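(* Consider a simple random walk on the complete graph $K_n$ starting at a uniformly random vertex, and let $\Gamma_t$ denote its trace after $t$ steps. Let $\tau_C$ be the cover time, i.e. the first time $t$ at which every vertex of $[n]$ has been visited, and let $\tau_{\mathcal H}$ be the first time $t$ at which $\Gamma_t$ is Hamiltonian. Then with high probability $\tau_{\mathcal H}=\tau_C+1$.
   Context: A simple random walk on $K_n$ (vertex set $[n]$) moves at each step from the current vertex to a uniformly random other vertex, independently of the past. The trace $\Gamma_t$ is the multigraph on $[n]$ whose edges are the edges traversed in the first $t$ steps (with multiplicity); Hamiltonicity refers to the underlying simple graph. The starting vertex counts as visited at time $0$. "With high probability" means with probability tending to $1$ as $n\to\infty$. *)

theory Defs
  imports "HOL-Probability.Probability" "HOL-Library.Extended_Nat" "HOL-Library.Multiset"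
begin

text \<open>
  A walk is given by an arbitrary process on a probability space, with vertex set
  \<open>{1..n}\<close>.  The assumption \<open>step\<close> conditions on the entire history, so it expresses
  uniformity of each move together with its independence of the past; summing over
  the \<open>n - 1\<close> other vertices shows that the walk stays put with probability \<open>0\<close>.
\<close>

locale complete_graph_walk = prob_space M for M :: "'a measure" +
  fixes n :: nat and X :: "nat \<Rightarrow> 'a \<Rightarrow> nat"
  assumes two_vertices: "n \<ge> 2"
    and rv: "\<And>t. random_variable (count_space {1..n}) (X t)"
    and start: "\<And>v. v \<in> {1..n} \<Longrightarrow> \<P>(\<omega> in M. X 0 \<omega> = v) = 1 / real n"
    and step: "\<And>t x w. \<P>(\<omega> in M. \<forall>s\<le>t. X s \<omega> = x s) > 0 \<Longrightarrow> w \<in> {1..n} \<Longrightarrow> w \<noteq> x t \<Longrightarrow>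
      \<P>(\<omega> in M. X (Suc t) \<omega> = w \<bar> \<forall>s\<le>t. X s \<omega> = x s) = 1 / (real n - 1)"

definition walk_trace :: "(nat \<Rightarrow> 'v) \<Rightarrow> nat \<Rightarrow> 'v set multiset" where
  "walk_trace x t = image_mset (\<lambda>s. {x s, x (Suc s)}) (mset_set {..<t})"

text \<open>
  A Hamilton cycle is listed without repeating its first vertex; \<open>length c \<ge> 3\<close> excludes
  the degenerate cycles, which do not exist in a simple graph.
\<close>

definition hamiltonian :: "'v set \<Rightarrow> 'v set set \<Rightarrow> bool" where
  "hamiltonian V E \<longleftrightarrow> (\<exists>c. distinct c \<and> set c = V \<and> length c \<ge> 3 \<and>
     (\<forall>i<length c. {c ! i, c ! (Suc i mod length c)} \<in> E))"

text \<open>The value is \<open>\<infinity>\<close> if \<open>P\<close> never holds.\<close>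

definition first_time :: "(nat \<Rightarrow> bool) \<Rightarrow> enat" where
  "first_time P = (INF t\<in>{t. P t}. enat t)"

definition cover_time :: "nat \<Rightarrow> (nat \<Rightarrow> nat) \<Rightarrow> enat" where
  "cover_time n x = first_time (\<lambda>t. \<forall>v\<in>{1..n}. \<exists>s\<le>t. x s = v)"

definition hamilton_time :: "nat \<Rightarrow> (nat \<Rightarrow> nat) \<Rightarrow> enat" where
  "hamilton_time n x = first_time (\<lambda>t. hamiltonian {1..n} (set_mset (walk_trace x t)))"

end

theory Submission
  imports Defs "HOL-Real_Asymp.Real_Asymp"
begin

text \<open>
  The vertex reached last has degree one in the trace at the cover time \<open>\<tau>\<close>, so the trace is not
  Hamiltonian before time \<open>\<tau> + 1\<close>.  For the converse, call a vertex small if it is visited fewer than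
  eight times before time \<open>T\<^sub>1 \<approx> (3/4) n ln n < \<tau>\<close>.  With high probability small vertices are
  pairwise at distance more than four in the trace, so the first eight steps out of each of the other
  vertices, together with the two steps around the first visit to each small vertex, form an expander
  \<open>\<Gamma>\<^sub>0\<close> with at most \<open>8 n\<close> edges.  By Posa's rotation argument a longest path of an expander can
  be rerouted to end in any of \<open>\<Omega>(n\<^sup>2)\<close> pairs of vertices.  A union bound over all sets of \<open>O(n)\<close> steps,
  of which there are only \<open>exp (O(n ln ln n))\<close>, shows that with high probability the trace closes a
  longest path of every expander that consists of \<open>O(n)\<close> of its edges.  Since the trace is
  connected, the closed path can be opened up and prolonged, and at most \<open>n\<close> such steps starting from
  \<open>\<Gamma>\<^sub>0\<close> produce a Hamilton cycle.

  All probabilities are bounded by exhibiting nonnegative supermartingales of the walk.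
\<close>

section \<open>Rotations of longest paths\<close>

text \<open>The obstacle is dependence: the expander and the steps that close its longest paths come
  from the same walk, and only one step is left after the cover time. Fixing a set of steps and the
  values of the walk at their ends makes the expander deterministic; summing over these values costs
  only a constant per pinned time, and the unpinned times remain for closing.

  The constants are linked. A set of s large vertices gets 7 s = (1 + 3 + 3) s vertices in its
  closed out-neighbourhood: the vertex itself, three that may be lost near a small vertex, two for
  expansion, and one to make up for large vertices that are themselves chosen neighbours of small
  ones. Confinement to 7 s targets beats the number of target sets only with more than seven steps
  per vertex, hence eight visits. The factor 3/4 in T1 is below 1, so that the walk has not covered
  by then, and large enough for close small pairs to be rare: their expected number is n times a
  power of ln n times \<open>n powr (- 3/4 * 7/4)\<close>.\<close>

fun pedges :: "'v list \<Rightarrow> 'v set set" where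
  "pedges (a # b # xs) = insert {a, b} (pedges (b # xs))"
| "pedges _ = {}"

lemma pedges_append:
  "xs \<noteq> [] \<Longrightarrow> ys \<noteq> [] \<Longrightarrow> pedges (xs @ ys) = insert {last xs, hd ys} (pedges xs \<union> pedges ys)"
proof (induction xs rule: pedges.induct)
  case ("2_2" v)
  then show ?case by (cases ys) auto
qed auto

lemma pedges_rev [simp]: "pedges (rev xs) = pedges xs"
proof (induction xs rule: pedges.induct)
  case (1 a b xs)
  have "pedges (rev (a # b # xs)) = pedges (rev (b # xs) @ [a])" by simp
  also have "\<dots> = insert {b, a} (pedges (rev (b # xs)))"
    by (subst pedges_append) (auto simp: last_rev)
  finally show ?case using 1 by (simp add: insert_commute)
qed auto

lemma pedges_conv_nth: "pedges xs = {{xs ! i, xs ! Suc i} | i. Suc i < length xs}"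
proof (induction xs rule: pedges.induct)
  case (1 a b xs)
  have "{{(a # b # xs) ! i, (a # b # xs) ! Suc i} | i. Suc i < length (a # b # xs)} =
      insert {a, b} {{(b # xs) ! i, (b # xs) ! Suc i} | i. Suc i < length (b # xs)}" (is "?L = ?R")
  proof (intro equalityI subsetI)
    fix e assume "e \<in> ?L"
    then obtain i where "e = {(a # b # xs) ! i, (a # b # xs) ! Suc i}" "Suc i < length (a # b # xs)"
      by blast
    then show "e \<in> ?R" by (cases i) auto
  next
    fix e assume "e \<in> ?R"
    then consider "e = {a, b}" | i where "e = {(b # xs) ! i, (b # xs) ! Suc i}" "Suc i < length (b # xs)"
      by blast
    then show "e \<in> ?L"
    proof cases
      case 1
      then show ?thesis by (intro CollectI exI[of _ 0]) auto
    next
      case 2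
      then show ?thesis by (intro CollectI exI[of _ "Suc i"]) auto
    qed
  qed
  then show ?case using 1 by simp
qed auto

definition path_in :: "'v set \<Rightarrow> 'v set set \<Rightarrow> 'v list \<Rightarrow> bool" where
  "path_in V E p \<longleftrightarrow> p \<noteq> [] \<and> distinct p \<and> set p \<subseteq> V \<and> pedges p \<subseteq> E"

definition longest_path :: "'v set \<Rightarrow> 'v set set \<Rightarrow> 'v list \<Rightarrow> bool" where
  "longest_path V E p \<longleftrightarrow> path_in V E p \<and> (\<forall>q. path_in V E q \<longrightarrow> length q \<le> length p)"

definition neighbours :: "'v set \<Rightarrow> 'v set set \<Rightarrow> 'v set \<Rightarrow> 'v set" where
  "neighbours V E S = {y \<in> V. y \<notin> S \<and> (\<exists>s\<in>S. {s, y} \<in> E)}"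

text \<open>The factor 2 is chosen to contradict the strict bound
  \<open>rotation_ends_neighbours\<close>, so that no set of rotation endpoints has size at most
  \<open>k\<close>.\<close>

definition expander :: "nat \<Rightarrow> 'v set \<Rightarrow> 'v set set \<Rightarrow> bool" where
  "expander k V E \<longleftrightarrow> (\<forall>S\<subseteq>V. S \<noteq> {} \<longrightarrow> card S \<le> k \<longrightarrow> 2 * card S \<le> card (neighbours V E S))"

text \<open>These pairs are tested against the steps of the walk: a step between \<open>a\<close>
  and \<open>b\<close> turns a longest path on at least three vertices into a cycle.\<close>

definition closing :: "'v set \<Rightarrow> 'v set set \<Rightarrow> 'v \<Rightarrow> 'v \<Rightarrow> bool" where
  "closing V E a b \<longleftrightarrow> (\<exists>p. longest_path V E p \<and> hd p = a \<and> last p = b)"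

lemma expander_mono:
  assumes "expander k V E" "E \<subseteq> E'" "finite V"
  shows "expander k V E'"
  unfolding expander_def
proof (intro allI impI)
  fix S assume "S \<subseteq> V" "S \<noteq> {}" "card S \<le> k"
  then have "2 * card S \<le> card (neighbours V E S)" using assms(1) by (simp add: expander_def)
  also have "\<dots> \<le> card (neighbours V E' S)"
    by (rule card_mono) (use assms in \<open>auto simp: neighbours_def\<close>)
  finally show "2 * card S \<le> card (neighbours V E' S)" .
qed

lemma length_path_le: "finite V \<Longrightarrow> path_in V E p \<Longrightarrow> length p \<le> card V"
  by (metis path_in_def distinct_card card_mono)

lemma path_in_rev: "path_in V E p \<Longrightarrow> path_in V E (rev p)"
  by (simp add: path_in_def)

lemma longest_path_rev: "longest_path V E p \<Longrightarrow> longest_path V E (rev p)"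
  by (simp add: longest_path_def path_in_rev)

lemma closing_sym:
  assumes "closing V E a b"
  shows "closing V E b a"
proof -
  obtain p where "longest_path V E p" "hd p = a" "last p = b" using assms by (auto simp: closing_def)
  then show ?thesis using longest_path_rev[of V E p] by (auto simp: closing_def hd_rev last_rev)
qed

lemma closing_in:
  assumes "closing V E a b"
  shows "a \<in> V \<and> b \<in> V"
proof -
  obtain p where "p \<noteq> []" "set p \<subseteq> V" "hd p = a" "last p = b"
    using assms by (auto simp: closing_def longest_path_def path_in_def)
  then show ?thesis using hd_in_set[of p] last_in_set[of p] by auto
qed

lemma ex_longest_path:
  assumes "finite V" "path_in V E q"
  shows "\<exists>p. longest_path V E p \<and> length q \<le> length p"
proof -
  have "\<exists>p. path_in V E p \<and> (\<forall>r. path_in V E r \<longrightarrow> length r \<le> length p)"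
    by (rule ex_has_greatest_nat[of _ _ _ "Suc (card V)"])
       (use assms length_path_le in \<open>auto simp: less_Suc_eq_le\<close>)
  then show ?thesis using assms(2) by (auto simp: longest_path_def)
qed

section \<open>Rotations with a fixed first vertex and Posa's bound on the neighbours of their
  endpoints\<close>

inductive rotation :: "'v set set \<Rightarrow> 'v list \<Rightarrow> 'v list \<Rightarrow> bool" for E p where
  start: "rotation E p p"
| pivot: "rotation E p (A @ w # B) \<Longrightarrow> B \<noteq> [] \<Longrightarrow> {w, last B} \<in> E \<Longrightarrow> rotation E p (A @ w # rev B)"

lemma pedges_pivot:
  "B \<noteq> [] \<Longrightarrow> pedges (A @ w # B) = insert {w, hd B} (pedges (A @ [w]) \<union> pedges B)"
  using pedges_append[of "A @ [w]" B] by simp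

lemma rotation_path:
  assumes "rotation E p q" "path_in V E p"
  shows "path_in V E q \<and> length q = length p \<and> set q = set p \<and> hd q = hd p"
  using assms
proof (induction rule: rotation.induct)
  case (pivot A w B)
  have "pedges (A @ w # rev B) = insert {w, last B} (pedges (A @ [w]) \<union> pedges B)"
    using pivot.hyps by (simp add: pedges_pivot hd_rev)
  moreover have "pedges (A @ w # B) = insert {w, hd B} (pedges (A @ [w]) \<union> pedges B)"
    using pivot.hyps by (simp add: pedges_pivot)
  moreover have "hd (A @ w # rev B) = hd (A @ w # B)" by (cases A) auto
  moreover have "set (A @ w # rev B) = set (A @ w # B)" "length (A @ w # rev B) = length (A @ w # B)"
    by simp_all
  moreover have "distinct (A @ w # rev B) = distinct (A @ w # B)" by simp
  ultimately show ?case using pivot unfolding path_in_def by auto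
qed auto

definition rotation_ends :: "'v set set \<Rightarrow> 'v list \<Rightarrow> 'v set" where
  "rotation_ends E p = {last q | q. rotation E p q}"

text \<open>An edge of the path at \<open>z\<close> can only be broken by a rotation if \<open>z\<close> or its neighbour
  along that edge becomes an endpoint.\<close>

lemma rotation_pedges:
  assumes "rotation E p q" "z \<notin> rotation_ends E p" "\<And>v. v \<in> rotation_ends E p \<Longrightarrow> {z, v} \<notin> pedges p"
  shows "{z, v} \<in> pedges q \<longleftrightarrow> {z, v} \<in> pedges p"
  using assms
proof (induction arbitrary: v rule: rotation.induct)
  case (pivot A w B)
  have e: "last B \<in> rotation_ends E p" "hd B \<in> rotation_ends E p"
    unfolding rotation_ends_def
    by (rule CollectI, rule exI[of _ "A @ w # B"], use pivot.hyps in simp,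
        rule CollectI, rule exI[of _ "A @ w # rev B"],
        use pivot.hyps rotation.pivot[OF pivot.hyps] in \<open>simp add: last_rev\<close>)
  have new: "pedges (A @ w # rev B) = insert {w, last B} (pedges (A @ [w]) \<union> pedges B)"
    using pivot.hyps by (simp add: pedges_pivot hd_rev)
  have old: "pedges (A @ w # B) = insert {w, hd B} (pedges (A @ [w]) \<union> pedges B)"
    using pivot.hyps by (simp add: pedges_pivot)
  have IH: "{z, v} \<in> pedges (A @ w # B) \<longleftrightarrow> {z, v} \<in> pedges p" for v
    by (rule pivot.IH) (use pivot.prems in auto)
  have "z \<noteq> w"
    using IH[of "hd B"] old pivot.prems(2)[OF e(2)] by auto
  moreover have "z \<noteq> hd B" "z \<noteq> last B" using e pivot.prems(1) by auto
  ultimately have "{z, v} \<noteq> {w, last B}" "{z, v} \<noteq> {w, hd B}" by (auto simp: doubleton_eq_iff)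
  then show ?case using IH[of v] old new by auto
qed auto

text \<open>Posa's lemma. If no neighbour of \<open>y\<close> along \<open>p\<close> were an
  endpoint, the path edges at \<open>y\<close> would survive all rotations; but pivoting at
  \<open>y\<close> makes its current successor an endpoint. Hence every external neighbour of the
  endpoint set is next to an endpoint on \<open>p\<close>. An endpoint has at most two neighbours on
  \<open>p\<close>, and \<open>last p\<close> has at most one, which makes the inequality
  strict.\<close>

lemma rotation_ends_neighbours:
  assumes "finite V" "longest_path V E p"
  shows "card (neighbours V E (rotation_ends E p)) < 2 * card (rotation_ends E p)"
proof -
  define R where "R = rotation_ends E p"
  have p: "path_in V E p" "p \<noteq> []" "distinct p" using assms by (auto simp: longest_path_def path_in_def)
  have R_sub: "R \<subseteq> set p"
    using rotation_path[OF _ p(1)] unfolding R_def rotation_ends_def path_in_def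
    by (auto, metis last_in_set)
  have lastR: "last p \<in> R" unfolding R_def rotation_ends_def using rotation.start by blast
  define J where "J = {i. i < length p \<and> p ! i \<in> R}"
  have finJ: "finite J" by (simp add: J_def)
  have injJ: "inj_on ((!) p) J" using p(3) by (auto simp: J_def inj_on_def nth_eq_iff_index_eq)
  have "R = (!) p ` J" using R_sub by (auto simp: J_def image_iff) (metis in_set_conv_nth subsetD)
  then have cardR: "card R = card J" using card_image[OF injJ] by simp
  have adj: "\<exists>v\<in>R. {y, v} \<in> pedges p" if y: "y \<in> neighbours V E R" for y
  proof (rule ccontr)
    assume no: "\<not> ?thesis"
    obtain q where q: "rotation E p q" "{last q, y} \<in> E" "y \<notin> R" "y \<in> V"
      using y by (auto simp: neighbours_def R_def rotation_ends_def)
    have qp: "path_in V E q" "length q = length p" using rotation_path[OF q(1) p(1)] by auto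
    have "y \<in> set q"
    proof (rule ccontr)
      assume "y \<notin> set q"
      then have "path_in V E (q @ [y])"
        using qp(1) q(2,4) by (auto simp: path_in_def pedges_append)
      then show False using assms(2) qp(2) unfolding longest_path_def by fastforce
    qed
    then obtain A B where AB: "q = A @ y # B" by (meson split_list)
    have "last q \<in> R" using q(1) by (auto simp: R_def rotation_ends_def)
    then have B: "B \<noteq> []" using AB q(3) by auto
    have "rotation E p (A @ y # rev B)"
      using rotation.pivot[of E p A y B] q(1,2) AB B by (simp add: insert_commute)
    then have hdR: "hd B \<in> R" using B by (force simp: R_def rotation_ends_def last_rev)
    have "{y, hd B} \<in> pedges q" unfolding AB using B by (simp add: pedges_pivot)
    then have "{y, hd B} \<in> pedges p"
      using rotation_pedges[OF q(1), of y "hd B"] q(3) no unfolding R_def by blast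
    then show False using no hdR by blast
  qed
  \<comment> \<open>The last index has no successor and is removed from the first image. In the
    second image the truncated \<open>i - 1\<close> at \<open>i = 0\<close> merely adds the vertex
    \<open>p ! 0\<close>.\<close>
  have "neighbours V E R \<subseteq> (\<lambda>i. p ! Suc i) ` (J - {length p - 1}) \<union> (\<lambda>i. p ! (i - 1)) ` J"
  proof
    fix y assume "y \<in> neighbours V E R"
    then obtain v where "v \<in> R" "{y, v} \<in> pedges p" using adj by blast
    then obtain i where i: "Suc i < length p" "{y, v} = {p ! i, p ! Suc i}"
      by (auto simp: pedges_conv_nth)
    then consider "y = p ! Suc i" "v = p ! i" | "y = p ! i" "v = p ! Suc i"
      by (auto simp: doubleton_eq_iff)
    then show "y \<in> (\<lambda>i. p ! Suc i) ` (J - {length p - 1}) \<union> (\<lambda>i. p ! (i - 1)) ` J"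
    proof cases
      case 1
      then have "i \<in> J - {length p - 1}" using i \<open>v \<in> R\<close> by (auto simp: J_def)
      then show ?thesis using 1 by blast
    next
      case 2
      then have "Suc i \<in> J" using i \<open>v \<in> R\<close> by (auto simp: J_def)
      then show ?thesis using 2 by (intro UnI2 image_eqI[of _ _ "Suc i"]) auto
    qed
  qed
  then have "card (neighbours V E R) \<le>
      card ((\<lambda>i. p ! Suc i) ` (J - {length p - 1}) \<union> (\<lambda>i. p ! (i - 1)) ` J)"
    by (rule card_mono[rotated]) (simp add: finJ)
  also have "\<dots> \<le> card (J - {length p - 1}) + card J"
    by (rule order.trans[OF card_Un_le]) (intro add_mono card_image_le, auto simp: finJ)
  also have "\<dots> < 2 * card J"
  proof -
    have "length p - 1 \<in> J" using p(2) lastR by (auto simp: J_def last_conv_nth)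
    then have "card (J - {length p - 1}) < card J" using finJ by (metis card_Diff1_less)
    then show ?thesis by simp
  qed
  finally show ?thesis using cardR by (simp add: R_def)
qed

text \<open>Rotations keep the length and the first vertex, so every endpoint reached is closing
  with \<open>hd p\<close>; expansion and Posa's bound are compatible only if there are more than
  \<open>k\<close> endpoints.\<close>

lemma closing_many_from:
  assumes "finite V" "expander k V E" "longest_path V E p"
  shows "k < card {b \<in> V. closing V E (hd p) b}"
proof -
  have p: "path_in V E p" using assms(3) by (simp add: longest_path_def)
  have sub: "rotation_ends E p \<subseteq> {b \<in> V. closing V E (hd p) b}"
  proof
    fix b assume "b \<in> rotation_ends E p"
    then obtain q where q: "rotation E p q" "b = last q" by (auto simp: rotation_ends_def)
    have "longest_path V E q" "hd q = hd p"
      using rotation_path[OF q(1) p] assms(3) by (auto simp: longest_path_def)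
    then have "closing V E (hd p) b" using q by (auto simp: closing_def)
    then show "b \<in> {b \<in> V. closing V E (hd p) b}" using closing_in[of V E "hd p" b] by simp
  qed
  then have subV: "rotation_ends E p \<subseteq> V" by auto
  have "last p \<in> rotation_ends E p" unfolding rotation_ends_def using rotation.start[of E p] by blast
  then have ne: "rotation_ends E p \<noteq> {}" by auto
  have "k < card (rotation_ends E p)"
  proof (rule ccontr)
    assume "\<not> ?thesis"
    then have "2 * card (rotation_ends E p) \<le> card (neighbours V E (rotation_ends E p))"
      using assms(2)[unfolded expander_def, rule_format, of "rotation_ends E p"] subV ne by simp
    then show False using rotation_ends_neighbours[OF assms(1,3)] by simp
  qed
  also have "\<dots> \<le> card {b \<in> V. closing V E (hd p) b}" using sub assms(1) by (intro card_mono) auto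
  finally show ?thesis .
qed

text \<open>Two rounds of rotations: the endpoints found from one longest path become, after
  reversal, the fixed first vertices of further longest paths.\<close>

lemma closing_many:
  assumes "finite V" "V \<noteq> {}" "expander k V E"
  obtains A where "A \<subseteq> V" "k < card A" "\<And>a. a \<in> A \<Longrightarrow> k < card {b \<in> V. closing V E a b}"
proof -
  obtain v where "v \<in> V" using assms(2) by blast
  then have "path_in V E [v]" by (simp add: path_in_def)
  from ex_longest_path[OF assms(1) this] obtain p where p: "longest_path V E p" by auto
  show thesis
  proof (rule that[of "{b \<in> V. closing V E (hd p) b}"])
    fix a assume "a \<in> {b \<in> V. closing V E (hd p) b}"
    then have "closing V E a (hd p)" by (simp add: closing_sym)
    then obtain q where "longest_path V E q" "hd q = a" by (auto simp: closing_def)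
    then show "k < card {b \<in> V. closing V E a b}" using closing_many_from[OF assms(1,3), of q] by simp
  qed (use closing_many_from[OF assms(1,3) p] in auto)
qed

lemma hamiltonian_of_path:
  assumes "path_in V E p" "set p = V" "{last p, hd p} \<in> E" "3 \<le> length p"
  shows "hamiltonian V E"
  unfolding hamiltonian_def
proof (intro exI[of _ p] conjI allI impI)
  fix i assume i: "i < length p"
  show "{p ! i, p ! (Suc i mod length p)} \<in> E"
  proof (cases "Suc i < length p")
    case True
    then have "{p ! i, p ! Suc i} \<in> pedges p" by (auto simp: pedges_conv_nth)
    then show ?thesis using True assms(1) by (auto simp: path_in_def)
  next
    case False
    then have Suc_i: "i = length p - 1" "Suc i = length p" using i by simp_all
    have "p \<noteq> []" using assms(4) by auto
    then have "p ! i = last p" "p ! (Suc i mod length p) = hd p"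
      by (simp add: Suc_i(1) last_conv_nth, simp add: Suc_i(2) hd_conv_nth)
    then show ?thesis using assms(3) by simp
  qed
qed (use assms in \<open>auto simp: path_in_def\<close>)

text \<open>The cycle is cut just before \<open>a\<close>, which gives a path from \<open>a\<close>
  through all of \<open>set p\<close>; then \<open>b\<close> goes in front.\<close>

lemma path_extend_cycle:
  assumes "path_in V E p" "{last p, hd p} \<in> E" "a \<in> set p" "b \<in> V" "b \<notin> set p" "{b, a} \<in> E"
  shows "\<exists>q. path_in V E q \<and> length q = Suc (length p)"
proof -
  obtain A B where AB: "p = A @ a # B" using assms(3) by (meson split_list)
  have pe: "pedges p \<subseteq> E" "distinct p" "set p \<subseteq> V" using assms(1) by (auto simp: path_in_def)
  have pe2: "pedges (a # B) \<subseteq> E" "pedges A \<subseteq> E"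
    using pe(1) unfolding AB by (cases "A = []"; simp add: pedges_append)+
  let ?q = "b # (a # B) @ A"
  have "pedges ((a # B) @ A) \<subseteq> E"
  proof (cases "A = []")
    case False
    then have "{last (a # B), hd A} \<in> E" using assms(2) by (simp add: AB)
    then show ?thesis using pe2 False by (subst pedges_append) auto
  qed (use pe2 in simp)
  then have "pedges ?q \<subseteq> E" using assms(6) by simp
  then have "path_in V E ?q" using pe assms(4,5) by (auto simp: path_in_def AB)
  then show ?thesis by (intro exI[of _ ?q]) (simp add: AB)
qed

section \<open>Hamilton cycles from expansion and closing edges\<close>

text \<open>Subgraphs are encoded by sets of times, because the union bound runs over such sets and
  over the values of the walk at the ends of their steps.\<close>

definition edges_at :: "(nat \<Rightarrow> 'v) \<Rightarrow> nat set \<Rightarrow> 'v set set" where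
  "edges_at x I = (\<lambda>t. {x t, x (Suc t)}) ` I"

lemma edges_at_mono: "I \<subseteq> J \<Longrightarrow> edges_at x I \<subseteq> edges_at x J"
  by (auto simp: edges_at_def)

lemma walk_crosses:
  fixes x :: "nat \<Rightarrow> 'v"
  assumes "s \<le> t" "x s \<in> C" "x t \<notin> C"
  shows "\<exists>r. s \<le> r \<and> r < t \<and> x r \<in> C \<and> x (Suc r) \<notin> C"
  using assms
proof (induction t)
  case (Suc t)
  show ?case
  proof (cases "s \<le> t \<and> x t \<notin> C")
    case True
    then show ?thesis using Suc by (meson less_SucI)
  next
    case False
    then show ?thesis using Suc.prems by (metis le_Suc_eq lessI)
  qed
qed auto

text \<open>Connectedness of the trace in the form needed to leave a cycle: the visit outside
  \<open>C\<close> may come before or after the visit inside, so the boundary is crossed in either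
  direction.\<close>

lemma walk_crosses_any:
  fixes x :: "nat \<Rightarrow> 'v"
  assumes "s \<le> m" "t \<le> m" "x s \<in> C" "x t \<notin> C"
  shows "\<exists>r<m. \<exists>a b. a \<in> C \<and> b \<notin> C \<and> {x r, x (Suc r)} = {a, b}"
proof (cases "s \<le> t")
  case True
  then obtain r where "r < t" "x r \<in> C" "x (Suc r) \<notin> C"
    using walk_crosses[of s t x C] assms by auto
  then show ?thesis using assms(2) by (intro exI[of _ r]) auto
next
  case False
  then obtain r where "r < s" "x r \<notin> C" "x (Suc r) \<in> C"
    using walk_crosses[of t s x "- C"] assms by auto
  then show ?thesis using assms(1) by (intro exI[of _ r]) (auto simp: insert_commute)
qed

text \<open>Each round adds two times: a step that closes a longest path to a cycle, and a step that
  joins this cycle to a vertex outside. The longest path then grows, so more than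
  \<open>card V\<close> rounds are impossible. The last use of \<open>boost\<close> concerns at most
  \<open>card I0 + 2 * card V\<close> times, which is the budget \<open>m\<close>.\<close>

lemma hamiltonian_of_expander:
  fixes x :: "nat \<Rightarrow> 'v"
  assumes V: "finite V" "x ` {..\<tau>} = V" "\<And>t. x t \<in> V"
    and I0: "I0 \<subseteq> {..\<tau>}" "card I0 + 2 * card V \<le> m" "expander k V (edges_at x I0)" "k \<ge> 1"
    and boost: "\<And>I. I \<subseteq> {..\<tau>} \<Longrightarrow> card I \<le> m \<Longrightarrow> expander k V (edges_at x I) \<Longrightarrow>
      \<exists>t\<le>\<tau>. closing V (edges_at x I) (x t) (x (Suc t))"
  shows "hamiltonian V (edges_at x {..\<tau>})"
proof (rule ccontr)
  assume not: "\<not> ?thesis"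
  have V0: "x 0 \<in> V" using V(3) .
  have grow: "\<exists>I p. I0 \<subseteq> I \<and> I \<subseteq> {..\<tau>} \<and> card I \<le> card I0 + 2 * j \<and> longest_path V (edges_at x I) p \<and> j \<le> length p"
    if "j \<le> Suc (card V)" for j
    using that
  proof (induction j)
    case 0
    have "path_in V (edges_at x I0) [x 0]" using V0 by (simp add: path_in_def)
    then show ?case using ex_longest_path[OF V(1)] I0(1) by fastforce
  next
    case (Suc j)
    then obtain I p where I: "I0 \<subseteq> I" "I \<subseteq> {..\<tau>}" "card I \<le> card I0 + 2 * j"
      and p: "longest_path V (edges_at x I) p" "j \<le> length p" by auto
    have ex: "expander k V (edges_at x I)"
      by (rule expander_mono[OF I0(3)]) (use I V in \<open>auto simp: edges_at_def\<close>)
    obtain t where t: "t \<le> \<tau>" "closing V (edges_at x I) (x t) (x (Suc t))"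
      using boost[OF I(2) _ ex] I(3) Suc.prems I0(2) by auto
    then obtain q where q: "longest_path V (edges_at x I) q" "hd q = x t" "last q = x (Suc t)"
      by (auto simp: closing_def)
    have qp: "path_in V (edges_at x I) q" using q(1) by (simp add: longest_path_def)
    have jq: "j \<le> length q" using p q by (auto simp: longest_path_def)
    \<comment> \<open>Expansion of a single vertex yields two neighbours and hence a path on three
      vertices, so a closed longest path is a genuine cycle as \<open>hamiltonian\<close>
      demands.\<close>
    have "2 * card {x 0} \<le> card (neighbours V (edges_at x I) {x 0})"
      using ex[unfolded expander_def, rule_format, of "{x 0}"] V0 I0(4) by simp
    then have "2 \<le> card (neighbours V (edges_at x I) {x 0})" by simp
    then obtain S where "S \<subseteq> neighbours V (edges_at x I) {x 0}" "card S = 2"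
      by (metis obtain_subset_with_card_n)
    then obtain a b where ab: "a \<noteq> b" "a \<in> neighbours V (edges_at x I) {x 0}" "b \<in> neighbours V (edges_at x I) {x 0}"
      by (auto simp: card_2_iff)
    then have "path_in V (edges_at x I) [a, x 0, b]"
      using V0 by (auto simp: path_in_def neighbours_def insert_commute)
    then have q3: "3 \<le> length q" using q(1) unfolding longest_path_def by force
    have path_all: "path_in V (edges_at x {..\<tau>}) q"
      using qp edges_at_mono[OF I(2), of x] by (auto simp: path_in_def)
    have close: "{last q, hd q} \<in> edges_at x {..\<tau>}" using t q by (auto simp: edges_at_def insert_commute)
    have "set q \<noteq> V" using hamiltonian_of_path[OF path_all _ close q3] not by blast
    moreover have qV: "set q \<subseteq> V" using qp by (simp add: path_in_def)
    ultimately obtain v where v: "v \<in> V" "v \<notin> set q" by blast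
    have "x t \<in> set q" using q(2) qp by (metis hd_in_set path_in_def)
    moreover obtain s where "s \<le> \<tau>" "x s = v" using v(1) V(2) by blast
    ultimately obtain r a b where r: "r < \<tau>" "a \<in> set q" "b \<notin> set q" "{x r, x (Suc r)} = {a, b}"
      using walk_crosses_any[of t \<tau> s x "set q"] t(1) v(2) by blast
    define I' where "I' = insert t (insert r I)"
    have bV: "b \<in> V" using r(4) V(3) by (metis insertE insertI1 insert_commute singletonD)
    have sub: "edges_at x I \<subseteq> edges_at x I'" by (auto simp: edges_at_def I'_def)
    have "path_in V (edges_at x I') q" using qp sub by (auto simp: path_in_def)
    moreover have "{last q, hd q} \<in> edges_at x I'" using q by (auto simp: edges_at_def I'_def insert_commute)
    moreover have "{b, a} \<in> edges_at x I'" using r(4) by (auto simp: edges_at_def I'_def insert_commute)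
    ultimately obtain q' where "path_in V (edges_at x I') q'" "length q' = Suc (length q)"
      using path_extend_cycle[of V _ q a b] r bV by blast
    then obtain p' where "longest_path V (edges_at x I') p'" "Suc j \<le> length p'"
      using ex_longest_path[OF V(1)] jq by (metis Suc_le_mono le_trans)
    moreover have "card I' \<le> card I + 2"
      unfolding I'_def using I(2) finite_subset[OF I(2)] by (simp add: card_insert_if)
    ultimately show ?case using I r(1) t(1) by (intro exI[of _ I'] exI[of _ p']) (auto simp: I'_def)
  qed
  obtain I p where "longest_path V (edges_at x I) p" "Suc (card V) \<le> length p"
    using grow[of "Suc (card V)"] by auto
  then show False using length_path_le[OF V(1)] unfolding longest_path_def by fastforce
qed

section \<open>A sparse expander in the trace\<close>

definition visits :: "(nat \<Rightarrow> 'v) \<Rightarrow> nat \<Rightarrow> 'v \<Rightarrow> nat" where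
  "visits x T v = card {s. s < T \<and> x s = v}"

definition small :: "(nat \<Rightarrow> 'v) \<Rightarrow> nat \<Rightarrow> 'v \<Rightarrow> bool" where
  "small x T v \<longleftrightarrow> visits x T v < 8"

text \<open>\<open>visits x t v\<close> counts the visits strictly before \<open>t\<close>, so the
  bound 8 selects the first eight departures from \<open>v\<close>.\<close>

definition outs :: "(nat \<Rightarrow> 'v) \<Rightarrow> nat \<Rightarrow> 'v \<Rightarrow> 'v set" where
  "outs x T v = {x (Suc t) | t. t < T \<and> x t = v \<and> visits x t v < 8}"

definition adjacent :: "(nat \<Rightarrow> 'v) \<Rightarrow> nat \<Rightarrow> 'v \<Rightarrow> 'v \<Rightarrow> bool" where
  "adjacent x T a b \<longleftrightarrow> (\<exists>t\<le>T. {x t, x (Suc t)} = {a, b})"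

fun reach :: "(nat \<Rightarrow> 'v) \<Rightarrow> nat \<Rightarrow> nat \<Rightarrow> 'v \<Rightarrow> 'v \<Rightarrow> bool" where
  "reach x T 0 a b \<longleftrightarrow> a = b"
| "reach x T (Suc l) a b \<longleftrightarrow> reach x T l a b \<or> (\<exists>c. adjacent x T a c \<and> reach x T l c b)"

lemma visits_Suc: "visits x (Suc T) v = visits x T v + (if x T = v then 1 else 0)"
proof -
  have "{s. s < Suc T \<and> x s = v} = (if x T = v then insert T {s. s < T \<and> x s = v} else {s. s < T \<and> x s = v})"
    by (auto simp: less_Suc_eq)
  then show ?thesis by (simp add: visits_def)
qed

lemma visits_0 [simp]: "visits x 0 v = 0"
  by (simp add: visits_def)

lemma card_first_visits: "card {t. t < T \<and> x t = v \<and> visits x t v < d} = min d (visits x T v)"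
proof (induction T)
  case (Suc T)
  have "{t. t < Suc T \<and> x t = v \<and> visits x t v < d} =
     (if x T = v \<and> visits x T v < d then insert T {t. t < T \<and> x t = v \<and> visits x t v < d}
      else {t. t < T \<and> x t = v \<and> visits x t v < d})"
    by (auto simp: less_Suc_eq)
  then show ?case using Suc by (simp add: visits_Suc)
qed simp

lemma adjacentI: "{x t, x (Suc t)} = {a, b} \<Longrightarrow> t \<le> T \<Longrightarrow> adjacent x T a b"
  by (auto simp: adjacent_def)

lemma edges_atI: "{x t, x (Suc t)} = {a, b} \<Longrightarrow> t \<in> I \<Longrightarrow> {a, b} \<in> edges_at x I"
  unfolding edges_at_def by (rule image_eqI[of _ _ t]) simp_all

lemma adjacent_sym: "adjacent x T a b \<longleftrightarrow> adjacent x T b a"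
  by (simp add: adjacent_def insert_commute)

lemma reach_step: "a = c \<or> adjacent x T a c \<Longrightarrow> reach x T l c b \<Longrightarrow> reach x T (Suc l) a b"
  by auto

lemma reach_4I:
  assumes "a = p \<or> adjacent x T a p" "p = q \<or> adjacent x T p q" "q = r \<or> adjacent x T q r"
    "r = b \<or> adjacent x T r b"
  shows "reach x T 4 a b"
proof -
  have "reach x T 0 b b" by simp
  from reach_step[OF assms(1) reach_step[OF assms(2) reach_step[OF assms(3) reach_step[OF assms(4) this]]]]
  show ?thesis by (simp add: numeral_eq_Suc)
qed

text \<open>The sets \<open>F u\<close> and \<open>N v\<close> stand for the two neighbours chosen for a small vertex and the
  out-neighbours chosen for a large one.\<close>

lemma expansion_count:
  fixes F N :: "'v \<Rightarrow> 'v set"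
  assumes fin: "finite S1" "finite S2" "\<And>u. u \<in> S1 \<Longrightarrow> finite (F u)" "\<And>v. v \<in> S2 \<Longrightarrow> finite (N v)"
    and F2: "\<And>u. u \<in> S1 \<Longrightarrow> card (F u) = 2"
    and F_disj: "\<And>u u'. u \<in> S1 \<Longrightarrow> u' \<in> S1 \<Longrightarrow> u \<noteq> u' \<Longrightarrow> F u \<inter> F u' = {}"
    and F_S1: "\<And>u. u \<in> S1 \<Longrightarrow> F u \<inter> S1 = {}"
    and N7: "7 * card S2 \<le> card (S2 \<union> (\<Union>v\<in>S2. N v))"
    and far: "\<And>v u u' b b'. v \<in> S2 \<Longrightarrow> b \<in> N v \<Longrightarrow> b' \<in> N v \<Longrightarrow> u \<in> S1 \<Longrightarrow> u' \<in> S1 \<Longrightarrow>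
      b \<in> insert u (F u) \<Longrightarrow> b' \<in> insert u' (F u') \<Longrightarrow> u = u'"
    and Y: "finite Y" "(\<Union>u\<in>S1. F u) - S2 \<subseteq> Y" "(\<Union>v\<in>S2. N v) - (S1 \<union> S2) \<subseteq> Y"
  shows "2 * card S1 + 2 * card S2 \<le> card Y"
proof -
  define A where "A = (\<Union>u\<in>S1. F u)"
  define B where "B = (\<Union>v\<in>S2. N v)"
  have finA: "finite A" and finB: "finite B" using fin by (auto simp: A_def B_def)
  have "card A = (\<Sum>u\<in>S1. card (F u))"
    unfolding A_def by (rule card_UN_disjoint) (use fin F_disj in auto)
  then have cardA: "card A = 2 * card S1" using F2 by simp
  \<comment> \<open>By \<open>far\<close>, all these vertices belong to one and the same small
    vertex \<open>u\<close> and its two chosen neighbours.\<close>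
  have "card (N v \<inter> (S1 \<union> A)) \<le> 3" if v: "v \<in> S2" for v
  proof (cases "N v \<inter> (S1 \<union> A) = {}")
    case False
    then obtain b u where b: "b \<in> N v" "u \<in> S1" "b \<in> insert u (F u)" by (auto simp: A_def)
    have "N v \<inter> (S1 \<union> A) \<subseteq> insert u (F u)"
    proof
      fix b' assume b': "b' \<in> N v \<inter> (S1 \<union> A)"
      then obtain u' where "u' \<in> S1" "b' \<in> insert u' (F u')" by (auto simp: A_def)
      then show "b' \<in> insert u (F u)" using far[OF v b(1), of b' u u'] b b' by auto
    qed
    then have "card (N v \<inter> (S1 \<union> A)) \<le> card (insert u (F u))"
      by (rule card_mono[rotated]) (use fin b in auto)
    also have "\<dots> \<le> 3" using F2[OF b(2)] fin(3)[OF b(2)] by (simp add: card_insert_if)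
    finally show ?thesis .
  qed simp
  then have "(\<Sum>v\<in>S2. card (N v \<inter> (S1 \<union> A))) \<le> (\<Sum>v\<in>S2. 3)" by (rule sum_mono)
  moreover have "card (B \<inter> (S1 \<union> A)) \<le> (\<Sum>v\<in>S2. card (N v \<inter> (S1 \<union> A)))"
  proof -
    have "B \<inter> (S1 \<union> A) = (\<Union>v\<in>S2. N v \<inter> (S1 \<union> A))" unfolding B_def by blast
    then show ?thesis by (simp only: card_UN_le[OF fin(2)])
  qed
  ultimately have BA: "card (B \<inter> (S1 \<union> A)) \<le> 3 * card S2" by simp
  have "card (S2 \<union> B) \<le> card (S2 \<union> (B \<inter> (S1 \<union> A)) \<union> (B - (S1 \<union> S2 \<union> A)))"
    by (rule card_mono) (use fin finB in auto)
  also have "\<dots> \<le> card S2 + card (B \<inter> (S1 \<union> A)) + card (B - (S1 \<union> S2 \<union> A))"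
    by (meson add_mono_thms_linordered_semiring(1) card_Un_le order.trans order_refl)
  finally have 1: "3 * card S2 \<le> card (B - (S1 \<union> S2 \<union> A))" using N7 BA by (simp add: B_def)
  \<comment> \<open>A neighbour chosen for a small vertex may lie in \<open>S2\<close>. This loses
    at most \<open>card S2\<close>, which one of the three new neighbours per large vertex
    repays.\<close>
  have "card A \<le> card ((A - S2) \<union> S2)" by (rule card_mono) (use fin finA in auto)
  also have "\<dots> \<le> card (A - S2) + card S2" by (rule card_Un_le)
  finally have 2: "2 * card S1 \<le> card (A - S2) + card S2" using cardA by simp
  have "card ((A - S2) \<union> (B - (S1 \<union> S2 \<union> A))) = card (A - S2) + card (B - (S1 \<union> S2 \<union> A))"
    by (rule card_Un_disjoint) (use finA finB in auto)
  moreover have "card ((A - S2) \<union> (B - (S1 \<union> S2 \<union> A))) \<le> card Y"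
    by (rule card_mono) (use Y in \<open>auto simp: A_def B_def\<close>)
  ultimately show ?thesis using 1 2 by linarith
qed

text \<open>A small vertex may be visited only once up to \<tau>, so just the steps into and out of
  its first visit are available; the latter can be the step from \<tau> to \<tau> + 1, which is
  where the additional step after covering enters. Any overlap between the neighbours chosen for two
  small vertices, even through a common large vertex, would join them by a chain of at most four
  trace edges, against \<open>far\<close>.\<close>

lemma sparse_expander:
  fixes x :: "nat \<Rightarrow> 'v"
  assumes V: "finite V" "\<And>t. x t \<in> V" "\<And>v. v \<in> V \<Longrightarrow> \<exists>s\<le>\<tau>. x s = v" and T: "T1 \<le> \<tau>"
    and noloop: "\<And>t. t \<le> \<tau> \<Longrightarrow> x t \<noteq> x (Suc t)"
    and start: "\<not> small x T1 (x 0)"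
    and turn: "\<And>t. Suc t \<le> \<tau> \<Longrightarrow> small x T1 (x (Suc t)) \<Longrightarrow> x t \<noteq> x (Suc (Suc t))"
    and far: "\<And>u u'. u \<in> V \<Longrightarrow> u' \<in> V \<Longrightarrow> small x T1 u \<Longrightarrow> small x T1 u' \<Longrightarrow> u \<noteq> u' \<Longrightarrow> \<not> reach x \<tau> 4 u u'"
    and expand: "\<And>S. S \<subseteq> V \<Longrightarrow> S \<noteq> {} \<Longrightarrow> card S \<le> k \<Longrightarrow> (\<And>v. v \<in> S \<Longrightarrow> \<not> small x T1 v) \<Longrightarrow>
      7 * card S \<le> card (S \<union> (\<Union>v\<in>S. outs x T1 v))"
  shows "\<exists>I \<subseteq> {..\<tau>}. card I \<le> 8 * card V \<and> expander k V (edges_at x I)"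
proof -
  define f where "f u = (LEAST t. x t = u)" for u
  have f: "x (f u) = u" "f u \<le> \<tau>" if u: "u \<in> V" for u
  proof -
    obtain s where s: "s \<le> \<tau>" "x s = u" using V(3)[OF u] by blast
    show "x (f u) = u" unfolding f_def by (rule LeastI[of _ s]) (rule s(2))
    have "f u \<le> s" unfolding f_def by (rule Least_le) (rule s(2))
    then show "f u \<le> \<tau>" using s(1) by simp
  qed
  \<comment> \<open>The starting vertex has no step into its first visit, so it has to be
    large.\<close>
  have f_pos: "f u > 0" if "u \<in> V" "small x T1 u" for u
    using f(1)[OF that(1)] that(2) start by (metis neq0_conv)
  define J where "J v = (if small x T1 v then {f v - 1, f v} else {t. t < T1 \<and> x t = v \<and> visits x t v < 8})" for v
  define I where "I = (\<Union>v\<in>V. J v)"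
  have I_sub: "I \<subseteq> {..\<tau>}" using f(2) T unfolding I_def J_def by (fastforce split: if_splits)
  have "card (J v) \<le> 8" for v
    unfolding J_def using card_first_visits[of T1 x v 8] by (auto simp: card_insert_if)
  then have "(\<Sum>v\<in>V. card (J v)) \<le> (\<Sum>v\<in>V. 8)" by (rule sum_mono)
  moreover have "card I \<le> (\<Sum>v\<in>V. card (J v))" unfolding I_def by (rule card_UN_le[OF V(1)])
  ultimately have I_card: "card I \<le> 8 * card V" by simp
  define sel where "sel u = {x (f u - 1), x (Suc (f u))}" for u
  have sel: "u \<notin> sel u" "card (sel u) = 2" "\<And>b. b \<in> sel u \<Longrightarrow> adjacent x \<tau> u b \<and> {u, b} \<in> edges_at x I \<and> b \<in> V"
    if u: "u \<in> V" "small x T1 u" for u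
  proof -
    obtain t where t: "f u = Suc t" using f_pos[OF u] by (cases "f u") auto
    have xt: "x (Suc t) = u" "Suc t \<le> \<tau>" using f[OF u(1)] t by auto
    have ne: "x t \<noteq> x (Suc t)" "x (Suc t) \<noteq> x (Suc (Suc t))" "x t \<noteq> x (Suc (Suc t))"
      using noloop[of t] noloop[of "Suc t"] turn[of t] xt u by auto
    then show "u \<notin> sel u" "card (sel u) = 2" unfolding sel_def t using xt by auto
    fix b assume b: "b \<in> sel u"
    have "J u \<subseteq> I" using u(1) unfolding I_def by blast
    then have I: "t \<in> I" "Suc t \<in> I" using u(2) t unfolding J_def by auto
    from b consider "b = x t" | "b = x (Suc (Suc t))" unfolding sel_def t by auto
    then show "adjacent x \<tau> u b \<and> {u, b} \<in> edges_at x I \<and> b \<in> V"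
    proof cases
      case 1
      then have e: "{x t, x (Suc t)} = {u, b}" using xt by auto
      show ?thesis using adjacentI[OF e, of \<tau>] edges_atI[OF e I(1)] xt(2) 1 V(2) by auto
    next
      case 2
      then have "{x (Suc t), x (Suc (Suc t))} = {u, b}" using xt by auto
      then show ?thesis using adjacentI[of x "Suc t" u b \<tau>] edges_atI[of x "Suc t" u b I] I(2) xt(2) 2 V(2) by simp
    qed
  qed
  have outs: "adjacent x \<tau> v b \<and> {v, b} \<in> edges_at x I \<and> b \<in> V"
    if v: "v \<in> V" "\<not> small x T1 v" "b \<in> outs x T1 v" for v b
  proof -
    obtain t where t: "t < T1" "x t = v" "visits x t v < 8" "b = x (Suc t)" using v(3) by (auto simp: outs_def)
    from t have "t \<in> I" using v unfolding I_def J_def by auto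
    have e: "{x t, x (Suc t)} = {v, b}" using t by simp
    show ?thesis
      using adjacentI[OF e, of \<tau>] edges_atI[OF e \<open>t \<in> I\<close>] t T V(2) by auto
  qed
  have "expander k V (edges_at x I)"
    unfolding expander_def
  proof (intro allI impI)
    fix S assume S: "S \<subseteq> V" "S \<noteq> {}" "card S \<le> k"
    define S1 where "S1 = {u \<in> S. small x T1 u}"
    define S2 where "S2 = {u \<in> S. \<not> small x T1 u}"
    have finS: "finite S" using S(1) V(1) finite_subset by blast
    have SV: "\<And>u. u \<in> S1 \<Longrightarrow> u \<in> V \<and> small x T1 u" "\<And>u. u \<in> S2 \<Longrightarrow> u \<in> V \<and> \<not> small x T1 u"
      using S(1) by (auto simp: S1_def S2_def)
    have selS: "adjacent x \<tau> u b" "adjacent x \<tau> b u" "{u, b} \<in> edges_at x I" "b \<in> V"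
      if "u \<in> S1" "b \<in> sel u" for u b
      using sel(3)[of u b] SV(1)[OF that(1)] that(2) adjacent_sym[of x \<tau> u b] by simp_all
    have outS: "adjacent x \<tau> v b" "adjacent x \<tau> b v" "{v, b} \<in> edges_at x I" "b \<in> V"
      if "v \<in> S2" "b \<in> outs x T1 v" for v b
      using outs[of v b] SV(2)[OF that(1)] that(2) adjacent_sym[of x \<tau> v b] by simp_all
    have "S = S1 \<union> S2" by (auto simp: S1_def S2_def)
    moreover have "card (S1 \<union> S2) = card S1 + card S2"
      by (rule card_Un_disjoint) (use finS in \<open>auto simp: S1_def S2_def\<close>)
    ultimately have cardS: "S = S1 \<union> S2" "card S = card S1 + card S2" by auto
    have "2 * card S1 + 2 * card S2 \<le> card (neighbours V (edges_at x I) S)"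
    proof (rule expansion_count[where F = sel and N = "outs x T1"])
      show "finite S1" "finite S2" using finS by (auto simp: S1_def S2_def)
      show "finite (sel u)" if "u \<in> S1" for u by (simp add: sel_def)
      show "finite (outs x T1 v)" if "v \<in> S2" for v
        by (rule finite_subset[OF _ V(1)]) (use outs that SV in blast)
      show "card (sel u) = 2" if "u \<in> S1" for u using sel(2) SV that by blast
      show "sel u \<inter> sel u' = {}" if "u \<in> S1" "u' \<in> S1" "u \<noteq> u'" for u u'
      proof (rule ccontr)
        assume "sel u \<inter> sel u' \<noteq> {}"
        then obtain b where b: "b \<in> sel u" "b \<in> sel u'" by blast
        have "adjacent x \<tau> u b" "adjacent x \<tau> b u'"
          using selS(1)[OF that(1) b(1)] selS(2)[OF that(2) b(2)] by simp_all
        then have "reach x \<tau> 4 u u'" by (intro reach_4I[of u b x \<tau> u' u' u']) auto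
        then show False using far[of u u'] SV that by blast
      qed
      show "sel u \<inter> S1 = {}" if "u \<in> S1" for u
      proof (rule ccontr)
        assume "sel u \<inter> S1 \<noteq> {}"
        then obtain u' where u': "u' \<in> sel u" "u' \<in> S1" by blast
        then have "reach x \<tau> 4 u u'" using selS(1)[OF that u'(1)] by (intro reach_4I[of u u' x \<tau> u' u' u']) auto
        moreover have "u \<noteq> u'" using u' sel(1) SV that by blast
        ultimately show False using far[of u u'] SV that u' by blast
      qed
      show "7 * card S2 \<le> card (S2 \<union> (\<Union>v\<in>S2. outs x T1 v))"
      proof (cases "S2 = {}")
        case False
        then show ?thesis using expand[of S2] SV S cardS by auto
      qed simp
      show "u = u'" if "v \<in> S2" "b \<in> outs x T1 v" "b' \<in> outs x T1 v" "u \<in> S1" "u' \<in> S1"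
        "b \<in> insert u (sel u)" "b' \<in> insert u' (sel u')" for v u u' b b'
      proof (rule ccontr)
        assume "u \<noteq> u'"
        have "u = b \<or> adjacent x \<tau> u b" using selS(1)[of u b] that by blast
        moreover have "b = v \<or> adjacent x \<tau> b v" using outS(2)[of v b] that by blast
        moreover have "v = b' \<or> adjacent x \<tau> v b'" using outS(1)[of v b'] that by blast
        moreover have "b' = u' \<or> adjacent x \<tau> b' u'" using selS(2)[of u' b'] that by blast
        ultimately have "reach x \<tau> 4 u u'" by (rule reach_4I)
        then show False using far[of u u'] SV that \<open>u \<noteq> u'\<close> by blast
      qed
      show "finite (neighbours V (edges_at x I) S)" using V(1) by (simp add: neighbours_def)
      show "(\<Union>u\<in>S1. sel u) - S2 \<subseteq> neighbours V (edges_at x I) S"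
      proof
        fix b assume b: "b \<in> (\<Union>u\<in>S1. sel u) - S2"
        then obtain u where u: "u \<in> S1" "b \<in> sel u" by blast
        have "b \<notin> S1"
        proof
          assume "b \<in> S1"
          then have "reach x \<tau> 4 u b" using selS(1)[OF u] by (intro reach_4I[of u b x \<tau> b b b]) auto
          moreover have "u \<noteq> b" using u sel(1) SV by blast
          ultimately show False using far[of u b] SV u \<open>b \<in> S1\<close> by blast
        qed
        then show "b \<in> neighbours V (edges_at x I) S"
          using u b selS[of u b] cardS(1) by (auto simp: neighbours_def)
      qed
      show "(\<Union>v\<in>S2. outs x T1 v) - (S1 \<union> S2) \<subseteq> neighbours V (edges_at x I) S"
      proof
        fix b assume b: "b \<in> (\<Union>v\<in>S2. outs x T1 v) - (S1 \<union> S2)"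
        then obtain v where v: "v \<in> S2" "b \<in> outs x T1 v" by blast
        then show "b \<in> neighbours V (edges_at x I) S"
          using b outS[of v b] cardS(1) by (auto simp: neighbours_def)
      qed
    qed
    then show "2 * card S \<le> card (neighbours V (edges_at x I) S)" using cardS by simp
  qed
  then show ?thesis using I_sub I_card by blast
qed

section \<open>The hitting times on a typical path\<close>

lemma first_time_eqI:
  assumes "Q t" "\<And>s. s < t \<Longrightarrow> \<not> Q s"
  shows "first_time Q = enat t"
  unfolding first_time_def
proof (rule antisym)
  show "(INF t\<in>{t. Q t}. enat t) \<le> enat t" by (rule INF_lower) (use assms in simp)
  show "enat t \<le> (INF t\<in>{t. Q t}. enat t)"
    by (rule INF_greatest) (use assms in \<open>auto simp: not_less[symmetric]\<close>)
qed

lemma first_time_le_iff: "first_time Q \<le> enat k \<longleftrightarrow> (\<exists>t\<le>k. Q t)"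
proof
  assume le: "first_time Q \<le> enat k"
  show "\<exists>t\<le>k. Q t"
  proof (rule ccontr)
    assume "\<not> ?thesis"
    then have "enat (Suc k) \<le> first_time Q"
      unfolding first_time_def by (intro INF_greatest) (auto simp: not_less_eq_eq[symmetric])
    then show False using le by (meson Suc_n_not_le_n enat_ord_simps(1) order.trans)
  qed
next
  assume "\<exists>t\<le>k. Q t"
  then obtain t where "t \<le> k" "Q t" by blast
  then show "first_time Q \<le> enat k"
    unfolding first_time_def by (intro INF_lower2[of t]) auto
qed

lemma set_walk_trace: "set_mset (walk_trace x t) = edges_at x {..<t}"
  by (simp add: walk_trace_def edges_at_def)

lemma hamiltonian_two_edges:
  assumes "hamiltonian V E" "v \<in> V"
  shows "\<exists>a b. a \<noteq> b \<and> {v, a} \<in> E \<and> {v, b} \<in> E"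
proof -
  obtain c where c: "distinct c" "set c = V" "length c \<ge> 3"
    "\<And>i. i < length c \<Longrightarrow> {c ! i, c ! (Suc i mod length c)} \<in> E"
    using assms(1) unfolding hamiltonian_def by blast
  obtain i where i: "i < length c" "c ! i = v" using assms(2) c(2) by (metis in_set_conv_nth)
  define p where "p = (if i = 0 then length c - 1 else i - 1)"
  define s where "s = Suc i mod length c"
  have p: "p < length c" "Suc p mod length c = i" using i c(3) by (auto simp: p_def)
  have s: "s < length c" using c(3) by (auto simp: s_def intro!: mod_less_divisor)
  have "p \<noteq> s"
  proof (cases "Suc i < length c")
    case True
    then show ?thesis using c(3) by (auto simp: p_def s_def)
  next
    case False
    then have "Suc i = length c" using i by simp
    then show ?thesis using c(3) by (auto simp: p_def s_def)
  qed
  then have "c ! p \<noteq> c ! s" using p s c(1) by (simp add: nth_eq_iff_index_eq)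
  moreover have "{v, c ! s} \<in> E" using c(4)[OF i(1)] i(2) by (simp add: s_def)
  moreover have "{v, c ! p} \<in> E" using c(4)[OF p(1)] p(2) i(2) by (simp add: insert_commute)
  ultimately show ?thesis by blast
qed

text \<open>The deterministic core: each negated hypothesis is one bad event in the form in which
  its probability is bounded later. The cover time is random, so the events refer to fixed times
  with \<open>T1 < \<tau> \<le> T2\<close>: smallness and closing steps are tested up to
  \<open>T1\<close>, distances up to \<open>T2\<close>.\<close>

lemma hamilton_time_eq:
  fixes x :: "nat \<Rightarrow> nat"
  assumes n: "n \<ge> 3" and k: "k \<ge> 1" and range: "\<And>t. x t \<in> {1..n}"
    and noloop: "\<not> (\<exists>t\<le>T2. x t = x (Suc t))"
    and cov: "\<not> (\<exists>v\<in>{1..n}. \<forall>s\<le>T2. x s \<noteq> v)"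
    and ncov: "\<not> (\<forall>v\<in>{1..n}. \<exists>s\<le>T1. x s = v)"
    and start: "\<not> small x T1 (x 0)"
    and turn: "\<not> (\<exists>t\<le>T2. small x T1 (x (Suc t)) \<and> x t = x (Suc (Suc t)))"
    and far: "\<not> (\<exists>u\<in>{1..n}. \<exists>u'\<in>{1..n}. u \<noteq> u' \<and> small x T1 u \<and> small x T1 u' \<and> reach x T2 4 u u')"
    and expand: "\<not> (\<exists>S\<subseteq>{1..n}. S \<noteq> {} \<and> card S \<le> k \<and> (\<forall>v\<in>S. \<not> small x T1 v) \<and>
      card (S \<union> (\<Union>v\<in>S. outs x T1 v)) < 7 * card S)"
    and boost: "\<not> (\<exists>I\<subseteq>{..T2}. card I \<le> 10 * n \<and> expander k {1..n} (edges_at x I) \<and>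
      (\<forall>t<T1. \<not> closing {1..n} (edges_at x I) (x t) (x (Suc t))))"
  shows "hamilton_time n x = cover_time n x + 1"
proof -
  define C where "C t \<longleftrightarrow> (\<forall>v\<in>{1..n}. \<exists>s\<le>t. x s = v)" for t
  have "C T2" using cov by (auto simp: C_def)
  define \<tau> where "\<tau> = (LEAST t. C t)"
  have \<tau>: "C \<tau>" "\<tau> \<le> T2" unfolding \<tau>_def using \<open>C T2\<close> by (auto intro: LeastI Least_le)
  have before: "\<not> C t" if "t < \<tau>" for t using that unfolding \<tau>_def by (rule not_less_Least)
  have cover: "cover_time n x = enat \<tau>"
    unfolding cover_time_def by (rule first_time_eqI) (use \<tau>(1) before in \<open>auto simp: C_def\<close>)
  have "T1 < \<tau>"
  proof (rule ccontr)
    assume "\<not> ?thesis"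
    then have "C T1" using \<tau>(1) unfolding C_def by (meson not_less order.trans)
    then show False using ncov by (simp add: C_def)
  qed
  have ham: "hamiltonian {1..n} (edges_at x {..\<tau>})"
  proof -
    have reach_mono: "reach x T2 l a b" if "reach x \<tau> l a b" for l a b
      using that
    proof (induction l arbitrary: a)
      case (Suc l)
      have "adjacent x T2 a c" if "adjacent x \<tau> a c" for c
        using that \<tau>(2) by (auto simp: adjacent_def intro: order.trans)
      then show ?case using Suc by auto
    qed simp
    have "\<exists>I\<subseteq>{..\<tau>}. card I \<le> 8 * card {1..n} \<and> expander k {1..n} (edges_at x I)"
    proof (rule sparse_expander[where ?T1.0 = T1])
      show "\<exists>s\<le>\<tau>. x s = v" if "v \<in> {1..n}" for v using \<tau>(1) that by (auto simp: C_def)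
      show "x t \<noteq> x (Suc t)" if "t \<le> \<tau>" for t using noloop that \<tau>(2) by auto
      show "x t \<noteq> x (Suc (Suc t))" if "Suc t \<le> \<tau>" "small x T1 (x (Suc t))" for t
        using turn that \<tau>(2) by auto
      show "\<not> reach x \<tau> 4 u u'" if "u \<in> {1..n}" "u' \<in> {1..n}" "small x T1 u" "small x T1 u'" "u \<noteq> u'" for u u'
        using far reach_mono[of 4 u u'] that by blast
      show "7 * card S \<le> card (S \<union> (\<Union>v\<in>S. outs x T1 v))"
        if "S \<subseteq> {1..n}" "S \<noteq> {}" "card S \<le> k" "\<And>v. v \<in> S \<Longrightarrow> \<not> small x T1 v" for S
        using expand that by (meson not_less)
    qed (use range \<open>T1 < \<tau>\<close> start in auto)
    then obtain I0 where I0: "I0 \<subseteq> {..\<tau>}" "card I0 \<le> 8 * n" "expander k {1..n} (edges_at x I0)" by auto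
    \<comment> \<open>The budget \<open>10 * n\<close> consists of \<open>8 * n\<close> for the
      sparse expander and \<open>2 * n\<close> for prolonging the path.\<close>
    show ?thesis
    proof (rule hamiltonian_of_expander[where m = "10 * n" and k = k and ?I0.0 = I0])
      show "x ` {..\<tau>} = {1..n}" 
      proof (intro equalityI subsetI)
        fix v assume "v \<in> {1..n}"
        then obtain s where "s \<le> \<tau>" "x s = v" using \<tau>(1) unfolding C_def by blast
        then show "v \<in> x ` {..\<tau>}" by auto
      qed (use range in blast)
      show "\<exists>t\<le>\<tau>. closing {1..n} (edges_at x I) (x t) (x (Suc t))"
        if I: "I \<subseteq> {..\<tau>}" "card I \<le> 10 * n" "expander k {1..n} (edges_at x I)" for I
      proof -
        have "I \<subseteq> {..T2}" using I(1) \<tau>(2) by auto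
        moreover have "\<not> (I \<subseteq> {..T2} \<and> card I \<le> 10 * n \<and> expander k {1..n} (edges_at x I) \<and>
            (\<forall>t<T1. \<not> closing {1..n} (edges_at x I) (x t) (x (Suc t))))"
          using boost unfolding not_ex by (rule spec)
        ultimately obtain t where "t < T1" "closing {1..n} (edges_at x I) (x t) (x (Suc t))"
          using I(2,3) by auto
        then show ?thesis using \<open>T1 < \<tau>\<close> by (intro exI[of _ t]) auto
      qed
    qed (use I0 k range in auto)
  qed
  have "hamilton_time n x = enat (Suc \<tau>)"
    unfolding hamilton_time_def
  proof (rule first_time_eqI)
    show "hamiltonian {1..n} (set_mset (walk_trace x (Suc \<tau>)))"
      using ham by (simp add: set_walk_trace lessThan_Suc_atMost)
    fix t assume t: "t < Suc \<tau>"
    show "\<not> hamiltonian {1..n} (set_mset (walk_trace x t))"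
    proof
      assume h: "hamiltonian {1..n} (set_mset (walk_trace x t))"
      define v where "v = x \<tau>"
      obtain m where m: "\<tau> = Suc m" using \<open>T1 < \<tau>\<close> by (cases \<tau>) auto
      have new: "x s \<noteq> v" if s: "s < \<tau>" for s
      proof
        assume "x s = v"
        have "C m" unfolding C_def
        proof
          fix w assume "w \<in> {1..n}"
          then obtain r where "r \<le> \<tau>" "x r = w" using \<tau>(1) unfolding C_def by blast
          then show "\<exists>r\<le>m. x r = w"
            using \<open>x s = v\<close> s m v_def
            by (cases "r = \<tau>") (auto simp: less_Suc_eq_le intro!: exI[of _ "if r = \<tau> then s else r"])
        qed
        then show False using before[of m] m by simp
      qed
      obtain a b where ab: "a \<noteq> b" "{v, a} \<in> edges_at x {..<t}" "{v, b} \<in> edges_at x {..<t}"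
        using hamiltonian_two_edges[OF h, of v] range by (auto simp: set_walk_trace v_def)
      have only: "{v, c} = {x m, v}" if c: "{v, c} \<in> edges_at x {..<t}" for c
      proof -
        obtain s where s: "s < t" "{v, c} = {x s, x (Suc s)}" using c by (auto simp: edges_at_def)
        have "x s \<noteq> v" using new[of s] s(1) t by simp
        then have "x (Suc s) = v" using s(2) by (metis insertE insertI1 singletonD)
        then have "Suc s = \<tau>" using new[of "Suc s"] s(1) t by (cases "Suc s < \<tau>") auto
        then show ?thesis using s(2) m \<open>x (Suc s) = v\<close> by simp
      qed
      show False using only[OF ab(2)] only[OF ab(3)] ab(1) by (metis doubleton_eq_iff)
    qed
  qed
  then show ?thesis using cover by (simp add: one_enat_def)
qed

section \<open>Supermartingale bounds for the walk\<close>

declare One_nat_def [simp del]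

context complete_graph_walk
begin

section \<open>The law of finite histories\<close>

lemma X_eq_sets [measurable]: "{\<omega> \<in> space M. X t \<omega> = w} \<in> sets M"
proof -
  have "{\<omega> \<in> space M. X t \<omega> = w} = X t -` ({w} \<inter> {1..n}) \<inter> space M"
    using measurable_space[OF rv[of t]] by auto
  then show ?thesis
    using measurable_sets[OF rv[of t], of "{w} \<inter> {1..n}"] by simp
qed

lemma X_range: "\<omega> \<in> space M \<Longrightarrow> X t \<omega> \<in> {1..n}"
  using measurable_space[OF rv[of t]] by auto

lemma cylinder_sets [measurable]:
  "{\<omega> \<in> space M. \<forall>s\<le>t. X s \<omega> = x s} \<in> sets M"
  by measurable

definition cyl :: "nat \<Rightarrow> (nat \<Rightarrow> nat) \<Rightarrow> real" where
  "cyl t x = \<P>(\<omega> in M. \<forall>s\<le>t. X s \<omega> = x s)"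

lemma cyl_nonneg: "0 \<le> cyl t x"
  by (simp add: cyl_def)

lemma cyl_split: "cyl t x = (\<Sum>w\<in>{1..n}. cyl (Suc t) (x(Suc t := w)))"
proof -
  have "cyl t x = prob (\<Union>w\<in>{1..n}. {\<omega> \<in> space M. \<forall>s\<le>Suc t. X s \<omega> = (x(Suc t := w)) s})"
    unfolding cyl_def
    by (rule arg_cong[of _ _ prob]) (use X_range in \<open>force simp: le_Suc_eq\<close>)
  also have "\<dots> = (\<Sum>w\<in>{1..n}. cyl (Suc t) (x(Suc t := w)))"
    unfolding cyl_def
  proof (rule finite_measure_finite_Union)
    show "disjoint_family_on (\<lambda>w. {\<omega> \<in> space M. \<forall>s\<le>Suc t. X s \<omega> = (x(Suc t := w)) s}) {1..n}"
      unfolding disjoint_family_on_def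
    proof (intro ballI impI)
      fix v w :: nat assume "v \<noteq> w"
      then show "{\<omega> \<in> space M. \<forall>s\<le>Suc t. X s \<omega> = (x(Suc t := v)) s} \<inter>
          {\<omega> \<in> space M. \<forall>s\<le>Suc t. X s \<omega> = (x(Suc t := w)) s} = {}"
        by (auto dest!: spec[of _ "Suc t"])
    qed
  qed auto
  finally show ?thesis .
qed

text \<open>The conditional law says nothing about histories of probability 0, but their extensions
  are null as well; so the product rule holds for every history and can be used under sums.\<close>

lemma cyl_step:
  assumes "w \<in> {1..n}" "w \<noteq> x t"
  shows "cyl (Suc t) (x(Suc t := w)) = cyl t x / (real n - 1)"
proof (cases "cyl t x > 0")
  case True
  have eq: "{\<omega> \<in> space M. X (Suc t) \<omega> = w \<and> (\<forall>s\<le>t. X s \<omega> = x s)} =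
      {\<omega> \<in> space M. \<forall>s\<le>Suc t. X s \<omega> = (x(Suc t := w)) s}"
    by (auto simp: le_Suc_eq)
  have "\<P>(\<omega> in M. X (Suc t) \<omega> = w \<bar> \<forall>s\<le>t. X s \<omega> = x s) = 1 / (real n - 1)"
    using step[of t x w] True assms by (simp add: cyl_def)
  then show ?thesis
    using True unfolding cond_prob_def cyl_def eq by (simp add: field_simps)
next
  case False
  then have 0: "cyl t x = 0" using cyl_nonneg[of t x] by simp
  have "cyl (Suc t) (x(Suc t := w)) \<le> cyl t x"
    unfolding cyl_split[of t x] by (rule member_le_sum[where f = "\<lambda>w. cyl (Suc t) (x(Suc t := w))"])
       (use assms in \<open>auto simp: cyl_nonneg\<close>)
  then show ?thesis using 0 cyl_nonneg[of "Suc t" "x(Suc t := w)"] by simp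
qed

lemma cyl_stay:
  assumes "x t \<in> {1..n}"
  shows "cyl (Suc t) (x(Suc t := x t)) = 0"
proof -
  have "cyl t x = cyl (Suc t) (x(Suc t := x t)) + (\<Sum>w\<in>{1..n}-{x t}. cyl (Suc t) (x(Suc t := w)))"
    unfolding cyl_split[of t x] by (rule sum.remove) (use assms in auto)
  also have "(\<Sum>w\<in>{1..n}-{x t}. cyl (Suc t) (x(Suc t := w))) = (\<Sum>w\<in>{1..n}-{x t}. cyl t x / (real n - 1))"
    by (rule sum.cong) (auto simp: cyl_step)
  also have "\<dots> = cyl t x"
    using assms two_vertices by (simp add: of_nat_diff)
  finally show ?thesis by (simp del: fun_upd_apply)
qed

text \<open>Extensional functions represent every history up to time \<open>t\<close> exactly once,
  so expectations become finite sums.\<close>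

definition hists :: "nat \<Rightarrow> (nat \<Rightarrow> nat) set" where
  "hists t = PiE {..t} (\<lambda>_. {1..n})"

lemma finite_hists [simp]: "finite (hists t)"
  by (auto simp: hists_def intro: finite_PiE)

lemma path_event_eq:
  assumes "\<And>x y. (\<And>s. s \<le> t \<Longrightarrow> x s = y s) \<Longrightarrow> Q x = Q y"
  shows "{\<omega> \<in> space M. Q (\<lambda>s. X s \<omega>)} =
    (\<Union>x\<in>{x\<in>hists t. Q x}. {\<omega> \<in> space M. \<forall>s\<le>t. X s \<omega> = x s})"
proof (intro set_eqI iffI)
  fix \<omega> assume \<omega>: "\<omega> \<in> {\<omega> \<in> space M. Q (\<lambda>s. X s \<omega>)}"
  define x where "x = restrict (\<lambda>s. X s \<omega>) {..t}"
  have "x \<in> hists t" unfolding x_def hists_def using \<omega> X_range by (auto simp del: atLeastAtMost_iff)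
  moreover have "Q x" using \<omega> assms[of x "\<lambda>s. X s \<omega>"] by (simp add: x_def)
  moreover have "\<forall>s\<le>t. X s \<omega> = x s" by (simp add: x_def)
  ultimately show "\<omega> \<in> (\<Union>x\<in>{x\<in>hists t. Q x}. {\<omega> \<in> space M. \<forall>s\<le>t. X s \<omega> = x s})"
    using \<omega> by blast
next
  fix \<omega> assume "\<omega> \<in> (\<Union>x\<in>{x\<in>hists t. Q x}. {\<omega> \<in> space M. \<forall>s\<le>t. X s \<omega> = x s})"
  then obtain x where "Q x" "\<omega> \<in> space M" "\<forall>s\<le>t. X s \<omega> = x s" by blast
  then show "\<omega> \<in> {\<omega> \<in> space M. Q (\<lambda>s. X s \<omega>)}" using assms[of "\<lambda>s. X s \<omega>" x] by simp
qed

lemma path_event_sets: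
  assumes "\<And>x y. (\<And>s. s \<le> t \<Longrightarrow> x s = y s) \<Longrightarrow> Q x = Q y"
  shows "{\<omega> \<in> space M. Q (\<lambda>s. X s \<omega>)} \<in> sets M"
  by (subst path_event_eq[of t Q], erule assms) (intro sets.finite_UN, auto)

lemma sum_hists_Suc:
  "(\<Sum>x\<in>hists (Suc t). f x) = (\<Sum>x\<in>hists t. \<Sum>y\<in>{1..n}. f (x(Suc t := y)))"
proof -
  have "hists (Suc t) = (\<lambda>(y, x). x(Suc t := y)) ` ({1..n} \<times> hists t)"
    unfolding hists_def atMost_Suc PiE_insert_eq by simp
  moreover have "inj_on (\<lambda>(y, x). x(Suc t := y)) ({1..n} \<times> hists t)"
    unfolding hists_def by (rule inj_combinator) simp
  ultimately have "(\<Sum>x\<in>hists (Suc t). f x) = (\<Sum>(y,x)\<in>{1..n} \<times> hists t. f (x(Suc t := y)))"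
    by (simp add: sum.reindex case_prod_unfold)
  also have "\<dots> = (\<Sum>y\<in>{1..n}. \<Sum>x\<in>hists t. f (x(Suc t := y)))"
    by (rule sum.cartesian_product[symmetric])
  also have "\<dots> = (\<Sum>x\<in>hists t. \<Sum>y\<in>{1..n}. f (x(Suc t := y)))"
    by (rule sum.swap)
  finally show ?thesis .
qed

lemma sum_hists_0: "(\<Sum>x\<in>hists 0. f x) = (\<Sum>v\<in>{1..n}. f ((\<lambda>_. undefined)(0 := v)))"
proof -
  have "hists 0 = (\<lambda>v. (\<lambda>_. undefined)(0 := v)) ` {1..n}"
    by (auto simp: hists_def PiE_insert_eq)
  moreover have "inj_on (\<lambda>v. (\<lambda>_. undefined)(0 := v)) {1..n}"
    by (rule inj_onI) (metis fun_upd_same)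
  ultimately show ?thesis using sum.reindex[of _ "{1..n}" f] by (simp only: o_def)
qed

text \<open>The expectation of \<open>F t\<close> is a finite sum weighted by cylinder
  probabilities, so the supermartingale property is an inequality between sums over the
  \<open>n - 1\<close> possible moves. Markov's inequality at the horizon \<open>T\<close> then
  bounds any event that forces \<open>F T\<close> to be at least \<open>c\<close>; \<open>b\<close>
  bounds the mean of \<open>F 0\<close> under the uniform start.\<close>

lemma supermartingale_bound:
  fixes F :: "nat \<Rightarrow> (nat \<Rightarrow> nat) \<Rightarrow> real"
  assumes adapted: "\<And>t x y. (\<And>s. s \<le> t \<Longrightarrow> x s = y s) \<Longrightarrow> F t x = F t y"
    and super: "\<And>t x. t < T \<Longrightarrow> (\<And>s. s \<le> t \<Longrightarrow> x s \<in> {1..n}) \<Longrightarrow>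
      (\<Sum>y\<in>{1..n}-{x t}. F (Suc t) (x(Suc t := y))) \<le> (real n - 1) * F t x"
    and nonneg: "\<And>x. 0 \<le> F T x"
    and Q: "\<And>x. (\<And>s. x s \<in> {1..n}) \<Longrightarrow> Q x \<Longrightarrow> c \<le> F T x"
    and c: "c > 0"
    and start_le: "(\<Sum>v\<in>{1..n}. F 0 (\<lambda>_. v)) \<le> real n * b"
  shows "\<P>(\<omega> in M. Q (\<lambda>t. X t \<omega>)) \<le> b / c"
proof -
  define m where "m t = (\<Sum>x\<in>hists t. cyl t x * F t x)" for t
  have m_Suc: "m (Suc t) \<le> m t" if "t < T" for t
  proof -
    have "(\<Sum>y\<in>{1..n}. cyl (Suc t) (x(Suc t := y)) * F (Suc t) (x(Suc t := y))) \<le> cyl t x * F t x"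
      if x: "x \<in> hists t" for x
    proof -
      have xs: "x s \<in> {1..n}" if "s \<le> t" for s
        using x that by (auto simp: hists_def simp del: atLeastAtMost_iff)
      have "(\<Sum>y\<in>{1..n}. cyl (Suc t) (x(Suc t := y)) * F (Suc t) (x(Suc t := y))) =
          (\<Sum>y\<in>{1..n}-{x t}. cyl (Suc t) (x(Suc t := y)) * F (Suc t) (x(Suc t := y)))"
        by (subst sum.remove[of _ "x t"]) (use xs[of t] cyl_stay[of x t] in auto)
      also have "\<dots> = (\<Sum>y\<in>{1..n}-{x t}. cyl t x / (real n - 1) * F (Suc t) (x(Suc t := y)))"
        by (rule sum.cong) (auto simp: cyl_step)
      also have "\<dots> = cyl t x / (real n - 1) * (\<Sum>y\<in>{1..n}-{x t}. F (Suc t) (x(Suc t := y)))"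
        by (simp add: sum_distrib_left)
      also have "\<dots> \<le> cyl t x / (real n - 1) * ((real n - 1) * F t x)"
        by (intro mult_left_mono super[OF \<open>t < T\<close> xs]) (use two_vertices cyl_nonneg in auto)
      finally show ?thesis using two_vertices by simp
    qed
    then show ?thesis unfolding m_def sum_hists_Suc by (rule sum_mono)
  qed
  have m_T: "m t \<le> m 0" if "t \<le> T" for t
    using that by (induction t) (auto intro: order.trans[OF m_Suc])
  have cyl0: "cyl 0 x = 1 / real n" if "x 0 \<in> {1..n}" for x
    using start[OF that] by (simp add: cyl_def)
  have "m 0 = (\<Sum>v\<in>{1..n}. F 0 (\<lambda>_. v)) / real n"
    unfolding m_def sum_hists_0 sum_divide_distrib
    by (rule sum.cong) (auto simp: cyl0 intro!: adapted)
  also have "\<dots> \<le> b"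
    using start_le two_vertices by (simp add: field_simps)
  finally have m0: "m 0 \<le> b" .
  let ?U = "\<Union>x\<in>{x\<in>hists T. c \<le> F T x}. {\<omega> \<in> space M. \<forall>s\<le>T. X s \<omega> = x s}"
  have "\<P>(\<omega> in M. Q (\<lambda>t. X t \<omega>)) \<le> \<P>(\<omega> in M. c \<le> F T (\<lambda>t. X t \<omega>))"
  proof (rule finite_measure_mono)
    show "{\<omega> \<in> space M. c \<le> F T (\<lambda>t. X t \<omega>)} \<in> events"
      by (rule path_event_sets[of T]) (metis adapted)
  qed (use Q X_range in auto)
  also have "\<dots> = prob ?U"
    by (subst path_event_eq[of T]) (use adapted in metis)+
  also have "\<dots> \<le> (\<Sum>x\<in>{x\<in>hists T. c \<le> F T x}. cyl T x)"
    unfolding cyl_def by (rule finite_measure_subadditive_finite) auto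
  also have "\<dots> \<le> (\<Sum>x\<in>{x\<in>hists T. c \<le> F T x}. cyl T x * (F T x / c))"
  proof (rule sum_mono)
    fix x assume "x \<in> {x \<in> hists T. c \<le> F T x}"
    then have "1 \<le> F T x / c" using c by simp
    then show "cyl T x \<le> cyl T x * (F T x / c)"
      using mult_left_mono[of 1 "F T x / c" "cyl T x"] cyl_nonneg[of T x] by simp
  qed
  also have "\<dots> \<le> (\<Sum>x\<in>hists T. cyl T x * (F T x / c))"
    by (intro sum_mono2) (use c nonneg cyl_nonneg in auto)
  also have "\<dots> = m T / c" by (simp add: m_def sum_divide_distrib)
  also have "\<dots> \<le> b / c" using m0 m_T[of T] c by (simp add: divide_right_mono)
  finally show ?thesis .
qed

end

section \<open>Events determined by finitely many steps, and their union bound\<close>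

definition finitary :: "((nat \<Rightarrow> 'v) \<Rightarrow> bool) \<Rightarrow> bool" where
  "finitary Q \<longleftrightarrow> (\<exists>T. \<forall>x y. (\<forall>s\<le>T. x s = y s) \<longrightarrow> Q x = Q y)"

lemma finitaryI: "(\<And>x y. (\<And>s. s \<le> T \<Longrightarrow> x s = y s) \<Longrightarrow> Q x = Q y) \<Longrightarrow> finitary Q"
  unfolding finitary_def by blast

lemma finitary_conj:
  assumes "finitary Q" "finitary R"
  shows "finitary (\<lambda>x. Q x \<and> R x)"
proof -
  obtain T T' where T: "\<And>x y. (\<forall>s\<le>T. x s = y s) \<Longrightarrow> Q x = Q y" "\<And>x y. (\<forall>s\<le>T'. x s = y s) \<Longrightarrow> R x = R y"
    using assms unfolding finitary_def by blast
  show ?thesis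
  proof (rule finitaryI[of "max T T'"])
    fix x y :: "nat \<Rightarrow> 'a" assume "\<And>s. s \<le> max T T' \<Longrightarrow> x s = y s"
    then show "(Q x \<and> R x) = (Q y \<and> R y)" using T[of x y] by simp
  qed
qed

lemma visits_cong: "(\<And>s. s < T \<Longrightarrow> x s = y s) \<Longrightarrow> visits x T v = visits y T v"
  unfolding visits_def by (rule arg_cong[of _ _ card]) auto

lemma small_cong: "(\<And>s. s < T \<Longrightarrow> x s = y s) \<Longrightarrow> small x T v = small y T v"
  unfolding small_def using visits_cong[of T x y v] by simp

lemma outs_cong:
  assumes xy: "\<And>s. s \<le> T \<Longrightarrow> x s = y s"
  shows "outs x T v = outs y T v"
proof -
  have "t < T \<Longrightarrow> visits x t v = visits y t v" for t using visits_cong[of t x y v] xy by simp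
  then show ?thesis unfolding outs_def using xy by (intro Collect_cong ex_cong1) auto
qed

lemma finitary_small: "finitary (\<lambda>x. small x T v)"
  by (rule finitaryI[of T], rule small_cong) auto

lemma finitary_confined: "finitary (\<lambda>x. \<forall>v\<in>S. \<not> small x T v \<and> outs x T v \<subseteq> W)"
proof (rule finitaryI[of T])
  fix x y :: "nat \<Rightarrow> 'a" assume xy: "\<And>s. s \<le> T \<Longrightarrow> x s = y s"
  have "small x T v = small y T v" for v by (rule small_cong) (use xy in auto)
  moreover have "outs x T v = outs y T v" for v by (rule outs_cong) (use xy in auto)
  ultimately show "(\<forall>v\<in>S. \<not> small x T v \<and> outs x T v \<subseteq> W) = (\<forall>v\<in>S. \<not> small y T v \<and> outs y T v \<subseteq> W)"
    by simp
qed

lemma finitary_reach: "finitary (\<lambda>x. reach x T l a b)"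
proof (rule finitaryI[of "Suc T"])
  fix x y :: "nat \<Rightarrow> 'a" assume xy: "\<And>s. s \<le> Suc T \<Longrightarrow> x s = y s"
  have "adjacent x T a b = adjacent y T a b" for a b
    unfolding adjacent_def by (rule ex_cong1) (use xy in auto)
  then show "reach x T l a b = reach y T l a b"
    by (induction l arbitrary: a) auto
qed

lemma finitary_at: "finitary (\<lambda>x. x t = v)"
  by (rule finitaryI[of t]) simp

lemma finitary_pinned:
  assumes "finite P"
  shows "finitary (\<lambda>x. \<forall>s\<in>P. x s = g s)"
proof -
  obtain T where "\<forall>s\<in>P. s \<le> T" using assms by (meson finite_nat_set_iff_bounded_le)
  then show ?thesis by (intro finitaryI[of T]) auto
qed

lemma finitary_bex: "finite A \<Longrightarrow> (\<And>a. a \<in> A \<Longrightarrow> finitary (Q a)) \<Longrightarrow> finitary (\<lambda>x. \<exists>a\<in>A. Q a x)"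
proof (induction A rule: finite_induct)
  case empty
  then show ?case by (simp add: finitary_def)
next
  case (insert a A)
  have "finitary (\<lambda>x. \<not> (\<not> Q a x \<and> \<not> (\<exists>a\<in>A. Q a x)))"
  proof -
    have neg: "finitary (\<lambda>x. \<not> R x)" if "finitary R" for R :: "(nat \<Rightarrow> 'b) \<Rightarrow> bool"
      using that unfolding finitary_def by simp
    show ?thesis by (intro neg finitary_conj) (use insert in auto)
  qed
  then show ?case by simp
qed

context complete_graph_walk
begin

definition path_prob :: "((nat \<Rightarrow> nat) \<Rightarrow> bool) \<Rightarrow> real" where
  "path_prob Q = \<P>(\<omega> in M. Q (\<lambda>t. X t \<omega>))"

lemma path_prob_nonneg: "0 \<le> path_prob Q"
  by (simp add: path_prob_def)

lemma finitary_sets: "finitary Q \<Longrightarrow> {\<omega> \<in> space M. Q (\<lambda>t. X t \<omega>)} \<in> sets M"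
  unfolding finitary_def using path_event_sets[of _ Q] by blast

lemma path_prob_union:
  assumes "finite A" "\<And>a. a \<in> A \<Longrightarrow> finitary (Q a)"
    and "\<And>x. (\<And>s. x s \<in> {1..n}) \<Longrightarrow> R x \<Longrightarrow> \<exists>a\<in>A. Q a x"
  shows "path_prob R \<le> (\<Sum>a\<in>A. path_prob (Q a))"
proof -
  have "path_prob R \<le> prob (\<Union>a\<in>A. {\<omega> \<in> space M. Q a (\<lambda>t. X t \<omega>)})"
    unfolding path_prob_def
  proof (rule finite_measure_mono)
    show "{\<omega> \<in> space M. R (\<lambda>t. X t \<omega>)} \<subseteq> (\<Union>a\<in>A. {\<omega> \<in> space M. Q a (\<lambda>t. X t \<omega>)})"
    proof
      fix \<omega> assume "\<omega> \<in> {\<omega> \<in> space M. R (\<lambda>t. X t \<omega>)}"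
      then show "\<omega> \<in> (\<Union>a\<in>A. {\<omega> \<in> space M. Q a (\<lambda>t. X t \<omega>)})"
        using assms(3)[of "\<lambda>t. X t \<omega>"] X_range by blast
    qed
    show "(\<Union>a\<in>A. {\<omega> \<in> space M. Q a (\<lambda>t. X t \<omega>)}) \<in> events"
      using assms(1,2) finitary_sets by (intro sets.finite_UN) auto
  qed
  also have "\<dots> \<le> (\<Sum>a\<in>A. path_prob (Q a))"
    unfolding path_prob_def using assms(1,2) finitary_sets
    by (intro finite_measure_subadditive_finite) auto
  finally show ?thesis .
qed

lemma path_prob_False: "(\<And>x. (\<And>s. x s \<in> {1..n}) \<Longrightarrow> \<not> R x) \<Longrightarrow> path_prob R = 0"
  using path_prob_union[of "{}" "\<lambda>_. R" R] path_prob_nonneg[of R] by simp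

lemma path_prob_supermartingale:
  fixes F :: "nat \<Rightarrow> (nat \<Rightarrow> nat) \<Rightarrow> real"
  assumes "\<And>t x y. (\<And>s. s \<le> t \<Longrightarrow> x s = y s) \<Longrightarrow> F t x = F t y"
    and "\<And>t x. t < T \<Longrightarrow> (\<And>s. s \<le> t \<Longrightarrow> x s \<in> {1..n}) \<Longrightarrow>
      (\<Sum>y\<in>{1..n}-{x t}. F (Suc t) (x(Suc t := y))) \<le> (real n - 1) * F t x"
    and "\<And>x. 0 \<le> F T x"
    and "\<And>x. (\<And>s. x s \<in> {1..n}) \<Longrightarrow> Q x \<Longrightarrow> c \<le> F T x"
    and "c > 0"
    and "(\<Sum>v\<in>{1..n}. F 0 (\<lambda>_. v)) \<le> real n * b"
  shows "path_prob Q \<le> b / c"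
  unfolding path_prob_def using assms by (rule supermartingale_bound)

text \<open>The indicator that a loop has occurred starts at 0 and is a supermartingale, because
  every admissible move leaves the current vertex.\<close>

lemma path_prob_loop: "path_prob (\<lambda>x. \<exists>t\<le>T. x t = x (Suc t)) = 0"
proof -
  have "path_prob (\<lambda>x. \<exists>t\<le>T. x t = x (Suc t)) \<le> 0 / 1"
  proof (rule path_prob_supermartingale[where F = "\<lambda>t x. if \<exists>s<t. x s = x (Suc s) then 1 else 0" and T = "Suc T"])
    fix t :: nat and x :: "nat \<Rightarrow> nat" assume x: "\<And>s. s \<le> t \<Longrightarrow> x s \<in> {1..n}"
    have "(\<Sum>y\<in>{1..n}-{x t}. if \<exists>s<Suc t. (x(Suc t := y)) s = (x(Suc t := y)) (Suc s) then 1 else 0) =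
      (\<Sum>y\<in>{1..n}-{x t}. if \<exists>s<t. x s = x (Suc s) then 1 else (0::real))"
      by (rule sum.cong) (auto simp: less_Suc_eq)
    then show "(\<Sum>y\<in>{1..n}-{x t}. if \<exists>s<Suc t. (x(Suc t := y)) s = (x(Suc t := y)) (Suc s) then 1 else 0) \<le>
       (real n - 1) * (if \<exists>s<t. x s = x (Suc s) then 1 else 0)"
      using x[of t] two_vertices by (simp add: of_nat_diff)
  qed (auto simp: less_Suc_eq_le)
  then show ?thesis using path_prob_nonneg[of "\<lambda>x. \<exists>t\<le>T. x t = x (Suc t)"] by simp
qed

section \<open>Upper and lower bounds for the cover time\<close>

lemma card_others: "v \<in> {1..n} \<Longrightarrow> real (card ({1..n} - {v})) = real n - 1"
  using two_vertices by (simp add: of_nat_diff)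

text \<open>From any other vertex a step misses \<open>v\<close> with probability exactly
  \<open>q = (n - 2) / (n - 1)\<close>, so \<open>F\<close> is the conditional probability that
  \<open>v\<close> stays unvisited up to \<open>T\<close>.\<close>

lemma path_prob_unvisited:
  assumes "v \<in> {1..n}"
  shows "path_prob (\<lambda>x. \<forall>s\<le>T. x s \<noteq> v) \<le> (1 - 1 / (real n - 1)) ^ T"
proof -
  define q where "q = 1 - 1 / (real n - 1)"
  have q: "q \<ge> 0" using two_vertices by (simp add: q_def)
  have "path_prob (\<lambda>x. \<forall>s\<le>T. x s \<noteq> v) \<le> q ^ T / 1"
  proof (rule path_prob_supermartingale[where F = "\<lambda>t x. if \<forall>s\<le>t. x s \<noteq> v then q ^ (T - t) else 0" and T = T])
    fix t :: nat and x :: "nat \<Rightarrow> nat" assume t: "t < T" and x: "\<And>s. s \<le> t \<Longrightarrow> x s \<in> {1..n}"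
    show "(\<Sum>y\<in>{1..n}-{x t}. if \<forall>s\<le>Suc t. (x(Suc t := y)) s \<noteq> v then q ^ (T - Suc t) else 0) \<le>
       (real n - 1) * (if \<forall>s\<le>t. x s \<noteq> v then q ^ (T - t) else 0)"
    proof (cases "\<forall>s\<le>t. x s \<noteq> v")
      case True
      have "(\<Sum>y\<in>{1..n}-{x t}. if \<forall>s\<le>Suc t. (x(Suc t := y)) s \<noteq> v then q ^ (T - Suc t) else 0) =
         (\<Sum>y\<in>{1..n}-{x t}. if y \<in> {v} then 0 else q ^ (T - Suc t))"
        by (rule sum.cong) (use True in \<open>auto simp: le_Suc_eq\<close>)
      also have "\<dots> = real (card (({1..n}-{x t}) \<inter> - {v})) * q ^ (T - Suc t)"
        by (subst sum.If_cases) auto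
      also have "({1..n}-{x t}) \<inter> - {v} = {1..n} - {x t, v}" by auto
      also have "real (card ({1..n} - {x t, v})) = real n - 2"
        using assms x[of t] True two_vertices by (subst card_Diff_subset) (auto simp: of_nat_diff)
      also have "(real n - 2) * q ^ (T - Suc t) = (real n - 1) * (q * q ^ (T - Suc t))"
        using two_vertices by (simp add: q_def field_simps)
      also have "q * q ^ (T - Suc t) = q ^ (T - t)" using t by (metis Suc_diff_Suc power_Suc)
      finally show ?thesis using True by simp
    next
      case False
      have "(\<Sum>y\<in>{1..n}-{x t}. if \<forall>s\<le>Suc t. (x(Suc t := y)) s \<noteq> v then q ^ (T - Suc t) else 0) =
         (\<Sum>y\<in>{1..n}-{x t}. 0)"
        by (rule sum.cong) (use False in \<open>auto simp: le_Suc_eq\<close>)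
      then show ?thesis using False by auto
    qed
  next
    show "(\<Sum>w\<in>{1..n}. if \<forall>s\<le>0::nat. w \<noteq> v then q ^ (T - 0) else 0) \<le> real n * q ^ T"
      by (rule order.trans[OF sum_mono[of _ _ "\<lambda>_. q ^ T"]]) (use q in auto)
  qed (use q in auto)
  then show ?thesis by (simp add: q_def)
qed

lemma path_prob_uncovered: "path_prob (\<lambda>x. \<exists>v\<in>{1..n}. \<forall>s\<le>T. x s \<noteq> v) \<le> real n * (1 - 1 / (real n - 1)) ^ T"
proof -
  have "path_prob (\<lambda>x. \<exists>v\<in>{1..n}. \<forall>s\<le>T. x s \<noteq> v) \<le> (\<Sum>v\<in>{1..n}. path_prob (\<lambda>x. \<forall>s\<le>T. x s \<noteq> v))"
    by (rule path_prob_union) (auto intro!: finitaryI[of T])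
  also have "\<dots> \<le> (\<Sum>v\<in>{1..n}. (1 - 1 / (real n - 1)) ^ T)"
    by (rule sum_mono) (rule path_prob_unvisited)
  finally show ?thesis by simp
qed

text \<open>If \<open>N\<close> vertices are unvisited, then \<open>1 / (N + 1)\<close> grows in expectation by a factor of at most
  \<open>1 + 1 / (n - 1)\<close> in one step.\<close>

lemma path_prob_covered_early:
  "path_prob (\<lambda>x. \<forall>v\<in>{1..n}. \<exists>s\<le>T. x s = v) \<le> (1 + 1 / (real n - 1)) ^ T / real n"
proof -
  define q where "q = 1 + 1 / (real n - 1)"
  have q: "q \<ge> 0" using two_vertices by (simp add: q_def)
  have nq: "(real n - 1) * q = real n" using two_vertices by (simp add: q_def field_simps)
  define F where "F t x = q ^ (T - t) / (1 + real (card ({1..n} - x ` {..t})))" for t and x :: "nat \<Rightarrow> nat"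
  have "path_prob (\<lambda>x. \<forall>v\<in>{1..n}. \<exists>s\<le>T. x s = v) \<le> (q ^ T / real n) / 1"
  proof (rule path_prob_supermartingale[where F = F and T = T])
    fix t :: nat and x y :: "nat \<Rightarrow> nat" assume "\<And>s. s \<le> t \<Longrightarrow> x s = y s"
    then have "x ` {..t} = y ` {..t}" by (intro image_cong) auto
    then show "F t x = F t y" by (simp add: F_def)
  next
    fix t :: nat and x :: "nat \<Rightarrow> nat" assume t: "t < T" and x: "\<And>s. s \<le> t \<Longrightarrow> x s \<in> {1..n}"
    define U where "U = {1..n} - x ` {..t}"
    have U: "finite U" "U \<subseteq> {1..n} - {x t}" by (auto simp: U_def)
    have "real (card U) \<le> real (card ({1..n} - {x t}))" by (intro of_nat_mono card_mono) (use U in auto)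
    then have cU: "real (card U) \<le> real n - 1" using card_others[of "x t"] x[of t] by (simp only:)
    have new: "{1..n} - (x(Suc t := y)) ` {..Suc t} = U - {y}" for y
      unfolding U_def atMost_Suc by auto
    have "(\<Sum>y\<in>{1..n}-{x t}. F (Suc t) (x(Suc t := y))) =
        (\<Sum>y\<in>{1..n}-{x t}. q ^ (T - Suc t) * (1 / (1 + real (card (U - {y})))))"
      unfolding F_def new by simp
    also have "\<dots> = q ^ (T - Suc t) * (\<Sum>y\<in>{1..n}-{x t}. 1 / (1 + real (card (U - {y}))))"
      by (simp add: sum_distrib_left)
    also have "(\<Sum>y\<in>{1..n}-{x t}. 1 / (1 + real (card (U - {y})))) =
      (\<Sum>y\<in>U. 1 / (1 + real (card (U - {y})))) + (\<Sum>y\<in>{1..n}-{x t}-U. 1 / (1 + real (card (U - {y}))))"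
      using U by (subst sum.subset_diff[of U]) auto
    also have "(\<Sum>y\<in>U. 1 / (1 + real (card (U - {y})))) = (\<Sum>y\<in>U. 1 / real (card U))"
    proof (rule sum.cong)
      fix y assume "y \<in> U"
      then have "card U > 0" using U(1) by (auto simp: card_gt_0_iff)
      then show "1 / (1 + real (card (U - {y}))) = 1 / real (card U)"
        using \<open>y \<in> U\<close> U(1) by (simp add: of_nat_diff)
    qed simp
    \<comment> \<open>This is not an equality when \<open>U\<close> is empty. Moves into
      \<open>U\<close> contribute at most 1 and the others
      \<open>(n - 1 - card U) / (1 + card U)\<close>, in total at most
      \<open>n / (1 + card U)\<close>.\<close>
    also have "(\<Sum>y\<in>U. 1 / real (card U)) \<le> 1" by simp
    also have "(\<Sum>y\<in>{1..n}-{x t}-U. 1 / (1 + real (card (U - {y})))) = (\<Sum>y\<in>{1..n}-{x t}-U. 1 / (1 + real (card U)))"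
      by (rule sum.cong) auto
    also have "\<dots> = (real n - 1 - real (card U)) / (1 + real (card U))"
      using card_others[of "x t"] x[of t] U cU by (simp add: card_Diff_subset of_nat_diff)
    also have "1 + (real n - 1 - real (card U)) / (1 + real (card U)) = (real n - 1) * q / (1 + real (card U))"
      unfolding nq by (simp add: field_simps)
    also have "q ^ (T - Suc t) * ((real n - 1) * q / (1 + real (card U))) =
        (real n - 1) * (q * q ^ (T - Suc t) / (1 + real (card U)))" by simp
    also have "q * q ^ (T - Suc t) = q ^ (T - t)" using t by (metis Suc_diff_Suc power_Suc)
    finally show "(\<Sum>y\<in>{1..n}-{x t}. F (Suc t) (x(Suc t := y))) \<le> (real n - 1) * F t x"
      using q by (simp add: F_def U_def mult_left_mono)
  next
    have "F 0 (\<lambda>_. v) = q ^ T / real n" if "v \<in> {1..n}" for v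
      unfolding F_def using card_others[OF that] by simp
    then show "(\<Sum>v\<in>{1..n}. F 0 (\<lambda>_. v)) \<le> real n * (q ^ T / real n)" by simp
  next
    fix x :: "nat \<Rightarrow> nat" assume "\<forall>v\<in>{1..n}. \<exists>s\<le>T. x s = v"
    then have "{1..n} - x ` {..T} = {}" by (auto simp del: atLeastAtMost_iff)
    then show "1 \<le> F T x" by (simp add: F_def)
  qed (use q in \<open>auto simp: F_def\<close>)
  then show ?thesis by (simp add: q_def)
qed

text \<open>The factor \<open>7/8\<close> is \<open>1 - 2 z\<close>, where \<open>z = 1/16\<close> is the weight given below to each visit to a
  small vertex.\<close>

definition avoid_rate :: "nat \<Rightarrow> real" where
  "avoid_rate m = 1 - real m * (7/8) / (real n - 1)"

lemma avoid_rate_bounds: "n \<ge> 5 \<Longrightarrow> m \<le> 2 \<Longrightarrow> 1/2 \<le> avoid_rate m \<and> avoid_rate m \<le> 1"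
  by (auto simp: avoid_rate_def field_simps)

lemma sum_pin: "finite A \<Longrightarrow> 0 \<le> c \<Longrightarrow> (\<Sum>y\<in>A. (if y = (a::nat) then c else 0) * f y) \<le> c * max 0 (f a)" for c :: real
  by (cases "a \<in> A", subst sum.mono_neutral_right[of _ "A \<inter> {a}"]) (auto simp: mult_left_mono sum.neutral)

text \<open>The supermartingale carries an additional factor \<open>2\<close> while the walk is in \<open>U\<close>, because from there
  the next step avoids \<open>U\<close> with a slightly larger probability.\<close>

lemma path_prob_pinned_small:
  assumes n: "n \<ge> 5" and U: "U \<subseteq> {1..n}" "card U \<le> 2" and P: "finite P"
  shows "path_prob (\<lambda>x. (\<forall>s\<in>P. x s = g s) \<and> (\<forall>u\<in>U. small x T1 u)) \<le>
    2 * 16 ^ 14 * (2 / (real n - 1)) ^ card P * avoid_rate (card U) ^ (T1 - card P)"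
proof -
  define l where "l = avoid_rate (card U)"
  have l: "1/2 \<le> l" "l \<le> 1" using avoid_rate_bounds[OF n U(2)] by (auto simp: l_def)
  obtain T where T: "P \<subseteq> {..T}" "T1 \<le> T"
  proof -
    obtain T' where "\<forall>s\<in>P. s \<le> T'" using P by (meson finite_nat_set_iff_bounded_le)
    then show thesis by (intro that[of "max T' T1"]) (auto intro: max.coboundedI1)
  qed
  \<comment> \<open>A pinned time is hit with probability at most \<open>1 / (n - 1)\<close>; the
    remaining factor \<open>1/2\<close> in its weight absorbs \<open>h\<close>. An unpinned time
    before \<open>T1\<close> is damped by \<open>1/16\<close> in \<open>U\<close> and renormalised
    by the mean weight \<open>l\<close>.\<close>
  define \<phi> where "\<phi> s y = (if s \<in> P then (if y = g s then (real n - 1) / 2 else 0)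
     else if s < T1 then (if y \<in> U then 1/16 else 1) / l else 1)" for s y
  define h where "h t y = (if t < T1 \<and> y \<in> U then 2 else (1::real))" for t y
  have finU: "finite U" using U(1) finite_subset by blast
  have hb: "1 \<le> h t y" "h t y \<le> 2" for t y by (auto simp: h_def)
  have phi0: "0 \<le> \<phi> s y" for s y using l n by (auto simp: \<phi>_def)
  have nn: "real n - 1 \<ge> 4" using n by simp
  have hn: "real n - 1 \<le> (real n - 1) * h t v" for t v
    using hb(1)[of t v] nn by (simp add: mult_le_cancel_left1)
  have step: "(\<Sum>y\<in>{1..n}-{v}. \<phi> (Suc t) y * h (Suc t) y) \<le> (real n - 1) * h t v" if v: "v \<in> {1..n}" for t v
  proof -
    consider "Suc t \<in> P" | "Suc t \<notin> P" "Suc t < T1" | "Suc t \<notin> P" "\<not> Suc t < T1" by blast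
    then show ?thesis
    proof cases
      case 1
      then have "(\<Sum>y\<in>{1..n}-{v}. \<phi> (Suc t) y * h (Suc t) y) \<le>
          (real n - 1) / 2 * max 0 (h (Suc t) (g (Suc t)))"
        unfolding \<phi>_def using sum_pin[of "{1..n}-{v}" "(real n - 1)/2" "g (Suc t)" "h (Suc t)"] n by simp
      also have "\<dots> \<le> (real n - 1) / 2 * 2" using hb n by (intro mult_left_mono) auto
      also have "\<dots> = real n - 1" by simp
      also have "\<dots> \<le> (real n - 1) * h t v" by (rule hn)
      finally show ?thesis .
    next
      case 2
      have "(\<Sum>y\<in>{1..n}-{v}. \<phi> (Suc t) y * h (Suc t) y) =
          (\<Sum>y\<in>{1..n}-{v}. if y \<in> U then 1/8 / l else 1 / l)"
        by (rule sum.cong) (use 2 in \<open>auto simp: \<phi>_def h_def\<close>)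
      also have "\<dots> = real (card (({1..n}-{v}) \<inter> U)) * (1/8 / l) + real (card (({1..n}-{v}) \<inter> - U)) * (1 / l)"
        by (subst sum.If_cases) auto
      also have "({1..n}-{v}) \<inter> U = U - {v}" using U(1) by auto
      also have "({1..n}-{v}) \<inter> - U = {1..n} - insert v U" by auto
      also have "real (card ({1..n} - insert v U)) = real n - real (card (insert v U))"
      proof -
        have "card (insert v U) \<le> card {1..n}" by (rule card_mono) (use U v in auto)
        then show ?thesis using U v finU by (subst card_Diff_subset) (auto simp: of_nat_diff)
      qed
      also have "real (card (U - {v})) * (1/8 / l) + (real n - real (card (insert v U))) * (1 / l) \<le> (real n - 1) * h t v"
      proof (cases "v \<in> U")
        case True
        then have "card U \<ge> 1" using finU by (metis One_nat_def Suc_leI card_gt_0_iff empty_iff)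
        then have c: "card U = 1 \<or> card U = 2" using U(2) by auto
        have c1: "real (card (U - {v})) = real (card U) - 1" using True finU \<open>card U \<ge> 1\<close> by (simp add: of_nat_diff)
        have c2: "insert v U = U" using True by auto
        \<comment> \<open>From inside \<open>U\<close> the next step has a mean weight bounded by 1
          rather than by \<open>l\<close>; since \<open>1 \<le> 2 * l\<close>, the factor
          \<open>h t v = 2\<close> pays for this.\<close>
        have "(real (card U) - 1) / 8 + (real n - real (card U)) \<le> (real n - 1) * 1"
          using c by auto
        also have "\<dots> \<le> (real n - 1) * (2 * l)" using l n by (intro mult_left_mono) auto
        finally have "((real (card U) - 1) / 8 + (real n - real (card U))) / l \<le> (real n - 1) * 2"
          using l by (simp add: field_simps)
        moreover have "h t v = 2" using True 2 by (simp add: h_def)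
        ultimately show ?thesis unfolding c1 c2 by (simp add: add_divide_distrib)
      next
        case False
        have eq: "real (card U) / 8 + (real n - (1 + real (card U))) = (real n - 1) * l"
          unfolding l_def avoid_rate_def using n by (simp add: field_simps)
        have "real (card U) * (1/8 / l) + (real n - (1 + real (card U))) * (1 / l) =
            (real (card U) / 8 + (real n - (1 + real (card U)))) / l"
          using l by (simp add: field_simps)
        also have "\<dots> = real n - 1" unfolding eq using l by simp
        finally show ?thesis using False finU by (simp add: h_def)
      qed
      finally show ?thesis .
    next
      case 3
      then have "(\<Sum>y\<in>{1..n}-{v}. \<phi> (Suc t) y * h (Suc t) y) = (\<Sum>y\<in>{1..n}-{v}. 1)"
        by (intro sum.cong) (auto simp: \<phi>_def h_def)
      also have "\<dots> = real n - 1" using card_others[OF v] by simp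
      also have "\<dots> \<le> (real n - 1) * h t v" by (rule hn)
      finally show ?thesis .
    qed
  qed
  define c where "c = ((real n - 1) / 2) ^ card P * (1/16) ^ 14 * (1 / l) ^ (T1 - card P)"
  have cpos: "c > 0" using l n by (simp add: c_def)
  define F where "F t x = (\<Prod>s\<in>{..t}. \<phi> s (x s)) * h t (x t)" for t and x :: "nat \<Rightarrow> nat"
  have "path_prob (\<lambda>x. (\<forall>s\<in>P. x s = g s) \<and> (\<forall>u\<in>U. small x T1 u)) \<le> 2 / c"
  proof (rule path_prob_supermartingale[where F = F and T = T])
    fix t :: nat and x y :: "nat \<Rightarrow> nat" assume xy: "\<And>s. s \<le> t \<Longrightarrow> x s = y s"
    then have "(\<Prod>s\<in>{..t}. \<phi> s (x s)) = (\<Prod>s\<in>{..t}. \<phi> s (y s))" by (intro prod.cong) auto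
    then show "F t x = F t y" using xy[of t] by (simp add: F_def)
  next
    fix t :: nat and x :: "nat \<Rightarrow> nat" assume t: "t < T" and x: "\<And>s. s \<le> t \<Longrightarrow> x s \<in> {1..n}"
    have "F (Suc t) (x(Suc t := y)) = (\<Prod>s\<in>{..t}. \<phi> s (x s)) * (\<phi> (Suc t) y * h (Suc t) y)" for y
    proof -
      have "(\<Prod>s\<in>{..t}. \<phi> s ((x(Suc t := y)) s)) = (\<Prod>s\<in>{..t}. \<phi> s (x s))"
        by (intro prod.cong) auto
      then show ?thesis unfolding F_def prod.atMost_Suc by (simp only: fun_upd_same mult.assoc)
    qed
    then have "(\<Sum>y\<in>{1..n}-{x t}. F (Suc t) (x(Suc t := y))) =
        (\<Prod>s\<in>{..t}. \<phi> s (x s)) * (\<Sum>y\<in>{1..n}-{x t}. \<phi> (Suc t) y * h (Suc t) y)"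
      by (simp add: sum_distrib_left)
    also have "\<dots> \<le> (\<Prod>s\<in>{..t}. \<phi> s (x s)) * ((real n - 1) * h t (x t))"
      by (intro mult_left_mono step x prod_nonneg) (auto simp: phi0)
    finally show "(\<Sum>y\<in>{1..n}-{x t}. F (Suc t) (x(Suc t := y))) \<le> (real n - 1) * F t x"
      by (simp add: F_def mult_ac)
  next
    fix x :: "nat \<Rightarrow> nat"
    show "0 \<le> F T x" unfolding F_def using hb[of T "x T"] by (intro mult_nonneg_nonneg prod_nonneg phi0) auto
  next
    fix x :: "nat \<Rightarrow> nat"
    assume "(\<forall>s\<in>P. x s = g s) \<and> (\<forall>u\<in>U. small x T1 u)"
    then have pin: "\<And>s. s \<in> P \<Longrightarrow> x s = g s" and sm: "\<And>u. u \<in> U \<Longrightarrow> visits x T1 u < 8" by (auto simp: small_def)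
    define N where "N = {..<T1} - P"
    have "{s\<in>N. x s \<in> U} \<subseteq> (\<Union>u\<in>U. {s. s < T1 \<and> x s = u})" by (auto simp: N_def)
    then have "card {s\<in>N. x s \<in> U} \<le> card (\<Union>u\<in>U. {s. s < T1 \<and> x s = u})"
      by (rule card_mono[rotated]) (use finU in auto)
    also have "\<dots> \<le> (\<Sum>u\<in>U. visits x T1 u)" unfolding visits_def by (rule card_UN_le[OF finU])
    also have "\<dots> \<le> (\<Sum>u\<in>U. 7)" by (rule sum_mono) (use sm in fastforce)
    also have "\<dots> \<le> 14" using U(2) by simp
    \<comment> \<open>At most seven visits to each of at most two vertices: the damping costs only
      the constant \<open>16 ^ 14\<close>.\<close>
    finally have v14: "card {s\<in>N. x s \<in> U} \<le> 14" .
    have "(\<Prod>s\<in>{..T}. \<phi> s (x s)) = (\<Prod>s\<in>P. \<phi> s (x s)) * (\<Prod>s\<in>{..T} - P. \<phi> s (x s))"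
      using T(1) by (subst prod.subset_diff[of P]) (auto simp: mult.commute)
    also have "(\<Prod>s\<in>P. \<phi> s (x s)) = (\<Prod>s\<in>P. (real n - 1) / 2)"
      by (rule prod.cong) (auto simp: \<phi>_def pin)
    also have "(\<Prod>s\<in>{..T} - P. \<phi> s (x s)) = (\<Prod>s\<in>N. (if x s \<in> U then 1/16 else 1) / l)"
      by (rule prod.mono_neutral_cong_right) (use T(2) in \<open>auto simp: N_def \<phi>_def\<close>)
    also have "\<dots> = (\<Prod>s\<in>N. if x s \<in> U then 1/16 else 1) * (1 / l) ^ card N"
      by (simp add: prod_dividef power_one_over)
    also have "(\<Prod>s\<in>N. if x s \<in> U then 1/16 else 1) = (1/16::real) ^ card {s\<in>N. x s \<in> U}"
      by (subst prod.If_cases) (auto simp: N_def Int_def)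
    finally have eq: "(\<Prod>s\<in>{..T}. \<phi> s (x s)) = ((real n - 1) / 2) ^ card P * ((1/16) ^ card {s\<in>N. x s \<in> U} * (1 / l) ^ card N)"
      by simp
    have "card N \<ge> T1 - card P" unfolding N_def using diff_card_le_card_Diff[OF P, of "{..<T1}"] by simp
    then have "(1 / l) ^ (T1 - card P) \<le> (1 / l) ^ card N" using l by (intro power_increasing) auto
    moreover have "(1/16::real) ^ 14 \<le> (1/16) ^ card {s\<in>N. x s \<in> U}" using v14 by (intro power_decreasing) auto
    ultimately have "(1/16) ^ 14 * (1 / l) ^ (T1 - card P) \<le> (1/16) ^ card {s\<in>N. x s \<in> U} * (1 / l) ^ card N"
      using l by (intro mult_mono) auto
    then have "c \<le> (\<Prod>s\<in>{..T}. \<phi> s (x s))"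
      unfolding eq c_def mult.assoc using n by (intro mult_left_mono) auto
    also have "\<dots> \<le> F T x"
      unfolding F_def using mult_left_mono[OF hb(1)[of T "x T"] prod_nonneg[of "{..T}" "\<lambda>s. \<phi> s (x s)"]] phi0
      by simp
    finally show "c \<le> F T x" .
  next
    show "(\<Sum>v\<in>{1..n}. F 0 (\<lambda>_. v)) \<le> real n * 2"
    proof (cases "0 \<in> P")
      case True
      have "(\<Sum>v\<in>{1..n}. F 0 (\<lambda>_. v)) \<le> (real n - 1) / 2 * max 0 (h 0 (g 0))"
        unfolding F_def \<phi>_def using sum_pin[of "{1..n}" "(real n - 1)/2" "g 0" "h 0"] n True by simp
      also have "\<dots> \<le> (real n - 1) / 2 * 2" using hb n by (intro mult_left_mono) auto
      finally show ?thesis by simp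
    next
      case False
      have "F 0 (\<lambda>_. v) \<le> 2" for v
        using False l by (auto simp: F_def \<phi>_def h_def field_simps)
      then have "(\<Sum>v\<in>{1..n}. F 0 (\<lambda>_. v)) \<le> (\<Sum>v\<in>{1..n}. 2)" by (intro sum_mono) auto
      then show ?thesis by simp
    qed
  qed (rule cpos)
  also have "2 / c = 2 * 16 ^ 14 * (2 / (real n - 1)) ^ card P * l ^ (T1 - card P)"
    unfolding c_def using l n by (simp add: power_one_over power_divide divide_simps)
  finally show ?thesis by (simp add: l_def)
qed

text \<open>A normal form for summing over pins. Passing from \<open>2 / (n - 1)\<close> to
  \<open>4 / n\<close> and restoring the missing factors \<open>l \<ge> 1/2\<close> costs at most
  \<open>8 ^ p\<close>; four edges pin at most eight times.\<close>

lemma path_prob_pinned_small':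
  assumes n: "n \<ge> 5" and U: "U \<subseteq> {1..n}" "card U = m" "m \<le> 2" and P: "finite P" "card P = p" "p \<le> 8"
  shows "path_prob (\<lambda>x. (\<forall>s\<in>P. x s = g s) \<and> (\<forall>u\<in>U. small x T1 u)) \<le>
    2 * 16 ^ 14 * 8 ^ 8 * (1 / real n) ^ p * avoid_rate m ^ T1"
proof -
  define l where "l = avoid_rate m"
  have l: "1/2 \<le> l" "l \<le> 1" using avoid_rate_bounds[OF n U(3)] by (auto simp: l_def)
  note p = P(3)
  have U2: "card U \<le> 2" using U by simp
  have "(2 / (real n - 1)) ^ p \<le> (4 / real n) ^ p"
    by (rule power_mono) (use n in \<open>auto simp: field_simps\<close>)
  also have "\<dots> = 4 ^ p * (1 / real n) ^ p" by (simp add: power_divide)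
  finally have 1: "(2 / (real n - 1)) ^ p \<le> 4 ^ p * (1 / real n) ^ p" .
  have 2: "l ^ (T1 - p) \<le> 2 ^ p * l ^ T1"
  proof (cases "p \<le> T1")
    case True
    have "(1/2) ^ p \<le> l ^ p" using l by (intro power_mono) auto
    then have "1 \<le> 2 ^ p * l ^ p" by (simp add: power_divide field_simps)
    then have "l ^ (T1 - p) * 1 \<le> l ^ (T1 - p) * (2 ^ p * l ^ p)" using l by (intro mult_left_mono) auto
    also have "\<dots> = 2 ^ p * l ^ T1" using True by (metis le_add_diff_inverse2 mult.left_commute power_add)
    finally show ?thesis by simp
  next
    case False
    have "1 = 2 ^ T1 * (1/2::real) ^ T1" by (simp add: power_divide)
    also have "\<dots> \<le> 2 ^ p * l ^ T1"
      using False l by (intro mult_mono power_increasing power_mono) auto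
    finally show ?thesis using False by simp
  qed
  have "(2 / (real n - 1)) ^ p * l ^ (T1 - p) \<le> (4 ^ p * (1 / real n) ^ p) * (2 ^ p * l ^ T1)"
    using 1 2 l n by (intro mult_mono) auto
  also have "\<dots> = 8 ^ p * ((1 / real n) ^ p * l ^ T1)"
    by (simp add: power_mult_distrib[symmetric] mult.left_commute)
  also have "\<dots> \<le> 8 ^ 8 * ((1 / real n) ^ p * l ^ T1)"
    using p l by (intro mult_right_mono power_increasing) auto
  finally have 3: "(2 / (real n - 1)) ^ p * l ^ (T1 - p) \<le> 8 ^ 8 * ((1 / real n) ^ p * l ^ T1)" .
  have "path_prob (\<lambda>x. (\<forall>s\<in>P. x s = g s) \<and> (\<forall>u\<in>U. small x T1 u)) \<le>
      2 * 16 ^ 14 * ((2 / (real n - 1)) ^ p * l ^ (T1 - p))"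
    using path_prob_pinned_small[OF n U(1) U2 P(1)] unfolding U(2) P(2) by (simp only: l_def mult.assoc)
  also have "\<dots> \<le> 2 * 16 ^ 14 * (8 ^ 8 * ((1 / real n) ^ p * l ^ T1))"
    using 3 by (intro mult_left_mono) auto
  finally show ?thesis by (simp only: l_def mult.assoc)
qed

section \<open>Bad events about small vertices: the start, immediate returns, close pairs\<close>

lemma path_prob_start_small:
  assumes "n \<ge> 5"
  shows "path_prob (\<lambda>x. small x T1 (x 0)) \<le> 2 * 16 ^ 14 * 8 ^ 8 * avoid_rate 1 ^ T1"
proof -
  have "path_prob (\<lambda>x. small x T1 (x 0)) \<le> (\<Sum>u\<in>{1..n}. path_prob (\<lambda>x. (\<forall>s\<in>{0}. x s = u) \<and> (\<forall>u\<in>{u}. small x T1 u)))"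
  proof (rule path_prob_union)
    fix x :: "nat \<Rightarrow> nat" assume "\<And>s. x s \<in> {1..n}" "small x T1 (x 0)"
    then show "\<exists>u\<in>{1..n}. (\<forall>s\<in>{0}. x s = u) \<and> (\<forall>u\<in>{u}. small x T1 u)"
      by (intro bexI[of _ "x 0"]) auto
  next
    fix u show "finitary (\<lambda>x. (\<forall>s\<in>{0}. x s = u) \<and> (\<forall>u\<in>{u}. small x T1 u))"
      by (simp, intro finitary_conj finitary_at finitary_small)
  qed simp
  also have "\<dots> \<le> (\<Sum>u\<in>{1..n}. 2 * 16 ^ 14 * 8 ^ 8 * (1 / real n) ^ 1 * avoid_rate 1 ^ T1)"
  proof (rule sum_mono)
    fix u assume "u \<in> {1..n}"
    then show "path_prob (\<lambda>x. (\<forall>s\<in>{0}. x s = u) \<and> (\<forall>u\<in>{u}. small x T1 u)) \<le>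
        2 * 16 ^ 14 * 8 ^ 8 * (1 / real n) ^ 1 * avoid_rate 1 ^ T1"
      by (intro path_prob_pinned_small' assms) (auto simp: One_nat_def)
  qed
  also have "\<dots> = 2 * 16 ^ 14 * 8 ^ 8 * avoid_rate 1 ^ T1" using assms by simp
  finally show ?thesis .
qed

text \<open>There are \<open>(T2 + 1) * n * n\<close> choices for the time, the small vertex and the
  vertex on both sides of it, against three pinned times of weight \<open>1 / n\<close>
  each.\<close>

lemma path_prob_turn:
  assumes "n \<ge> 5"
  shows "path_prob (\<lambda>x. \<exists>t\<le>T2. small x T1 (x (Suc t)) \<and> x t = x (Suc (Suc t))) \<le>
    2 * 16 ^ 14 * 8 ^ 8 * ((real T2 + 1) / real n) * avoid_rate 1 ^ T1"
proof -
  define A where "A = {..T2} \<times> {1..n} \<times> {1..n}"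
  define Q where "Q p x \<longleftrightarrow> (case p of (t, u, a) \<Rightarrow> (\<forall>s\<in>{t, Suc t, Suc (Suc t)}. x s = (if s = Suc t then u else a)) \<and>
      (\<forall>u\<in>{u}. small x T1 u))" for p and x :: "nat \<Rightarrow> nat"
  have "path_prob (\<lambda>x. \<exists>t\<le>T2. small x T1 (x (Suc t)) \<and> x t = x (Suc (Suc t))) \<le> (\<Sum>p\<in>A. path_prob (Q p))"
  proof (rule path_prob_union)
    fix x :: "nat \<Rightarrow> nat" assume x: "\<And>s. x s \<in> {1..n}" and "\<exists>t\<le>T2. small x T1 (x (Suc t)) \<and> x t = x (Suc (Suc t))"
    then obtain t where "t \<le> T2" "small x T1 (x (Suc t))" "x t = x (Suc (Suc t))" by blast
    then have "Q (t, x (Suc t), x t) x" "(t, x (Suc t), x t) \<in> A" using x by (simp_all add: Q_def A_def)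
    then show "\<exists>p\<in>A. Q p x" by blast
  next
    fix p show "finitary (Q p)"
      unfolding Q_def by (cases p) (simp, intro finitary_conj finitary_at finitary_small)
  qed (simp add: A_def)
  also have "\<dots> \<le> (\<Sum>p\<in>A. 2 * 16 ^ 14 * 8 ^ 8 * (1 / real n) ^ 3 * avoid_rate 1 ^ T1)"
  proof (rule sum_mono)
    fix p assume "p \<in> A"
    then obtain t u a where p: "p = (t, u, a)" "u \<in> {1..n}" by (auto simp: A_def)
    show "path_prob (Q p) \<le> 2 * 16 ^ 14 * 8 ^ 8 * (1 / real n) ^ 3 * avoid_rate 1 ^ T1"
      unfolding Q_def p(1) prod.case by (intro path_prob_pinned_small' assms) (use p in \<open>auto simp: One_nat_def\<close>)
  qed
  also have "\<dots> = (real T2 + 1) * real n * real n * (2 * 16 ^ 14 * 8 ^ 8 * (1 / real n) ^ 3 * avoid_rate 1 ^ T1)"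
    by (simp add: A_def card_cartesian_product algebra_simps)
  also have "\<dots> = 2 * 16 ^ 14 * 8 ^ 8 * ((real T2 + 1) / real n) * avoid_rate 1 ^ T1"
    using assms by (simp add: power3_eq_cube field_simps)
  finally show ?thesis .
qed

text \<open>The summand is the price of exposing a step at the times \<open>i\<close> and
  \<open>j\<close> once its far end has been summed over: \<open>1 / n\<close> at two new times, 1
  if it touches \<open>P\<close>. Each element of \<open>P\<close> lies in at most four ordered
  pairs of consecutive times.\<close>

lemma sum_pairs_le:
  fixes P :: "nat set"
  assumes "finite P"
  shows "(\<Sum>(i, j)\<in>(\<lambda>t. (t, Suc t)) ` {..T} \<union> (\<lambda>t. (Suc t, t)) ` {..T}. if i \<in> P \<or> j \<in> P then 1 else 1 / real n)
     \<le> 2 * (real T + 1) / real n + 4 * real (card P)"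
proof -
  define A where "A = (\<lambda>t. (t, Suc t)) ` {..T} \<union> (\<lambda>t. (Suc t, t)) ` {..T}"
  define B where "B = {p\<in>A. fst p \<in> P \<or> snd p \<in> P}"
  have finA: "finite A" by (simp add: A_def)
  have "card A \<le> card ((\<lambda>t. (t, Suc t)) ` {..T}) + card ((\<lambda>t. (Suc t, t)) ` {..T})"
    unfolding A_def by (rule card_Un_le)
  also have "\<dots> \<le> card {..T} + card {..T}" by (intro add_mono card_image_le) auto
  finally have cA: "real (card A) \<le> 2 * (real T + 1)" by simp
  have "B \<subseteq> (\<lambda>p. (p, Suc p)) ` P \<union> (\<lambda>p. (p - 1, p)) ` P \<union> (\<lambda>p. (Suc p, p)) ` P \<union> (\<lambda>p. (p, p - 1)) ` P"
    unfolding B_def A_def by (auto simp: image_iff)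
  then have "card B \<le> card ((\<lambda>p. (p, Suc p)) ` P \<union> (\<lambda>p. (p - 1, p)) ` P \<union> (\<lambda>p. (Suc p, p)) ` P \<union> (\<lambda>p. (p, p - 1)) ` P)"
    by (rule card_mono[rotated]) (use assms in auto)
  also have "\<dots> \<le> card ((\<lambda>p. (p, Suc p)) ` P) + card ((\<lambda>p. (p - 1, p)) ` P) + card ((\<lambda>p. (Suc p, p)) ` P) + card ((\<lambda>p. (p, p - 1)) ` P)"
    by (intro order.trans[OF card_Un_le] add_mono order_refl)
  also have "\<dots> \<le> card P + card P + card P + card P"
    by (intro add_mono card_image_le assms)
  finally have cB: "real (card B) \<le> 4 * real (card P)" by simp
  have "(\<Sum>(i, j)\<in>A. if i \<in> P \<or> j \<in> P then 1 else 1 / real n) \<le> (\<Sum>p\<in>A. 1 / real n + (if p \<in> B then 1 else 0))"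
    by (rule sum_mono) (auto simp: B_def)
  also have "\<dots> = real (card A) / real n + real (card B)"
    using finA by (simp add: sum.distrib B_def Int_def flip: sum.inter_filter)
  also have "\<dots> \<le> 2 * (real T + 1) / real n + 4 * real (card P)"
    using cA cB by (intro add_mono divide_right_mono) auto
  finally show ?thesis by (simp add: A_def)
qed

text \<open>If \<open>j\<close> is pinned already, \<open>c\<close> is determined. If only
  \<open>i\<close> is pinned, the \<open>n\<close> values of \<open>c\<close> are balanced by one
  new pin. If both times are new, the second pin leaves a factor \<open>1 / n\<close>.\<close>

lemma sum_consistent_le:
  fixes P :: "nat set"
  assumes "finite P" "i \<noteq> j" "n \<ge> 1"
  shows "(\<Sum>c\<in>{1..n}. if (i \<in> P \<longrightarrow> g i = a) \<and> (j \<in> P \<longrightarrow> g j = c) then (1 / real n) ^ card (P \<union> {i, j}) else 0)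
     \<le> (if i \<in> P \<or> j \<in> P then 1 else 1 / real n) * (1 / real n) ^ card P"
proof -
  have n: "1 / real n \<le> 1" "real n > 0" using assms(3) by auto
  have mono: "(1 / real n) ^ card (P \<union> {i, j}) \<le> (1 / real n) ^ card P"
    by (rule power_decreasing) (use n assms in \<open>auto intro!: card_mono\<close>)
  show ?thesis
  proof (cases "j \<in> P")
    case True
    have "(\<Sum>c\<in>{1..n}. if (i \<in> P \<longrightarrow> g i = a) \<and> (j \<in> P \<longrightarrow> g j = c) then (1 / real n) ^ card (P \<union> {i, j}) else 0) \<le>
      (\<Sum>c\<in>{1..n}. if c = g j then (1 / real n) ^ card P else 0)"
      by (rule sum_mono) (use True mono in auto)
    also have "\<dots> \<le> (1 / real n) ^ card P" by simp
    finally show ?thesis using True by simp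
  next
    case False
    have c: "card (P \<union> {i, j}) = card P + (if i \<in> P then 1 else 2)"
      using False assms(1,2) by (auto simp: card_insert_if insert_absorb)
    have "(\<Sum>c\<in>{1..n}. if (i \<in> P \<longrightarrow> g i = a) \<and> (j \<in> P \<longrightarrow> g j = c) then (1 / real n) ^ card (P \<union> {i, j}) else 0) \<le>
      (\<Sum>c\<in>{1..n}. (1 / real n) ^ card (P \<union> {i, j}))"
      by (rule sum_mono) auto
    also have "\<dots> = real n * (1 / real n) ^ (card P + (if i \<in> P then 1 else 2))" by (simp only: c) simp
    also have "\<dots> =
        (if i \<in> P then 1 else 1 / real n) * (1 / real n) ^ card P"
      using n by (auto simp: power_add power2_eq_square)
    finally show ?thesis using False by simp
  qed
qed

text \<open>One edge of the walk is exposed at a time: \<open>g\<close> records the values seen so far on the set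
  \<open>P\<close> of times, and a new edge either uses new times or one of the few times next to \<open>P\<close>.\<close>

lemma sum_path_prob_reach:
  assumes n: "n \<ge> 5" and u: "u \<in> {1..n}"
  shows "finite P \<Longrightarrow> card P + 2 * l \<le> 8 \<Longrightarrow> a \<in> {1..n} \<Longrightarrow>
    (\<Sum>v\<in>{1..n}-{u}. path_prob (\<lambda>x. ((\<forall>s\<in>P. x s = g s) \<and> small x T1 u \<and> small x T1 v) \<and> reach x T l a v)) \<le>
    2 * 16 ^ 14 * 8 ^ 8 * avoid_rate 2 ^ T1 * (2 * (real T + 1) / real n + 33) ^ l * (1 / real n) ^ card P"
proof (induction l arbitrary: P g a)
  \<comment> \<open>With no edge left only \<open>v = a\<close> survives. Summing over
    \<open>v\<close> inside the induction therefore avoids a further factor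
    \<open>n\<close>.\<close>
  case 0
  have "(\<Sum>v\<in>{1..n}-{u}. path_prob (\<lambda>x. ((\<forall>s\<in>P. x s = g s) \<and> small x T1 u \<and> small x T1 v) \<and> reach x T 0 a v)) \<le>
      (\<Sum>v\<in>{1..n}-{u}. if v = a then 2 * 16 ^ 14 * 8 ^ 8 * (1 / real n) ^ card P * avoid_rate 2 ^ T1 else 0)"
  proof (rule sum_mono)
    fix v assume v: "v \<in> {1..n} - {u}"
    show "path_prob (\<lambda>x. ((\<forall>s\<in>P. x s = g s) \<and> small x T1 u \<and> small x T1 v) \<and> reach x T 0 a v) \<le>
        (if v = a then 2 * 16 ^ 14 * 8 ^ 8 * (1 / real n) ^ card P * avoid_rate 2 ^ T1 else 0)"
    proof (cases "v = a")
      case True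
      have "path_prob (\<lambda>x. (\<forall>s\<in>P. x s = g s) \<and> (\<forall>w\<in>{u, v}. small x T1 w)) \<le>
          2 * 16 ^ 14 * 8 ^ 8 * (1 / real n) ^ card P * avoid_rate 2 ^ T1"
        by (rule path_prob_pinned_small') (use 0 n u v in \<open>auto simp: card_insert_if\<close>)
      then show ?thesis using True v by simp
    next
      case False
      then show ?thesis by (simp add: path_prob_False)
    qed
  qed
  also have "\<dots> \<le> 2 * 16 ^ 14 * 8 ^ 8 * (1 / real n) ^ card P * avoid_rate 2 ^ T1"
    using avoid_rate_bounds[OF n, of 2] by (auto simp: sum.delta)
  finally show ?case by (simp add: mult_ac)
next
  case (Suc l)
  define K where "K = 2 * 16 ^ 14 * 8 ^ 8 * avoid_rate 2 ^ T1"
  define b where "b = 2 * (real T + 1) / real n + 33"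
  define E where "E P g v l a x \<longleftrightarrow> ((\<forall>s\<in>P. x s = g s) \<and> small x T1 u \<and> small x T1 v) \<and> reach x T l a v"
    for P g v l a and x :: "nat \<Rightarrow> nat"
  define A where "A = (\<lambda>t. (t, Suc t)) ` {..T} \<union> (\<lambda>t. (Suc t, t)) ` {..T}"
  have K0: "K \<ge> 0" using avoid_rate_bounds[OF n, of 2] by (simp add: K_def)
  have b0: "b \<ge> 0" by (simp add: b_def)
  have finA: "finite A" by (simp add: A_def)
  have finE: "finitary (E P g v l a)" if "finite P" for P g v l a
    unfolding E_def using that by (intro finitary_conj finitary_pinned finitary_small finitary_reach)
  have IH: "(\<Sum>v\<in>{1..n}-{u}. path_prob (E P g v l a)) \<le> K * b ^ l * (1 / real n) ^ card P"
    if "finite P" "card P + 2 * l \<le> 8" "a \<in> {1..n}" for P g a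
    unfolding E_def K_def b_def by (rule Suc.IH) (use that in auto)
  define Q where "Q i j c v = (\<lambda>x. E P g v l c x \<and> x i = a \<and> x j = c)" for i j c v
  have finQ: "finitary (Q i j c v)" for i j c v
    unfolding Q_def by (intro finitary_conj finE finitary_at Suc.prems)
  have split: "path_prob (E P g v (Suc l) a) \<le> path_prob (E P g v l a) + (\<Sum>p\<in>A. \<Sum>c\<in>{1..n}. path_prob (Q (fst p) (snd p) c v))" for v
  proof -
    \<comment> \<open>\<open>None\<close> stands for a chain of at most \<open>l\<close> edges,
      \<open>Some\<close> for a first edge that sits at a pair of consecutive times and leads to
      \<open>c\<close>.\<close>
    have "path_prob (E P g v (Suc l) a) \<le> (\<Sum>o'\<in>insert None (Some ` (A \<times> {1..n})).
        path_prob (case o' of None \<Rightarrow> E P g v l a | Some (p, c) \<Rightarrow> Q (fst p) (snd p) c v))"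
    proof (rule path_prob_union)
      fix x :: "nat \<Rightarrow> nat" assume x: "\<And>s. x s \<in> {1..n}" and E: "E P g v (Suc l) a x"
      show "\<exists>o'\<in>insert None (Some ` (A \<times> {1..n})).
          (case o' of None \<Rightarrow> E P g v l a | Some (p, c) \<Rightarrow> Q (fst p) (snd p) c v) x"
      proof (cases "reach x T l a v")
        case True
        then show ?thesis using E by (simp add: E_def)
      next
        case False
        then obtain c where c: "adjacent x T a c" "reach x T l c v" using E by (auto simp: E_def)
        then obtain t where t: "t \<le> T" "{x t, x (Suc t)} = {a, c}" by (auto simp: adjacent_def)
        then have cV: "c \<in> {1..n}" using x by (metis insertE insertI1 insert_commute singletonD)
        have E': "E P g v l c x" using E c(2) by (simp add: E_def)
        from t(2) consider "x t = a" "x (Suc t) = c" | "x t = c" "x (Suc t) = a"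
          by (auto simp: doubleton_eq_iff)
        then show ?thesis
        proof cases
          case 1
          have "((t, Suc t), c) \<in> A \<times> {1..n}" using t(1) cV by (auto simp: A_def)
          moreover have "Q t (Suc t) c v x" using E' 1 by (simp add: Q_def)
          ultimately show ?thesis by (intro bexI[of _ "Some ((t, Suc t), c)"]) auto
        next
          case 2
          have "((Suc t, t), c) \<in> A \<times> {1..n}" using t(1) cV by (auto simp: A_def)
          moreover have "Q (Suc t) t c v x" using E' 2 by (simp add: Q_def)
          ultimately show ?thesis by (intro bexI[of _ "Some ((Suc t, t), c)"]) auto
        qed
      qed
    next
      fix o' :: "((nat \<times> nat) \<times> nat) option"
      show "finitary (case o' of None \<Rightarrow> E P g v l a | Some (p, c) \<Rightarrow> Q (fst p) (snd p) c v)"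
        using finE[OF Suc.prems(1)] finQ by (auto split: option.split prod.split)
    qed (use finA in auto)
    also have "\<dots> = path_prob (E P g v l a) + (\<Sum>(p, c)\<in>A \<times> {1..n}. path_prob (Q (fst p) (snd p) c v))"
      using finA by (subst sum.insert) (auto simp: sum.reindex case_prod_unfold)
    finally show ?thesis by (simp add: sum.cartesian_product)
  qed
  \<comment> \<open>The pins for the new edge either agree with \<open>g\<close>, and the induction
    hypothesis applies to the extended pinning on \<open>P \<union> {i, j}\<close>, or they
    contradict \<open>g\<close> and the probability is 0.\<close>
  have pair: "(\<Sum>v\<in>{1..n}-{u}. path_prob (Q i j c v)) \<le>
      K * b ^ l * (if (i \<in> P \<longrightarrow> g i = a) \<and> (j \<in> P \<longrightarrow> g j = c) then (1 / real n) ^ card (P \<union> {i, j}) else 0)"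
    if c: "c \<in> {1..n}" and ij: "i \<noteq> j" for i j c
  proof (cases "(i \<in> P \<longrightarrow> g i = a) \<and> (j \<in> P \<longrightarrow> g j = c)")
    case True
    have "Q i j c v = E (P \<union> {i, j}) (g(i := a, j := c)) v l c" for v
    proof
      fix x
      have "(\<forall>s\<in>P \<union> {i, j}. x s = (g(i := a, j := c)) s) \<longleftrightarrow> (\<forall>s\<in>P. x s = g s) \<and> x i = a \<and> x j = c"
        using True ij by auto
      then show "Q i j c v x = E (P \<union> {i, j}) (g(i := a, j := c)) v l c x" unfolding Q_def E_def by blast
    qed
    moreover have "card (P \<union> {i, j}) \<le> card P + 2"
      using card_Un_le[of P "{i, j}"] ij by simp
    ultimately show ?thesis
      using True IH[of "P \<union> {i, j}" c "g(i := a, j := c)"] Suc.prems c by simp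
  next
    case False
    have "path_prob (Q i j c v) = 0" for v
      by (rule path_prob_False) (use False in \<open>auto simp: Q_def E_def\<close>)
    then show ?thesis using False by auto
  qed
  have "(\<Sum>v\<in>{1..n}-{u}. path_prob (E P g v (Suc l) a)) \<le>
      (\<Sum>v\<in>{1..n}-{u}. path_prob (E P g v l a) + (\<Sum>p\<in>A. \<Sum>c\<in>{1..n}. path_prob (Q (fst p) (snd p) c v)))"
    by (rule sum_mono) (rule split)
  also have "\<dots> = (\<Sum>v\<in>{1..n}-{u}. path_prob (E P g v l a)) +
      (\<Sum>p\<in>A. \<Sum>c\<in>{1..n}. \<Sum>v\<in>{1..n}-{u}. path_prob (Q (fst p) (snd p) c v))"
  proof -
    have "(\<Sum>v\<in>{1..n}-{u}. \<Sum>p\<in>A. \<Sum>c\<in>{1..n}. path_prob (Q (fst p) (snd p) c v)) =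
        (\<Sum>p\<in>A. \<Sum>v\<in>{1..n}-{u}. \<Sum>c\<in>{1..n}. path_prob (Q (fst p) (snd p) c v))" by (rule sum.swap)
    also have "\<dots> = (\<Sum>p\<in>A. \<Sum>c\<in>{1..n}. \<Sum>v\<in>{1..n}-{u}. path_prob (Q (fst p) (snd p) c v))"
      by (rule sum.cong[OF refl]) (rule sum.swap)
    finally show ?thesis by (simp only: sum.distrib)
  qed
  also have "(\<Sum>p\<in>A. \<Sum>c\<in>{1..n}. \<Sum>v\<in>{1..n}-{u}. path_prob (Q (fst p) (snd p) c v)) \<le>
      (\<Sum>p\<in>A. K * b ^ l * ((if fst p \<in> P \<or> snd p \<in> P then 1 else 1 / real n) * (1 / real n) ^ card P))"
  proof (rule sum_mono)
    fix p assume "p \<in> A"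
    then have ne: "fst p \<noteq> snd p" by (auto simp: A_def)
    have "(\<Sum>c\<in>{1..n}. \<Sum>v\<in>{1..n}-{u}. path_prob (Q (fst p) (snd p) c v)) \<le>
       (\<Sum>c\<in>{1..n}. K * b ^ l * (if (fst p \<in> P \<longrightarrow> g (fst p) = a) \<and> (snd p \<in> P \<longrightarrow> g (snd p) = c)
         then (1 / real n) ^ card (P \<union> {fst p, snd p}) else 0))"
      by (rule sum_mono) (rule pair[OF _ ne])
    also have "\<dots> = K * b ^ l * (\<Sum>c\<in>{1..n}. if (fst p \<in> P \<longrightarrow> g (fst p) = a) \<and> (snd p \<in> P \<longrightarrow> g (snd p) = c)
         then (1 / real n) ^ card (P \<union> {fst p, snd p}) else 0)"
      by (simp only: sum_distrib_left)
    also have "\<dots> \<le> K * b ^ l * ((if fst p \<in> P \<or> snd p \<in> P then 1 else 1 / real n) * (1 / real n) ^ card P)"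
      by (intro mult_left_mono sum_consistent_le) (use K0 b0 ne n Suc.prems in auto)
    finally show "(\<Sum>c\<in>{1..n}. \<Sum>v\<in>{1..n}-{u}. path_prob (Q (fst p) (snd p) c v)) \<le>
      K * b ^ l * ((if fst p \<in> P \<or> snd p \<in> P then 1 else 1 / real n) * (1 / real n) ^ card P)" .
  qed
  also have "\<dots> = K * b ^ l * (1 / real n) ^ card P * (\<Sum>p\<in>A. if fst p \<in> P \<or> snd p \<in> P then 1 else 1 / real n)"
    by (simp add: sum_distrib_left mult_ac)
  \<comment> \<open>The constant 33 is \<open>4 * 8 + 1\<close>: four pairs for each of at most
    eight pinned times, and 1 for the chain without a further edge.\<close>
  also have "(\<Sum>p\<in>A. if fst p \<in> P \<or> snd p \<in> P then 1 else 1 / real n) \<le> b - 1"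
    using sum_pairs_le[OF Suc.prems(1), of T] Suc.prems(2) by (simp add: A_def b_def case_prod_unfold)
  also have "(\<Sum>v\<in>{1..n}-{u}. path_prob (E P g v l a)) \<le> K * b ^ l * (1 / real n) ^ card P"
    by (rule IH) (use Suc.prems in auto)
  finally have "(\<Sum>v\<in>{1..n}-{u}. path_prob (E P g v (Suc l) a)) \<le>
      K * b ^ l * (1 / real n) ^ card P + K * b ^ l * (1 / real n) ^ card P * (b - 1)"
    using K0 b0 by (simp add: mult_left_mono)
  also have "\<dots> = K * b ^ Suc l * (1 / real n) ^ card P" by (simp add: algebra_simps)
  finally show ?case unfolding E_def K_def b_def .
qed

lemma path_prob_close_small:
  assumes n: "n \<ge> 5"
  shows "path_prob (\<lambda>x. \<exists>u\<in>{1..n}. \<exists>v\<in>{1..n}. u \<noteq> v \<and> small x T1 u \<and> small x T1 v \<and> reach x T 4 u v) \<le>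
    real n * (2 * 16 ^ 14 * 8 ^ 8 * avoid_rate 2 ^ T1 * (2 * (real T + 1) / real n + 33) ^ 4)"
proof -
  define Q where "Q u v = (\<lambda>x. ((\<forall>s\<in>{}. x s = 0) \<and> small x T1 u \<and> small x T1 v) \<and> reach x T 4 u v)" for u v :: nat
  have "path_prob (\<lambda>x. \<exists>u\<in>{1..n}. \<exists>v\<in>{1..n}. u \<noteq> v \<and> small x T1 u \<and> small x T1 v \<and> reach x T 4 u v) \<le>
      (\<Sum>(u, v)\<in>(SIGMA u:{1..n}. {1..n}-{u}). path_prob (Q u v))"
    unfolding case_prod_unfold
  proof (rule path_prob_union)
    fix x :: "nat \<Rightarrow> nat"
    assume "\<exists>u\<in>{1..n}. \<exists>v\<in>{1..n}. u \<noteq> v \<and> small x T1 u \<and> small x T1 v \<and> reach x T 4 u v"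
    then obtain u v where "u \<in> {1..n}" "v \<in> {1..n}" "u \<noteq> v" "small x T1 u" "small x T1 v" "reach x T 4 u v"
      by blast
    then show "\<exists>p\<in>(SIGMA u:{1..n}. {1..n}-{u}). Q (fst p) (snd p) x"
      by (intro bexI[of _ "(u, v)"]) (auto simp: Q_def)
  next
    fix p show "finitary (Q (fst p) (snd p))"
      unfolding Q_def by (intro finitary_conj finitary_pinned finitary_small finitary_reach) auto
  qed auto
  also have "\<dots> = (\<Sum>u\<in>{1..n}. \<Sum>v\<in>{1..n}-{u}. path_prob (Q u v))"
    by (simp add: sum.Sigma)
  also have "\<dots> \<le> (\<Sum>u\<in>{1..n}. 2 * 16 ^ 14 * 8 ^ 8 * avoid_rate 2 ^ T1 * (2 * (real T + 1) / real n + 33) ^ 4 * (1 / real n) ^ card ({} :: nat set))"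
    unfolding Q_def by (rule sum_mono) (rule sum_path_prob_reach[OF n], auto)
  finally show ?thesis by simp
qed

end

section \<open>Expansion of large vertices\<close>

text \<open>One term of the expansion of \<open>(1 + q) ^ n\<close> at \<open>q = w / n\<close>,
  together with \<open>exp 1 \<le> 3\<close>.\<close>

lemma binomial_le_three_power:
  assumes "0 < w"
  shows "real (n choose w) \<le> (3 * real n / real w) ^ w"
proof (cases "n = 0")
  case False
  define q where "q = real w / real n"
  have q: "q > 0" using assms False by (simp add: q_def)
  have "real (n choose w) * q ^ w \<le> (\<Sum>i\<le>n. real (n choose i) * q ^ i)"
  proof (cases "w \<le> n")
    case True
    then show ?thesis using q by (intro member_le_sum) auto
  next
    case False
    then show ?thesis using q by (simp add: binomial_eq_0 sum_nonneg)
  qed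
  also have "\<dots> = (1 + q) ^ n" using binomial_ring[of q 1 n] by (simp add: add.commute)
  also have "\<dots> \<le> exp q ^ n" using q by (intro power_mono) auto
  also have "\<dots> = exp (real w)" using False by (simp add: q_def exp_of_nat_mult[symmetric])
  also have "\<dots> = exp 1 ^ w" by (simp add: exp_of_nat_mult[symmetric])
  also have "\<dots> \<le> 3 ^ w" using exp_le by (intro power_mono) auto
  finally have "real (n choose w) \<le> 3 ^ w / q ^ w" using q by (simp add: field_simps)
  also have "\<dots> = (3 * real n / real w) ^ w" by (simp add: q_def power_divide power_mult_distrib)
  finally show ?thesis .
qed (use assms in \<open>auto simp: binomial_eq_0\<close>)

lemma sum_nat_half_power: "(\<Sum>s=1..k. real s * (1/2) ^ s) = 2 - (real k + 2) / 2 ^ k"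
  by (induction k) (auto simp: field_simps)

context complete_graph_walk
begin

text \<open>The vertices of \<open>S\<close> make \<open>8 * card S\<close> tested departures in
  all, and each lands in \<open>W\<close> with probability at most \<open>w / (n - 1)\<close>
  whatever the past; the weight \<open>a\<close> is the inverse of this bound.\<close>

lemma path_prob_confined:
  assumes S: "S \<subseteq> {1..n}" and W: "W \<subseteq> {1..n}" "card W = w" "w > 0"
  shows "path_prob (\<lambda>x. \<forall>v\<in>S. \<not> small x T v \<and> outs x T v \<subseteq> W) \<le> (real w / (real n - 1)) ^ (8 * card S)"
proof -
  define a where "a = (real n - 1) / real w"
  have a: "a > 0" using W two_vertices by (simp add: a_def)
  \<comment> \<open>\<open>\<psi> r\<close> inspects the step from \<open>r\<close> to
    \<open>r + 1\<close>, so \<open>F t\<close> multiplies over \<open>r < t\<close> only and is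
    determined by the walk up to time \<open>t\<close>.\<close>
  define \<psi> where "\<psi> r x = (if x r \<in> S \<and> visits x r (x r) < 8 then (if x (Suc r) \<in> W then a else 0) else 1)"
    for r and x :: "nat \<Rightarrow> nat"
  have psi_cong: "\<psi> r x = \<psi> r y" if "\<And>s. s \<le> Suc r \<Longrightarrow> x s = y s" for r x y
    using that[of r] that[of "Suc r"] visits_cong[of r x y] that unfolding \<psi>_def by simp
  have psi0: "\<psi> r x \<ge> 0" for r x using a by (simp add: \<psi>_def)
  define F where "F t x = (\<Prod>r\<in>{..<t}. \<psi> r x)" for t x
  have F_cong: "F t x = F t y" if "\<And>s. s \<le> t \<Longrightarrow> x s = y s" for t x y
    unfolding F_def by (intro prod.cong psi_cong that) auto
  have "path_prob (\<lambda>x. \<forall>v\<in>S. \<not> small x T v \<and> outs x T v \<subseteq> W) \<le> 1 / a ^ (8 * card S)"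
  proof (rule path_prob_supermartingale[where F = F and T = T])
    show "F t x = F t y" if "\<And>s. s \<le> t \<Longrightarrow> x s = y s" for t x y using that by (rule F_cong)
  next
    fix t :: nat and x :: "nat \<Rightarrow> nat" assume x: "\<And>s. s \<le> t \<Longrightarrow> x s \<in> {1..n}"
    have Fstep: "F (Suc t) (x(Suc t := y)) = F t x * \<psi> t (x(Suc t := y))" for y
    proof -
      have "F t (x(Suc t := y)) = F t x" by (rule F_cong) auto
      then show ?thesis unfolding F_def by simp
    qed
    have "(\<Sum>y\<in>{1..n}-{x t}. \<psi> t (x(Suc t := y))) \<le> real n - 1"
    proof (cases "x t \<in> S \<and> visits x t (x t) < 8")
      case True
      have v: "visits (x(Suc t := y)) t (x t) = visits x t (x t)" for y by (rule visits_cong) auto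
      have "(\<Sum>y\<in>{1..n}-{x t}. \<psi> t (x(Suc t := y))) = (\<Sum>y\<in>{1..n}-{x t}. if y \<in> W then a else 0)"
        by (rule sum.cong) (use True v in \<open>auto simp: \<psi>_def\<close>)
      also have "\<dots> = real (card (({1..n}-{x t}) \<inter> W)) * a" by (subst sum.If_cases) auto
      also have "\<dots> \<le> real w * a"
        using W a by (intro mult_right_mono of_nat_mono) (auto intro!: card_mono intro: finite_subset)
      also have "\<dots> = real n - 1" using W(3) by (simp add: a_def)
      finally show ?thesis .
    next
      case False
      have v: "visits (x(Suc t := y)) t (x t) = visits x t (x t)" for y by (rule visits_cong) auto
      have "(\<Sum>y\<in>{1..n}-{x t}. \<psi> t (x(Suc t := y))) = (\<Sum>y\<in>{1..n}-{x t}. 1)"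
        by (rule sum.cong) (use False v in \<open>auto simp: \<psi>_def\<close>)
      then show ?thesis using card_others[of "x t"] x[of t] by simp
    qed
    then have "F t x * (\<Sum>y\<in>{1..n}-{x t}. \<psi> t (x(Suc t := y))) \<le> F t x * (real n - 1)"
      by (rule mult_left_mono) (auto simp: F_def psi0 intro: prod_nonneg)
    then show "(\<Sum>y\<in>{1..n}-{x t}. F (Suc t) (x(Suc t := y))) \<le> (real n - 1) * F t x"
      unfolding Fstep by (simp add: sum_distrib_left mult.commute)
  next
    fix x :: "nat \<Rightarrow> nat" show "0 \<le> F T x" by (auto simp: F_def psi0 intro: prod_nonneg)
  next
    fix x :: "nat \<Rightarrow> nat"
    assume conf: "\<forall>v\<in>S. \<not> small x T v \<and> outs x T v \<subseteq> W"
    define B where "B = {r. r < T \<and> x r \<in> S \<and> visits x r (x r) < 8}"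
    have finS: "finite S" using S finite_subset by blast
    have "F T x = (\<Prod>r\<in>{..<T}. if r \<in> B then a else 1)"
      unfolding F_def
    proof (rule prod.cong)
      fix r assume r: "r \<in> {..<T}"
      show "\<psi> r x = (if r \<in> B then a else 1)"
      proof (cases "r \<in> B")
        case True
        then have "x (Suc r) \<in> outs x T (x r)" using r by (auto simp: B_def outs_def)
        then have "x (Suc r) \<in> W" using conf True by (auto simp: B_def)
        then show ?thesis using True by (simp add: \<psi>_def B_def)
      next
        case False
        then show ?thesis using r by (auto simp: \<psi>_def B_def)
      qed
    qed simp
    also have "\<dots> = a ^ card ({..<T} \<inter> B)" by (subst prod.If_cases) auto
    also have "{..<T} \<inter> B = (\<Union>v\<in>S. {t. t < T \<and> x t = v \<and> visits x t v < 8})" by (auto simp: B_def)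
    also have "card \<dots> = (\<Sum>v\<in>S. card {t. t < T \<and> x t = v \<and> visits x t v < 8})"
      by (rule card_UN_disjoint) (use finS in auto)
    also have "\<dots> = (\<Sum>v\<in>S. 8)"
      unfolding card_first_visits by (rule sum.cong) (use conf in \<open>auto simp: small_def\<close>)
    finally show "a ^ (8 * card S) \<le> F T x" by (simp add: mult.commute)
  next
    show "(\<Sum>v\<in>{1..n}. F 0 (\<lambda>_. v)) \<le> real n * 1" by (simp add: F_def)
  qed (use a in simp)
  also have "1 / a ^ (8 * card S) = (real w / (real n - 1)) ^ (8 * card S)"
    by (simp add: a_def power_divide)
  finally show ?thesis .
qed

text \<open>The union bound over the sets \<open>W\<close> of size \<open>7 s\<close> converges because each of the \<open>s\<close> vertices has
  eight confined steps.\<close>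

lemma path_prob_not_expanding:
  assumes k: "2 * 14 ^ 8 * k \<le> n"
  shows "path_prob (\<lambda>x. \<exists>S\<subseteq>{1..n}. S \<noteq> {} \<and> card S \<le> k \<and> (\<forall>v\<in>S. \<not> small x T v) \<and>
      card (S \<union> (\<Union>v\<in>S. outs x T v)) < 7 * card S) \<le> 4 * 14 ^ 8 / real n"
proof -
  define Ws where "Ws s = {W. W \<subseteq> {1..n} \<and> card W = 7 * s}" for s
  define Ss where "Ss s W = {S. S \<subseteq> W \<and> card S = s}" for s and W :: "nat set"
  define I where "I = (SIGMA s:{1..k}. SIGMA W:Ws s. Ss s W)"
  define Q where "Q p = (\<lambda>x. \<forall>v\<in>snd (snd p). \<not> small x T v \<and> outs x T v \<subseteq> fst (snd p))"
    for p :: "nat \<times> nat set \<times> nat set"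
  have finWs: "finite (Ws s)" for s by (auto simp: Ws_def)
  have finW: "finite W" if "W \<in> Ws s" for W s using that finite_subset by (auto simp: Ws_def)
  have finSs: "finite (Ss s W)" if "finite W" for s W using that by (auto simp: Ss_def)
  have "path_prob (\<lambda>x. \<exists>S\<subseteq>{1..n}. S \<noteq> {} \<and> card S \<le> k \<and> (\<forall>v\<in>S. \<not> small x T v) \<and>
      card (S \<union> (\<Union>v\<in>S. outs x T v)) < 7 * card S) \<le> (\<Sum>p\<in>I. path_prob (Q p))"
  proof (rule path_prob_union)
    show "finite I" unfolding I_def by (intro finite_SigmaI finite_atLeastAtMost finWs finSs) (rule finW)
    show "finitary (Q p)" for p unfolding Q_def by (rule finitary_confined)
    fix x :: "nat \<Rightarrow> nat" assume x: "\<And>s. x s \<in> {1..n}"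
      and "\<exists>S\<subseteq>{1..n}. S \<noteq> {} \<and> card S \<le> k \<and> (\<forall>v\<in>S. \<not> small x T v) \<and>
        card (S \<union> (\<Union>v\<in>S. outs x T v)) < 7 * card S"
    then obtain S where S: "S \<subseteq> {1..n}" "S \<noteq> {}" "card S \<le> k" "\<forall>v\<in>S. \<not> small x T v"
      "card (S \<union> (\<Union>v\<in>S. outs x T v)) < 7 * card S" by blast
    have finS: "finite S" using S(1) finite_subset by blast
    have "S \<union> (\<Union>v\<in>S. outs x T v) \<subseteq> {1..n}" using S(1) x unfolding outs_def by blast
    moreover have "7 * card S \<le> card {1..n}" using S(3) k by simp
    \<comment> \<open>Enlarging to exactly \<open>7 * card S\<close> elements lets \<open>W\<close>
      range over sets of a single size. As \<open>S\<close> lies in \<open>W\<close>, choosing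
      \<open>S\<close> afterwards costs at most \<open>2 ^ (7 * s)\<close>.\<close>
    ultimately obtain W where W: "S \<union> (\<Union>v\<in>S. outs x T v) \<subseteq> W" "W \<subseteq> {1..n}" "card W = 7 * card S"
      using exists_subset_between[of "S \<union> (\<Union>v\<in>S. outs x T v)" "7 * card S" "{1..n}"] S(5) by auto
    have "card S \<ge> 1" using S(2) finS by (simp add: Suc_le_eq card_gt_0_iff One_nat_def)
    then have "(card S, W, S) \<in> I" using S W by (auto simp: I_def Ws_def Ss_def)
    moreover have "Q (card S, W, S) x" using S(4) W(1) by (auto simp: Q_def)
    ultimately show "\<exists>p\<in>I. Q p x" by blast
  qed
  also have "\<dots> = (\<Sum>s\<in>{1..k}. \<Sum>W\<in>Ws s. \<Sum>S\<in>Ss s W. path_prob (Q (s, W, S)))"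
  proof -
    have "(\<Sum>W\<in>Ws s. \<Sum>S\<in>Ss s W. path_prob (Q (s, W, S))) = (\<Sum>q\<in>(SIGMA W:Ws s. Ss s W). path_prob (Q (s, q)))" for s
      by (subst sum.Sigma) (use finWs finSs finW in \<open>auto simp: case_prod_unfold\<close>)
    moreover have "(\<Sum>s\<in>{1..k}. \<Sum>q\<in>(SIGMA W:Ws s. Ss s W). path_prob (Q (s, q))) = (\<Sum>p\<in>I. path_prob (Q p))"
      unfolding I_def by (subst sum.Sigma) (use finWs finSs finW in \<open>auto simp: case_prod_unfold\<close>)
    ultimately show ?thesis by simp
  qed
  also have "\<dots> \<le> (\<Sum>s\<in>{1..k}. 2 * (14 ^ 8 / real n) * (real s * (1/2) ^ s))"
  proof (rule sum_mono)
    fix s assume s: "s \<in> {1..k}"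
    define z where "z = real s / real n"
    have sn: "s \<ge> 1" "2 * 14 ^ 8 * s \<le> n" using s k by auto
    have n0: "real n > 0" using two_vertices by simp
    have z: "z > 0" "14 ^ 8 * z \<le> 1/2"
    proof -
      show "z > 0" using sn n0 by (simp add: z_def)
      have "real (2 * 14 ^ 8 * s) \<le> real n" using sn(2) by (rule of_nat_mono)
      then show "14 ^ 8 * z \<le> 1/2" using n0 by (simp add: z_def field_simps)
    qed
    have "(\<Sum>W\<in>Ws s. \<Sum>S\<in>Ss s W. path_prob (Q (s, W, S))) \<le> (\<Sum>W\<in>Ws s. 2 ^ (7 * s) * (14 * z) ^ (8 * s))"
    proof (rule sum_mono)
      fix W assume W: "W \<in> Ws s"
      have "(\<Sum>S\<in>Ss s W. path_prob (Q (s, W, S))) \<le> (\<Sum>S\<in>Ss s W. (14 * z) ^ (8 * s))"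
      proof (rule sum_mono)
        fix S assume S: "S \<in> Ss s W"
        have "path_prob (Q (s, W, S)) \<le> (real (7 * s) / (real n - 1)) ^ (8 * card S)"
          unfolding Q_def snd_conv fst_conv by (rule path_prob_confined) (use W S sn in \<open>auto simp: Ws_def Ss_def\<close>)
        also have "\<dots> \<le> (14 * z) ^ (8 * s)"
        proof -
          have "real (7 * s) / (real n - 1) \<le> 14 * z"
            using two_vertices sn by (simp add: z_def field_simps)
          moreover have "0 \<le> real (7 * s) / (real n - 1)" using two_vertices by simp
          moreover have "card S = s" using S by (simp add: Ss_def)
          ultimately show ?thesis by (simp only: power_mono)
        qed
        finally show "path_prob (Q (s, W, S)) \<le> (14 * z) ^ (8 * s)" .
      qed
      also have "\<dots> = real (card (Ss s W)) * (14 * z) ^ (8 * s)" by simp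
      also have "card (Ss s W) \<le> card (Pow W)"
        by (rule card_mono) (use finW[OF W] in \<open>auto simp: Ss_def\<close>)
      also have "card (Pow W) = 2 ^ (7 * s)" using W finW[OF W] by (simp add: card_Pow Ws_def)
      finally show "(\<Sum>S\<in>Ss s W. path_prob (Q (s, W, S))) \<le> 2 ^ (7 * s) * (14 * z) ^ (8 * s)"
        using z by (simp add: mult_right_mono)
    qed
    also have "\<dots> = real (card (Ws s)) * (2 ^ (7 * s) * (14 * z) ^ (8 * s))" by simp
    also have "card (Ws s) = n choose (7 * s)" unfolding Ws_def by (simp add: n_subsets)
    \<comment> \<open>With \<open>z = s / n\<close>, the choices of \<open>W\<close> and
      \<open>S\<close> number at most \<open>(1 / z) ^ (7 * s)\<close>, against a probability of at
      most \<open>(14 * z) ^ (8 * s)\<close>: one power of \<open>z\<close> survives per vertex, and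
      the product is \<open>(14 ^ 8 * z) ^ s\<close>.\<close>
    also have "real (n choose (7 * s)) * (2 ^ (7 * s) * (14 * z) ^ (8 * s)) \<le>
        (3 * real n / real (7 * s)) ^ (7 * s) * (2 ^ (7 * s) * (14 * z) ^ (8 * s))"
      using z sn by (intro mult_right_mono binomial_le_three_power) auto
    also have "\<dots> = (3 * real n / real (7 * s) * 2) ^ (7 * s) * (14 * z) ^ (8 * s)"
      by (simp only: power_mult_distrib[of "3 * real n / real (7 * s)" 2] mult.assoc)
    also have "3 * real n / real (7 * s) * 2 = 6/7 / z" using sn n0 by (simp add: z_def field_simps)
    also have "(6/7 / z) ^ (7 * s) * (14 * z) ^ (8 * s) \<le> (1 / z) ^ (7 * s) * (14 * z) ^ (8 * s)"
      using z by (intro mult_right_mono power_mono) (auto simp: field_simps)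
    also have "\<dots> = ((1 / z) ^ 7 * (14 * z) ^ 8) ^ s"
      by (simp only: power_mult_distrib[of _ _ s] power_mult)
    also have "(1 / z) ^ 7 * (14 * z) ^ 8 = 14 ^ 8 * z"
    proof -
      have "z ^ 8 = z * z ^ 7" using power_add[of z 1 7] by simp
      then show ?thesis using z by (simp only: power_mult_distrib power_divide) simp
    qed
    \<comment> \<open>One factor is kept for the decay in \<open>n\<close>; the others are at most
      \<open>1/2\<close> by the bound on \<open>k\<close>.\<close>
    also have "(14 ^ 8 * z) ^ s = 14 ^ 8 * z * (14 ^ 8 * z) ^ (s - 1)"
      using sn by (cases s) (simp_all add: One_nat_def)
    also have "\<dots> \<le> 14 ^ 8 * z * (1/2) ^ (s - 1)"
      using z by (intro mult_left_mono power_mono) auto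
    also have "(1/2::real) ^ (s - 1) = 2 * (1/2) ^ s"
      using sn by (cases s) (auto simp: One_nat_def)
    finally show "(\<Sum>W\<in>Ws s. \<Sum>S\<in>Ss s W. path_prob (Q (s, W, S))) \<le> 2 * (14 ^ 8 / real n) * (real s * (1/2) ^ s)"
      by (simp add: z_def mult_ac)
  qed
  also have "\<dots> = 2 * (14 ^ 8 / real n) * (\<Sum>s=1..k. real s * (1/2) ^ s)"
    by (simp only: sum_distrib_left)
  also have "\<dots> \<le> 2 * (14 ^ 8 / real n) * 2"
    unfolding sum_nat_half_power by (intro mult_left_mono) auto
  finally show ?thesis by simp
qed

end

section \<open>Closing edges\<close>

lemma sum_Pow_power_card:
  fixes q :: "'b :: comm_semiring_1"
  assumes "finite A"
  shows "(\<Sum>I\<in>Pow A. q ^ card I) = (1 + q) ^ card A"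
  using assms
proof (induction A)
  case (insert a A)
  have inj: "inj_on (insert a) (Pow A)" using insert.hyps by (auto simp: inj_on_def)
  have "(\<Sum>I\<in>Pow (insert a A). q ^ card I) = (\<Sum>I\<in>Pow A. q ^ card I) + (\<Sum>I\<in>insert a ` Pow A. q ^ card I)"
    unfolding Pow_insert by (rule sum.union_disjoint) (use insert.hyps in auto)
  also have "(\<Sum>I\<in>insert a ` Pow A. q ^ card I) = (\<Sum>I\<in>Pow A. q ^ card (insert a I))"
    using sum.reindex[OF inj, of "\<lambda>I. q ^ card I"] by simp
  also have "\<dots> = (\<Sum>I\<in>Pow A. q * q ^ card I)"
  proof (rule sum.cong)
    fix I assume "I \<in> Pow A"
    then have "finite I" "a \<notin> I" using insert.hyps finite_subset by auto
    then show "q ^ card (insert a I) = q * q ^ card I" by simp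
  qed simp
  finally show ?case using insert by (simp add: sum_distrib_left[symmetric] distrib_right)
qed simp

text \<open>Exponential weighting as in Chernoff bounds: a set of size at most \<open>m\<close> is
  counted with weight \<open>L ^ m * (1 / L) ^ card I \<ge> 1\<close>. For \<open>L = ln n\<close>,
  \<open>m\<close> of order \<open>n\<close> and a ground set of order \<open>n * ln n\<close>, only
  \<open>exp (O(n ln ln n))\<close> sets result.\<close>

lemma card_small_subsets_le:
  fixes L :: real
  assumes "finite A" "L \<ge> 1"
  shows "real (card {I. I \<subseteq> A \<and> card I \<le> m}) \<le> L ^ m * exp (real (card A) / L)"
proof -
  have fin: "finite {I. I \<subseteq> A \<and> card I \<le> m}" using assms(1) by simp
  have "real (card {I. I \<subseteq> A \<and> card I \<le> m}) = (\<Sum>I\<in>{I. I \<subseteq> A \<and> card I \<le> m}. 1)" by simp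
  also have "\<dots> \<le> (\<Sum>I\<in>{I. I \<subseteq> A \<and> card I \<le> m}. L ^ m * (1 / L) ^ card I)"
  proof (rule sum_mono)
    fix I assume "I \<in> {I. I \<subseteq> A \<and> card I \<le> m}"
    then have "L ^ card I \<le> L ^ m" using assms(2) by (intro power_increasing) auto
    then show "1 \<le> L ^ m * (1 / L) ^ card I" using assms(2) by (simp add: power_divide)
  qed
  also have "\<dots> \<le> (\<Sum>I\<in>Pow A. L ^ m * (1 / L) ^ card I)"
    by (rule sum_mono2) (use assms in auto)
  also have "\<dots> = L ^ m * (1 + 1 / L) ^ card A"
    using sum_Pow_power_card[OF assms(1), of "1 / L"] by (simp add: sum_distrib_left[symmetric])
  also have "\<dots> \<le> L ^ m * exp (1 / L) ^ card A"
    using assms(2) by (intro mult_left_mono power_mono) auto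
  also have "exp (1 / L) ^ card A = exp (real (card A) / L)" by (simp add: exp_of_nat_mult[symmetric])
  finally show ?thesis .
qed

lemma edges_at_cong: "(\<And>s. s \<in> I \<union> Suc ` I \<Longrightarrow> x s = y s) \<Longrightarrow> edges_at x I = edges_at y I"
  unfolding edges_at_def by (intro image_cong) auto

text \<open>Halving sends both times of a pair to the same number, so an element of \<open>S\<close>
  spoils at most one pair.\<close>

lemma card_free_pairs:
  assumes "finite S"
  shows "T div 2 - 1 - card S \<le> card {t. even t \<and> 0 < t \<and> t < T \<and> t \<notin> S \<and> Suc t \<notin> S}"
proof -
  define J where "J = {1..<(T + 1) div 2}"
  have "T div 2 - 1 - card S \<le> card J - card ((\<lambda>s. s div 2) ` S)"
    using card_image_le[OF assms, of "\<lambda>s. s div 2"] by (simp add: J_def)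
  also have "\<dots> \<le> card (J - (\<lambda>s. s div 2) ` S)" by (rule diff_card_le_card_Diff) (use assms in simp)
  also have "\<dots> = card ((\<lambda>j. 2 * j) ` (J - (\<lambda>s. s div 2) ` S))" by (rule card_image[symmetric]) (simp add: inj_on_def)
  also have "\<dots> \<le> card {t. even t \<and> 0 < t \<and> t < T \<and> t \<notin> S \<and> Suc t \<notin> S}"
  proof (rule card_mono)
    show "(\<lambda>j. 2 * j) ` (J - (\<lambda>s. s div 2) ` S) \<subseteq> {t. even t \<and> 0 < t \<and> t < T \<and> t \<notin> S \<and> Suc t \<notin> S}"
    proof
      fix t assume "t \<in> (\<lambda>j. 2 * j) ` (J - (\<lambda>s. s div 2) ` S)"
      then obtain j where j: "t = 2 * j" "1 \<le> j" "j < (T + 1) div 2" "j \<notin> (\<lambda>s. s div 2) ` S" by (auto simp: J_def)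
      have "2 * j div 2 = j" "Suc (2 * j) div 2 = j" by simp_all
      then have "2 * j \<notin> S" "Suc (2 * j) \<notin> S" using j(4) by (metis image_eqI)+
      then show "t \<in> {t. even t \<and> 0 < t \<and> t < T \<and> t \<notin> S \<and> Suc t \<notin> S}" using j by auto
    qed
  qed simp
  finally show ?thesis .
qed

context complete_graph_walk
begin

text \<open>The steps tested are those from an even time \<open>t\<close> to \<open>t + 1\<close> with both times outside \<open>S\<close>, so that
  they use disjoint pairs of positions.  At the first position of a pair the factor \<open>g\<close> already
  accounts for the chance that the second one closes a longest path.\<close>

lemma path_prob_pinned_no_closing:
  assumes S: "finite S" and E: "expander k {1..n} E" and k: "k < n - 1"
  shows "path_prob (\<lambda>x. (\<forall>s\<in>S. x s = y s) \<and> (\<forall>t<T1. \<not> closing {1..n} E (x t) (x (Suc t)))) \<le>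
    (1 / (real n - 1)) ^ card S * (1 - (real k / (real n - 1))\<^sup>2) ^ (T1 div 2 - 1 - card S)"
proof -
  \<comment> \<open>At least \<open>k\<close> of the \<open>n - 1\<close> possible moves lead into
    \<open>A\<close>, and from there at least \<open>k\<close> close a longest path, the current
    vertex being discarded each time. A pair thus succeeds with probability at least
    \<open>\<kappa>\<^sup>2\<close>.\<close>
  define \<kappa> where "\<kappa> = real k / (real n - 1)"
  define a where "a = 1 - \<kappa>\<^sup>2"
  have \<kappa>: "0 \<le> \<kappa>" "\<kappa> < 1" using k by (auto simp: \<kappa>_def)
  have kk: "(real n - 1) * \<kappa> = real k" using two_vertices by (simp add: \<kappa>_def)
  have a: "0 < a" "a \<le> 1" using \<kappa> by (auto simp: a_def power_less_one_iff abs_square_less_1)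
  have ne: "{1..n} \<noteq> {}" using two_vertices by auto
  obtain A where A: "A \<subseteq> {1..n}" "k < card A" "\<And>v. v \<in> A \<Longrightarrow> k < card {b \<in> {1..n}. closing {1..n} E v b}"
    using closing_many[OF _ ne E] by auto
  have finA: "finite A" using A(1) finite_subset by blast
  obtain T where T: "S \<subseteq> {..T}" "T1 \<le> T"
  proof -
    obtain T' where "\<forall>s\<in>S. s \<le> T'" using S by (meson finite_nat_set_iff_bounded_le)
    then show thesis by (intro that[of "max T' T1"]) (auto intro: max.coboundedI1)
  qed
  \<comment> \<open>\<open>0 < t\<close> keeps the initial vertex free of tests, so that
    \<open>F 0\<close> accounts only for a possible pin; \<open>t < T1 \<le> T\<close> puts both
    times of a pair within the horizon.\<close>
  define good where "good t \<longleftrightarrow> even t \<and> 0 < t \<and> t < T1 \<and> t \<notin> S \<and> Suc t \<notin> S" for t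
  define g where "g v = (if v \<in> A then 1 - \<kappa> else 1)" for v
  define h where "h t v = (if good t then g v else 1)" for t v
  define \<phi> where "\<phi> s u v = (if s \<in> S then (if v = y s then real n - 1 else 0)
    else if good s then 1 / a
    else if 0 < s \<and> good (s - 1) then (if closing {1..n} E u v then 0 else 1) else 1)" for s u v
  have g0: "0 \<le> g v" for v using \<kappa> by (simp add: g_def)
  have phi0: "0 \<le> \<phi> s u v" for s u v using a two_vertices by (simp add: \<phi>_def)
  have step: "(\<Sum>w\<in>{1..n}-{v}. \<phi> (Suc t) v w * h (Suc t) w) \<le> (real n - 1) * h t v" if v: "v \<in> {1..n}" for t v
  proof -
    consider "Suc t \<in> S" | "good (Suc t)" | "Suc t \<notin> S" "\<not> good (Suc t)" "good t"
      | "Suc t \<notin> S" "\<not> good (Suc t)" "\<not> good t" by blast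
    then show ?thesis
    proof cases
      case 1
      then have ng: "\<not> good (Suc t)" "\<not> good t" by (auto simp: good_def)
      have "(\<Sum>w\<in>{1..n}-{v}. \<phi> (Suc t) v w * h (Suc t) w) = (\<Sum>w\<in>{1..n}-{v}. if w = y (Suc t) then real n - 1 else 0)"
        by (rule sum.cong) (use 1 ng in \<open>auto simp: \<phi>_def h_def\<close>)
      also have "\<dots> \<le> real n - 1" using two_vertices by simp
      finally show ?thesis using ng by (simp add: h_def)
    next
      case 2
      then have ng: "\<not> good t" "Suc t \<notin> S" by (auto simp: good_def)
      have "(\<Sum>w\<in>{1..n}-{v}. \<phi> (Suc t) v w * h (Suc t) w) = (\<Sum>w\<in>{1..n}-{v}. 1 / a - (if w \<in> A then \<kappa> / a else 0))"
        by (rule sum.cong) (use 2 ng in \<open>auto simp: \<phi>_def h_def g_def diff_divide_distrib\<close>)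
      also have "\<dots> = real (card ({1..n}-{v})) * (1 / a) - real (card (({1..n}-{v}) \<inter> A)) * (\<kappa> / a)"
        by (simp add: sum_subtractf sum.If_cases)
      also have "\<dots> \<le> real (card ({1..n}-{v})) * (1 / a) - real k * (\<kappa> / a)"
      proof -
        have "({1..n}-{v}) \<inter> A = A - {v}" using A(1) by auto
        moreover have "card A - 1 \<le> card (A - {v})" using finA by (metis card_Diff1_le card_Diff_singleton card_Diff_singleton_if order_refl diff_le_self)
        ultimately have "k \<le> card (({1..n}-{v}) \<inter> A)" using A(2) by simp
        then show ?thesis using \<kappa> a by (intro diff_left_mono mult_right_mono of_nat_mono) auto
      qed
      also have "\<dots> = ((real n - 1) - real k * \<kappa>) / a"
        using card_others[OF v] by (simp add: diff_divide_distrib)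
      also have "(real n - 1) - real k * \<kappa> = (real n - 1) * a"
        unfolding kk[symmetric] a_def by (simp add: power2_eq_square algebra_simps)
      also have "(real n - 1) * a / a = (real n - 1) * h t v" using a ng by (simp add: h_def)
      finally show ?thesis .
    next
      case 3
      define R where "R = {b \<in> {1..n}. closing {1..n} E v b}"
      have "(\<Sum>w\<in>{1..n}-{v}. \<phi> (Suc t) v w * h (Suc t) w) = (\<Sum>w\<in>{1..n}-{v}. 1 - (if w \<in> R then 1 else 0))"
        by (rule sum.cong) (use 3 in \<open>auto simp: \<phi>_def h_def R_def\<close>)
      also have "\<dots> = real (card ({1..n}-{v})) - real (card (({1..n}-{v}) \<inter> R))"
        by (simp add: sum_subtractf sum.If_cases)
      also have "\<dots> \<le> (real n - 1) * g v"
      proof (cases "v \<in> A")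
        case True
        have "({1..n}-{v}) \<inter> R = R - {v}" by (auto simp: R_def)
        moreover have "finite R" by (simp add: R_def)
        then have "card R - 1 \<le> card (R - {v})" by (metis card_Diff1_le card_Diff_singleton card_Diff_singleton_if order_refl diff_le_self)
        ultimately have "k \<le> card (({1..n}-{v}) \<inter> R)" using A(3)[OF True] by (simp add: R_def)
        then have "real k \<le> real (card (({1..n}-{v}) \<inter> R))" by (rule of_nat_mono)
        moreover have "(real n - 1) * g v = real n - 1 - real k" using True kk by (simp add: g_def algebra_simps)
        ultimately show ?thesis using card_others[OF v] by linarith
      next
        case False
        then show ?thesis using card_others[OF v] by (simp add: g_def)
      qed
      finally show ?thesis using 3 by (simp add: h_def)
    next
      case 4
      have "(\<Sum>w\<in>{1..n}-{v}. \<phi> (Suc t) v w * h (Suc t) w) = (\<Sum>w\<in>{1..n}-{v}. 1)"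
        by (rule sum.cong) (use 4 in \<open>auto simp: \<phi>_def h_def\<close>)
      then show ?thesis using card_others[OF v] 4 by (simp add: h_def)
    qed
  qed
  define G where "G = {t. good t}"
  define c where "c = (real n - 1) ^ card S * (1 / a) ^ card G"
  have cpos: "c > 0" using a two_vertices by (simp add: c_def)
  have finG: "finite G" by (rule finite_subset[of _ "{..T1}"]) (auto simp: G_def good_def)
  \<comment> \<open>At \<open>s = 0\<close> the truncated \<open>s - 1\<close> gives
    \<open>x 0\<close> as previous vertex; there \<open>\<phi>\<close> depends on its last argument
    only.\<close>
  define F where "F t x = (\<Prod>s\<in>{..t}. \<phi> s (x (s - 1)) (x s)) * h t (x t)" for t and x :: "nat \<Rightarrow> nat"
  have "path_prob (\<lambda>x. (\<forall>s\<in>S. x s = y s) \<and> (\<forall>t<T1. \<not> closing {1..n} E (x t) (x (Suc t)))) \<le> 1 / c"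
  proof (rule path_prob_supermartingale[where F = F and T = T])
    fix t :: nat and x z :: "nat \<Rightarrow> nat" assume xz: "\<And>s. s \<le> t \<Longrightarrow> x s = z s"
    have "(\<Prod>s\<in>{..t}. \<phi> s (x (s - 1)) (x s)) = (\<Prod>s\<in>{..t}. \<phi> s (z (s - 1)) (z s))"
      by (rule prod.cong) (use xz in auto)
    then show "F t x = F t z" using xz[of t] by (simp add: F_def)
  next
    fix t :: nat and x :: "nat \<Rightarrow> nat" assume t: "t < T" and x: "\<And>s. s \<le> t \<Longrightarrow> x s \<in> {1..n}"
    have "F (Suc t) (x(Suc t := w)) = (\<Prod>s\<in>{..t}. \<phi> s (x (s - 1)) (x s)) * (\<phi> (Suc t) (x t) w * h (Suc t) w)" for w
    proof -
      have "(\<Prod>s\<in>{..t}. \<phi> s ((x(Suc t := w)) (s - 1)) ((x(Suc t := w)) s)) = (\<Prod>s\<in>{..t}. \<phi> s (x (s - 1)) (x s))"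
        by (rule prod.cong) auto
      moreover have "(x(Suc t := w)) (Suc t - 1) = x t" by simp
      ultimately show ?thesis unfolding F_def prod.atMost_Suc by (simp only: fun_upd_same mult.assoc)
    qed
    then have "(\<Sum>w\<in>{1..n}-{x t}. F (Suc t) (x(Suc t := w))) =
        (\<Prod>s\<in>{..t}. \<phi> s (x (s - 1)) (x s)) * (\<Sum>w\<in>{1..n}-{x t}. \<phi> (Suc t) (x t) w * h (Suc t) w)"
      by (simp add: sum_distrib_left)
    also have "\<dots> \<le> (\<Prod>s\<in>{..t}. \<phi> s (x (s - 1)) (x s)) * ((real n - 1) * h t (x t))"
      by (intro mult_left_mono step x prod_nonneg) (auto simp: phi0)
    finally show "(\<Sum>w\<in>{1..n}-{x t}. F (Suc t) (x(Suc t := w))) \<le> (real n - 1) * F t x"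
      by (simp add: F_def mult_ac)
  next
    fix x :: "nat \<Rightarrow> nat"
    show "0 \<le> F T x" unfolding F_def h_def by (intro mult_nonneg_nonneg prod_nonneg phi0) (auto simp: g0)
  next
    fix x :: "nat \<Rightarrow> nat"
    assume Q: "(\<forall>s\<in>S. x s = y s) \<and> (\<forall>t<T1. \<not> closing {1..n} E (x t) (x (Suc t)))"
    \<comment> \<open>No pair is left half finished at the horizon.\<close>
    have hT: "h T (x T) = 1" using T(2) by (simp add: h_def good_def)
    have "(\<Prod>s\<in>{..T}. \<phi> s (x (s - 1)) (x s)) = (\<Prod>s\<in>{..T}. (if s \<in> S then real n - 1 else 1) * (if s \<in> G then 1 / a else 1))"
    proof (rule prod.cong)
      fix s assume "s \<in> {..T}"
      have "\<not> closing {1..n} E (x (s - 1)) (x s)" if gs: "0 < s" "good (s - 1)"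
        using Q gs by (cases s) (auto simp: good_def)
      then show "\<phi> s (x (s - 1)) (x s) = (if s \<in> S then real n - 1 else 1) * (if s \<in> G then 1 / a else 1)"
        using Q by (auto simp: \<phi>_def G_def good_def)
    qed simp
    also have "\<dots> = (\<Prod>s\<in>{..T}. if s \<in> S then real n - 1 else 1) * (\<Prod>s\<in>{..T}. if s \<in> G then 1 / a else 1)"
      by (rule prod.distrib)
    also have "(\<Prod>s\<in>{..T}. if s \<in> S then real n - 1 else 1) = (real n - 1) ^ card S"
      using T(1) by (simp add: prod.If_cases Int_absorb1)
    also have "(\<Prod>s\<in>{..T}. if s \<in> G then 1 / a else 1) = (1 / a) ^ card G"
    proof -
      have "G \<subseteq> {..T}" using T(2) by (auto simp: G_def good_def)
      then show ?thesis by (simp add: prod.If_cases Int_absorb1)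
    qed
    finally show "c \<le> F T x" using hT by (simp add: F_def c_def)
  next
    have "F 0 (\<lambda>_. v) = (if 0 \<in> S then (if v = y 0 then real n - 1 else 0) else 1)" for v
      by (simp add: F_def h_def \<phi>_def good_def)
    then have "(\<Sum>v\<in>{1..n}. F 0 (\<lambda>_. v)) = (if 0 \<in> S then (\<Sum>v\<in>{1..n}. if v = y 0 then real n - 1 else 0) else real n)"
      by simp
    also have "\<dots> \<le> real n" using two_vertices by simp
    finally show "(\<Sum>v\<in>{1..n}. F 0 (\<lambda>_. v)) \<le> real n * 1" by simp
  qed (rule cpos)
  also have "1 / c = (1 / (real n - 1)) ^ card S * a ^ card G"
    using a by (simp add: c_def power_divide)
  also have "\<dots> \<le> (1 / (real n - 1)) ^ card S * a ^ (T1 div 2 - 1 - card S)"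
  proof -
    have "T1 div 2 - 1 - card S \<le> card G" using card_free_pairs[OF S, of T1] by (simp add: G_def good_def)
    then show ?thesis using a two_vertices by (intro mult_left_mono power_decreasing) auto
  qed
  finally show ?thesis by (simp add: a_def \<kappa>_def)
qed

text \<open>Once \<open>I\<close> and the values at the ends of its steps are fixed, the graph no
  longer depends on the walk and the pinned bound applies. At most \<open>n\<close> values per
  pinned time against a probability \<open>1 / (n - 1)\<close> leave a factor
  \<open>n / (n - 1) \<le> 2\<close>, hence \<open>4 ^ m\<close> for at most \<open>2 * m\<close>
  times.\<close>

lemma path_prob_no_booster:
  assumes k: "k < n - 1" and L: "L \<ge> 1"
  shows "path_prob (\<lambda>x. \<exists>I\<subseteq>{..T2}. card I \<le> m \<and> expander k {1..n} (edges_at x I) \<and>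
      (\<forall>t<T1. \<not> closing {1..n} (edges_at x I) (x t) (x (Suc t)))) \<le>
    L ^ m * exp ((real T2 + 1) / L) * (4 ^ m * (1 - (real k / (real n - 1))\<^sup>2) ^ (T1 div 2 - 1 - 2 * m))"
proof -
  define a where "a = 1 - (real k / (real n - 1))\<^sup>2"
  have a: "0 \<le> a" "a \<le> 1" using k by (auto simp: a_def power_le_one_iff)
  define \<I> where "\<I> = {I. I \<subseteq> {..T2} \<and> card I \<le> m}"
  define S where "S I = I \<union> Suc ` I" for I
  define Y where "Y I = {y \<in> PiE (S I) (\<lambda>_. {1..n}). expander k {1..n} (edges_at y I)}" for I
  define Q where "Q p = (\<lambda>x. (\<forall>s\<in>S (fst p). x s = snd p s) \<and>
      (\<forall>t<T1. \<not> closing {1..n} (edges_at (snd p) (fst p)) (x t) (x (Suc t))))" for p :: "nat set \<times> (nat \<Rightarrow> nat)"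
  have fin\<I>: "finite \<I>" by (simp add: \<I>_def)
  have finI: "finite I" if "I \<in> \<I>" for I using that finite_subset by (auto simp: \<I>_def)
  have finS: "finite (S I)" if "I \<in> \<I>" for I using finI[OF that] by (simp add: S_def)
  have cardS: "card (S I) \<le> 2 * m" if "I \<in> \<I>" for I
  proof -
    have "card (S I) \<le> card I + card (Suc ` I)" unfolding S_def by (rule card_Un_le)
    also have "card (Suc ` I) = card I" by (simp add: card_image)
    finally show ?thesis using that by (simp add: \<I>_def)
  qed
  have finY: "finite (Y I)" if "I \<in> \<I>" for I unfolding Y_def using finS[OF that] by (simp add: finite_PiE)
  have "path_prob (\<lambda>x. \<exists>I\<subseteq>{..T2}. card I \<le> m \<and> expander k {1..n} (edges_at x I) \<and>
      (\<forall>t<T1. \<not> closing {1..n} (edges_at x I) (x t) (x (Suc t)))) \<le> (\<Sum>p\<in>(SIGMA I:\<I>. Y I). path_prob (Q p))"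
  proof (rule path_prob_union)
    show "finite (SIGMA I:\<I>. Y I)" by (intro finite_SigmaI fin\<I> finY)
    show "finitary (Q p)" if "p \<in> (SIGMA I:\<I>. Y I)" for p
    proof -
      have "fst p \<in> \<I>" using that by auto
      moreover have "finitary (\<lambda>x. \<forall>t<T1. \<not> closing {1..n} (edges_at (snd p) (fst p)) (x t) (x (Suc t)))"
        by (rule finitaryI[of T1]) auto
      ultimately show ?thesis unfolding Q_def by (intro finitary_conj finitary_pinned finS)
    qed
    fix x :: "nat \<Rightarrow> nat" assume x: "\<And>s. x s \<in> {1..n}"
      and "\<exists>I\<subseteq>{..T2}. card I \<le> m \<and> expander k {1..n} (edges_at x I) \<and>
        (\<forall>t<T1. \<not> closing {1..n} (edges_at x I) (x t) (x (Suc t)))"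
    then obtain I where I: "I \<subseteq> {..T2}" "card I \<le> m" "expander k {1..n} (edges_at x I)"
      "\<forall>t<T1. \<not> closing {1..n} (edges_at x I) (x t) (x (Suc t))" by blast
    define y where "y = restrict x (S I)"
    have e: "edges_at y I = edges_at x I" by (rule edges_at_cong) (auto simp: y_def S_def)
    have "(I, y) \<in> (SIGMA I:\<I>. Y I)" using I x e by (auto simp: \<I>_def Y_def y_def simp del: atLeastAtMost_iff)
    moreover have "Q (I, y) x" using I(4) e by (auto simp: Q_def y_def)
    ultimately show "\<exists>p\<in>(SIGMA I:\<I>. Y I). Q p x" by blast
  qed
  also have "\<dots> = (\<Sum>I\<in>\<I>. \<Sum>y\<in>Y I. path_prob (Q (I, y)))"
    using fin\<I> finY by (subst sum.Sigma) (auto simp: case_prod_unfold)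
  also have "\<dots> \<le> (\<Sum>I\<in>\<I>. 4 ^ m * a ^ (T1 div 2 - 1 - 2 * m))"
  proof (rule sum_mono)
    fix I assume I: "I \<in> \<I>"
    have "(\<Sum>y\<in>Y I. path_prob (Q (I, y))) \<le> (\<Sum>y\<in>Y I. (1 / (real n - 1)) ^ card (S I) * a ^ (T1 div 2 - 1 - 2 * m))"
    proof (rule sum_mono)
      fix y assume y: "y \<in> Y I"
      have "path_prob (Q (I, y)) \<le> (1 / (real n - 1)) ^ card (S I) * a ^ (T1 div 2 - 1 - card (S I))"
        unfolding Q_def a_def fst_conv snd_conv
        by (rule path_prob_pinned_no_closing) (use y k finS[OF I] in \<open>auto simp: Y_def\<close>)
      also have "\<dots> \<le> (1 / (real n - 1)) ^ card (S I) * a ^ (T1 div 2 - 1 - 2 * m)"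
        using a cardS[OF I] two_vertices by (intro mult_left_mono power_decreasing) auto
      finally show "path_prob (Q (I, y)) \<le> (1 / (real n - 1)) ^ card (S I) * a ^ (T1 div 2 - 1 - 2 * m)" .
    qed
    also have "\<dots> = real (card (Y I)) * ((1 / (real n - 1)) ^ card (S I) * a ^ (T1 div 2 - 1 - 2 * m))" by simp
    also have "\<dots> \<le> real n ^ card (S I) * ((1 / (real n - 1)) ^ card (S I) * a ^ (T1 div 2 - 1 - 2 * m))"
    proof (rule mult_right_mono)
      have "card (Y I) \<le> card (PiE (S I) (\<lambda>_. {1..n}))"
        by (rule card_mono) (use finS[OF I] in \<open>auto simp: Y_def intro: finite_PiE\<close>)
      also have "\<dots> = n ^ card (S I)" using finS[OF I] by (simp add: card_PiE)
      finally show "real (card (Y I)) \<le> real n ^ card (S I)" by (metis of_nat_mono of_nat_power)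
    qed (use a two_vertices in auto)
    also have "\<dots> = (real n / (real n - 1)) ^ card (S I) * a ^ (T1 div 2 - 1 - 2 * m)"
      by (simp add: power_divide)
    also have "\<dots> \<le> 4 ^ m * a ^ (T1 div 2 - 1 - 2 * m)"
    proof (rule mult_right_mono)
      have "(real n / (real n - 1)) ^ card (S I) \<le> 2 ^ card (S I)"
        using two_vertices by (intro power_mono) (auto simp: field_simps)
      also have "\<dots> \<le> 2 ^ (2 * m)" using cardS[OF I] by (intro power_increasing) auto
      also have "\<dots> = (4::real) ^ m" by (simp add: power_mult)
      finally show "(real n / (real n - 1)) ^ card (S I) \<le> 4 ^ m" .
    qed (use a in auto)
    finally show "(\<Sum>y\<in>Y I. path_prob (Q (I, y))) \<le> 4 ^ m * a ^ (T1 div 2 - 1 - 2 * m)" .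
  qed
  also have "\<dots> = real (card \<I>) * (4 ^ m * a ^ (T1 div 2 - 1 - 2 * m))" by simp
  also have "\<dots> \<le> L ^ m * exp (real (card {..T2}) / L) * (4 ^ m * a ^ (T1 div 2 - 1 - 2 * m))"
    unfolding \<I>_def using a L by (intro mult_right_mono card_small_subsets_le) auto
  finally show ?thesis by (simp add: a_def add.commute)
qed

end

section \<open>Combining the bounds\<close>

text \<open>Of order \<open>n powr (1 - 21/16)\<close> times the fourth power of
  \<open>ln n\<close>, where \<open>21/16 = 7/4 * 3/4\<close>.\<close>

definition err_close :: "nat \<Rightarrow> real" where
  "err_close n = real n * (2 * 16 ^ 14 * 8 ^ 8 * exp (- (7/4) * (3/4 * real n * ln (real n) - 1) / (real n - 1)) *
     (2 * (2 * real n * ln (real n) + 2) / real n + 33) ^ 4)"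

text \<open>The first three terms count time sets and pinned values and are
  \<open>O(n ln ln n)\<close>; the last comes from about \<open>3/8 * n * ln n\<close> free pairs,
  each succeeding with at least the square of \<open>1 / (4 * 14 ^ 8)\<close>.\<close>

definition err_boost :: "nat \<Rightarrow> real" where
  "err_boost n = exp (10 * real n * ln (ln (real n)) + (2 * real n * ln (real n) + 2) / ln (real n) + 10 * real n * ln 4
     - (1 / (4 * 14 ^ 8))\<^sup>2 * (3/8 * real n * ln (real n) - 3 - 20 * real n))"

definition err :: "nat \<Rightarrow> real" where
  "err n = 1 / real n + exp (3/4 * real n * ln (real n) / (real n - 1)) / real n
    + 2 * 16 ^ 14 * 8 ^ 8 * (1 + (2 * real n * ln (real n) + 2) / real n) *
        exp (- (7/8) * (3/4 * real n * ln (real n) - 1) / (real n - 1))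
    + err_close n + 4 * 14 ^ 8 / real n + err_boost n"

lemma err_close_tendsto: "err_close \<longlonglongrightarrow> 0"
  unfolding err_close_def by real_asymp

lemma err_boost_tendsto: "err_boost \<longlonglongrightarrow> 0"
proof -
  \<comment> \<open>Any positive multiple of \<open>n * ln n\<close> beats
    \<open>n * ln (ln n)\<close>, so the concrete constant is abstracted to
    \<open>c\<close>.\<close>
  have "(\<lambda>n. exp (10 * real n * ln (ln (real n)) + (2 * real n * ln (real n) + 2) / ln (real n) + 10 * real n * ln 4
     - c * (3/8 * real n * ln (real n) - 3 - 20 * real n))) \<longlonglongrightarrow> 0" if "c > 0" for c :: real
    using that by real_asymp
  then show ?thesis unfolding err_boost_def by simp
qed

lemma err_tendsto: "err \<longlonglongrightarrow> 0"
proof -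
  have "(\<lambda>n. 1 / real n + exp (3/4 * real n * ln (real n) / (real n - 1)) / real n
    + 2 * 16 ^ 14 * 8 ^ 8 * (1 + (2 * real n * ln (real n) + 2) / real n) *
        exp (- (7/8) * (3/4 * real n * ln (real n) - 1) / (real n - 1))) \<longlonglongrightarrow> 0"
    by real_asymp
  moreover have "(\<lambda>n. 4 * 14 ^ 8 / real n) \<longlonglongrightarrow> 0" by real_asymp
  ultimately have "err \<longlonglongrightarrow> 0 + 0 + 0 + 0"
    unfolding err_def by (intro tendsto_add err_close_tendsto err_boost_tendsto)
  then show ?thesis by simp
qed

definition early :: "nat \<Rightarrow> nat" where
  "early n = nat \<lfloor>3/4 * real n * ln (real n)\<rfloor>"

text \<open>The factor 2 makes the union bound over unvisited vertices
  \<open>n * exp (- 2 * ln n) = 1 / n\<close>.\<close>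

definition late :: "nat \<Rightarrow> nat" where
  "late n = nat \<lceil>2 * real n * ln (real n)\<rceil>"

lemma early_bounds:
  assumes "n \<ge> 2"
  shows "real (early n) \<le> 3/4 * real n * ln (real n)" "3/4 * real n * ln (real n) - 1 \<le> real (early n)"
proof -
  have "0 \<le> 3/4 * real n * ln (real n)" using assms by simp
  then show "real (early n) \<le> 3/4 * real n * ln (real n)" "3/4 * real n * ln (real n) - 1 \<le> real (early n)"
    unfolding early_def by linarith+
qed

lemma late_bounds:
  assumes "n \<ge> 2"
  shows "2 * real n * ln (real n) \<le> real (late n)" "real (late n) \<le> 2 * real n * ln (real n) + 1"
proof -
  have "0 \<le> 2 * real n * ln (real n)" using assms by simp
  then show "2 * real n * ln (real n) \<le> real (late n)" "real (late n) \<le> 2 * real n * ln (real n) + 1"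
    unfolding late_def by linarith+
qed

lemma one_minus_power_le_exp:
  fixes q :: real
  assumes "q \<le> 1"
  shows "(1 - q) ^ T \<le> exp (- (q * real T))"
proof -
  have "(1 - q) ^ T \<le> exp (- q) ^ T" using assms exp_ge_add_one_self[of "- q"] by (intro power_mono) auto
  then show ?thesis by (simp add: exp_of_nat_mult[symmetric] mult.commute)
qed

text \<open>Equality of possibly infinite times is split into countably many comparisons with finite
  times, which are measurable.\<close>

lemma enat_eq_plus_one_iff:
  "a = b + (1 :: enat) \<longleftrightarrow> (\<forall>k. a \<le> enat k \<longleftrightarrow> (\<exists>j<k. b \<le> enat j))"
proof
  assume "a = b + 1"
  then show "\<forall>k. a \<le> enat k \<longleftrightarrow> (\<exists>j<k. b \<le> enat j)"
    by (cases b) (auto simp: one_enat_def intro: exI[of _ "the_enat b"])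
next
  assume R: "\<forall>k. a \<le> enat k \<longleftrightarrow> (\<exists>j<k. b \<le> enat j)"
  show "a = b + 1"
  proof (cases b)
    case (enat m)
    have "a \<le> enat (Suc m)" using R[rule_format, of "Suc m"] enat by auto
    moreover have "\<not> a \<le> enat m" using R[rule_format, of m] enat by auto
    ultimately show ?thesis using enat by (cases a) (auto simp: one_enat_def)
  next
    case infinity
    then have "\<not> a \<le> enat k" for k using R by simp
    then show ?thesis using infinity by (cases a) auto
  qed
qed

context complete_graph_walk
begin

text \<open>Measurability turns the bound on the failure probability into a lower bound for the
  event itself.\<close>

lemma hamilton_event_sets:
  "{\<omega> \<in> space M. hamilton_time n (\<lambda>t. X t \<omega>) = cover_time n (\<lambda>t. X t \<omega>) + 1} \<in> sets M"
proof -
  have [measurable]: "Measurable.pred M (\<lambda>\<omega>. hamiltonian {1..n} (set_mset (walk_trace (\<lambda>t. X t \<omega>) t)))" for t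
  proof -
    have "finitary (\<lambda>x. hamiltonian {1..n} (set_mset (walk_trace x t)))"
    proof (rule finitaryI[of t])
      fix x y :: "nat \<Rightarrow> nat" assume "\<And>s. s \<le> t \<Longrightarrow> x s = y s"
      then have "edges_at x {..<t} = edges_at y {..<t}" by (intro edges_at_cong) auto
      then show "hamiltonian {1..n} (set_mset (walk_trace x t)) = hamiltonian {1..n} (set_mset (walk_trace y t))"
        by (simp add: set_walk_trace)
    qed
    from finitary_sets[OF this] show ?thesis by (simp add: pred_def)
  qed
  show ?thesis
    unfolding enat_eq_plus_one_iff hamilton_time_def cover_time_def first_time_le_iff by measurable
qed

lemma avoid_rate_early:
  assumes "n \<ge> 5" "m \<le> 2"
  shows "avoid_rate m ^ early n \<le> exp (- (real m * (7/8)) * (3/4 * real n * ln (real n) - 1) / (real n - 1))"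
proof -
  have "real m * (7/8) / (real n - 1) \<le> 1" using avoid_rate_bounds[OF assms] by (simp add: avoid_rate_def)
  then have "avoid_rate m ^ early n \<le> exp (- (real m * (7/8) / (real n - 1) * real (early n)))"
    unfolding avoid_rate_def by (rule one_minus_power_le_exp)
  also have "\<dots> \<le> exp (- (real m * (7/8) / (real n - 1) * (3/4 * real n * ln (real n) - 1)))"
    using early_bounds(2)[of n] assms by (simp add: mult_left_mono divide_right_mono)
  finally show ?thesis by simp
qed

lemma path_prob_not_hamilton:
  assumes n: "4 * 14 ^ 8 \<le> n"
  shows "path_prob (\<lambda>x. hamilton_time n x \<noteq> cover_time n x + 1) \<le> err n"
proof -
  define T1 where "T1 = early n"
  define T2 where "T2 = late n"
  \<comment> \<open>The largest value that \<open>path_prob_not_expanding\<close> admits; the lower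
    bound on \<open>n\<close> makes it positive.\<close>
  define k where "k = n div (2 * 14 ^ 8)"
  define K where "K = (2 * 16 ^ 14 * 8 ^ 8 :: real)"
  have n5: "n \<ge> 5" and n2: "n \<ge> 2" using n by auto
  have ln1: "ln (real n) \<ge> 1"
  proof -
    have "exp 1 \<le> real n" using exp_le n5 by linarith
    then show ?thesis using n5 by (simp add: ln_ge_iff)
  qed
  have k: "1 \<le> k" "2 * 14 ^ 8 * k \<le> n" "k < n - 1"
    using n unfolding k_def by auto
  \<comment> \<open>One index per bad event of \<open>hamilton_time_eq\<close>, whose contrapositive
    thereby becomes a union bound over eight events.\<close>
  define B where "B i = (\<lambda>x :: nat \<Rightarrow> nat.
    if i = 0 then \<exists>t\<le>T2. x t = x (Suc t)
    else if i = 1 then \<exists>v\<in>{1..n}. \<forall>s\<le>T2. x s \<noteq> v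
    else if i = 2 then \<forall>v\<in>{1..n}. \<exists>s\<le>T1. x s = v
    else if i = 3 then small x T1 (x 0)
    else if i = 4 then \<exists>t\<le>T2. small x T1 (x (Suc t)) \<and> x t = x (Suc (Suc t))
    else if i = 5 then \<exists>u\<in>{1..n}. \<exists>v\<in>{1..n}. u \<noteq> v \<and> small x T1 u \<and> small x T1 v \<and> reach x T2 4 u v
    else if i = 6 then \<exists>S\<subseteq>{1..n}. S \<noteq> {} \<and> card S \<le> k \<and> (\<forall>v\<in>S. \<not> small x T1 v) \<and>
      card (S \<union> (\<Union>v\<in>S. outs x T1 v)) < 7 * card S
    else \<exists>I\<subseteq>{..T2}. card I \<le> 10 * n \<and> expander k {1..n} (edges_at x I) \<and>
      (\<forall>t<T1. \<not> closing {1..n} (edges_at x I) (x t) (x (Suc t))))" for i :: nat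
  have fin: "finitary (B i)" for i
  proof -
    consider "i = 0" | "i = 1" | "i = 2" | "i = 3" | "i = 4" | "i = 5" | "i = 6" | "i > 6" by linarith
    then show ?thesis
    proof cases
      case 1
      then show ?thesis unfolding B_def by simp (rule finitaryI[of "Suc T2"], auto)
    next
      case 2
      then show ?thesis unfolding B_def by simp (rule finitaryI[of T2], auto)
    next
      case 3
      have "finitary (\<lambda>x :: nat \<Rightarrow> nat. \<forall>v\<in>{1..n}. \<exists>s\<le>T1. x s = v)"
      proof (rule finitaryI[of T1])
        fix x y :: "nat \<Rightarrow> nat" assume "\<And>s. s \<le> T1 \<Longrightarrow> x s = y s"
        then have "(\<exists>s\<le>T1. x s = v) = (\<exists>s\<le>T1. y s = v)" for v by (intro ex_cong1) auto
        then show "(\<forall>v\<in>{1..n}. \<exists>s\<le>T1. x s = v) = (\<forall>v\<in>{1..n}. \<exists>s\<le>T1. y s = v)" by simp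
      qed
      then show ?thesis using 3 unfolding B_def by simp
    next
      case 4
      have "finitary (\<lambda>x :: nat \<Rightarrow> nat. small x T1 (x 0))"
      proof (rule finitaryI[of T1])
        fix x y :: "nat \<Rightarrow> nat" assume "\<And>s. s \<le> T1 \<Longrightarrow> x s = y s"
        then show "small x T1 (x 0) = small y T1 (y 0)" using small_cong[of T1 x y "x 0"] by simp
      qed
      then show ?thesis using 4 unfolding B_def by simp
    next
      case 5
      have "finitary (\<lambda>x :: nat \<Rightarrow> nat. \<exists>t\<in>{..T2}. small x T1 (x (Suc t)) \<and> x t = x (Suc (Suc t)))"
      proof (rule finitary_bex)
        fix t
        show "finitary (\<lambda>x :: nat \<Rightarrow> nat. small x T1 (x (Suc t)) \<and> x t = x (Suc (Suc t)))"
        proof (rule finitaryI[of "T1 + t + 2"])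
          fix x y :: "nat \<Rightarrow> nat" assume xy: "\<And>s. s \<le> T1 + t + 2 \<Longrightarrow> x s = y s"
          have "small x T1 (x (Suc t)) = small y T1 (x (Suc t))" by (rule small_cong) (use xy in auto)
          then show "(small x T1 (x (Suc t)) \<and> x t = x (Suc (Suc t))) = (small y T1 (y (Suc t)) \<and> y t = y (Suc (Suc t)))"
            using xy[of t] xy[of "Suc t"] xy[of "Suc (Suc t)"] by simp
        qed
      qed simp
      then show ?thesis using 5 unfolding B_def by (simp add: Bex_def)
    next
      case 6
      have "finitary (\<lambda>x :: nat \<Rightarrow> nat. \<exists>u\<in>{1..n}. \<exists>v\<in>{1..n}. u \<noteq> v \<and> small x T1 u \<and> small x T1 v \<and> reach x T2 4 u v)"
        by (intro finitary_bex finitary_conj finitary_small finitary_reach) (auto simp: finitary_def)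
      then show ?thesis using 6 unfolding B_def by simp
    next
      case 7
      have "finitary (\<lambda>x :: nat \<Rightarrow> nat. \<exists>S\<subseteq>{1..n}. S \<noteq> {} \<and> card S \<le> k \<and> (\<forall>v\<in>S. \<not> small x T1 v) \<and>
          card (S \<union> (\<Union>v\<in>S. outs x T1 v)) < 7 * card S)"
      proof (rule finitaryI[of T1])
        fix x y :: "nat \<Rightarrow> nat" assume xy: "\<And>s. s \<le> T1 \<Longrightarrow> x s = y s"
        have "small x T1 v = small y T1 v" for v by (rule small_cong) (use xy in auto)
        moreover have "outs x T1 v = outs y T1 v" for v by (rule outs_cong) (use xy in auto)
        ultimately show "(\<exists>S\<subseteq>{1..n}. S \<noteq> {} \<and> card S \<le> k \<and> (\<forall>v\<in>S. \<not> small x T1 v) \<and>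
          card (S \<union> (\<Union>v\<in>S. outs x T1 v)) < 7 * card S) = (\<exists>S\<subseteq>{1..n}. S \<noteq> {} \<and> card S \<le> k \<and> (\<forall>v\<in>S. \<not> small y T1 v) \<and>
          card (S \<union> (\<Union>v\<in>S. outs y T1 v)) < 7 * card S)" by simp
      qed
      then show ?thesis using 7 unfolding B_def by simp
    next
      case 8
      have "finitary (\<lambda>x :: nat \<Rightarrow> nat. \<exists>I\<in>Pow {..T2}. card I \<le> 10 * n \<and> expander k {1..n} (edges_at x I) \<and>
          (\<forall>t<T1. \<not> closing {1..n} (edges_at x I) (x t) (x (Suc t))))"
      proof (rule finitary_bex)
        fix I assume I: "I \<in> Pow {..T2}"
        show "finitary (\<lambda>x :: nat \<Rightarrow> nat. card I \<le> 10 * n \<and> expander k {1..n} (edges_at x I) \<and>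
          (\<forall>t<T1. \<not> closing {1..n} (edges_at x I) (x t) (x (Suc t))))"
        proof (rule finitaryI[of "T1 + Suc T2"])
          fix x y :: "nat \<Rightarrow> nat" assume xy: "\<And>s. s \<le> T1 + Suc T2 \<Longrightarrow> x s = y s"
          have e: "edges_at x I = edges_at y I" by (rule edges_at_cong) (use xy I in auto)
          show "(card I \<le> 10 * n \<and> expander k {1..n} (edges_at x I) \<and>
              (\<forall>t<T1. \<not> closing {1..n} (edges_at x I) (x t) (x (Suc t)))) =
            (card I \<le> 10 * n \<and> expander k {1..n} (edges_at y I) \<and>
              (\<forall>t<T1. \<not> closing {1..n} (edges_at y I) (y t) (y (Suc t))))"
            unfolding e using xy by simp
        qed
      qed simp
      then show ?thesis using 8 unfolding B_def by (simp add: Bex_def)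
    qed
  qed
  have "path_prob (\<lambda>x. hamilton_time n x \<noteq> cover_time n x + 1) \<le> (\<Sum>i\<in>{..<8}. path_prob (B i))"
  proof (rule path_prob_union)
    fix x :: "nat \<Rightarrow> nat" assume x: "\<And>s. x s \<in> {1..n}" and bad: "hamilton_time n x \<noteq> cover_time n x + 1"
    show "\<exists>i\<in>{..<8}. B i x"
    proof (rule ccontr)
      assume "\<not> ?thesis"
      then have no: "\<not> B 0 x" "\<not> B 1 x" "\<not> B 2 x" "\<not> B 3 x" "\<not> B 4 x" "\<not> B 5 x" "\<not> B 6 x" "\<not> B 7 x" by simp_all
      have "hamilton_time n x = cover_time n x + 1"
        by (rule hamilton_time_eq[where k = k and ?T1.0 = T1 and ?T2.0 = T2])
           (use n5 in linarith, rule k(1), rule x,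
            use no(1) in \<open>simp add: B_def\<close>,
            use no(2) in \<open>simp add: B_def\<close>,
            use no(3) in \<open>simp add: B_def\<close>,
            use no(4) in \<open>simp add: B_def\<close>,
            use no(5) in \<open>simp add: B_def\<close>,
            use no(6) in \<open>simp add: B_def\<close>,
            use no(7) in \<open>simp add: B_def\<close>,
            use no(8) in \<open>simp add: B_def\<close>)
      then show False using bad by simp
    qed
  qed (use fin in auto)
  also have "\<dots> = path_prob (B 0) + path_prob (B 1) + path_prob (B 2) + path_prob (B 3) + path_prob (B 4) + path_prob (B 5) + path_prob (B 6) + path_prob (B 7)"
    by (simp add: eval_nat_numeral One_nat_def)
  also have "\<dots> \<le> 0 + 1 / real n + exp (3/4 * real n * ln (real n) / (real n - 1)) / real n
      + K * avoid_rate 1 ^ T1 + K * ((real T2 + 1) / real n) * avoid_rate 1 ^ T1 + err_close n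
      + 4 * 14 ^ 8 / real n + err_boost n"
  proof (intro add_mono)
    show "path_prob (B 0) \<le> 0" using path_prob_loop[of T2] by (simp add: B_def)
    show "path_prob (B 1) \<le> 1 / real n"
    proof -
      have "path_prob (B 1) \<le> real n * (1 - 1 / (real n - 1)) ^ T2"
        using path_prob_uncovered[of T2] by (simp add: B_def)
      also have "(1 - 1 / (real n - 1)) ^ T2 \<le> exp (- (1 / (real n - 1) * real T2))"
        by (rule one_minus_power_le_exp) (use n2 in simp)
      also have "\<dots> \<le> exp (- (2 * ln (real n)))"
      proof -
        have "2 * ln (real n) * (real n - 1) \<le> 2 * real n * ln (real n)" using ln1 by (simp add: algebra_simps)
        also have "\<dots> \<le> real T2" unfolding T2_def by (rule late_bounds) (rule n2)
        finally show ?thesis using n2 by (simp add: field_simps)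
      qed
      also have "exp (- (2 * ln (real n))) = 1 / (real n * real n)"
        using n2 by (simp add: exp_minus exp_double power2_eq_square inverse_eq_divide)
      finally show ?thesis using n2 by (simp add: mult_left_mono)
    qed
    \<comment> \<open>The factor 3/4 in \<open>early\<close> makes this about
      \<open>n powr (- 1/4)\<close>.\<close>
    show "path_prob (B 2) \<le> exp (3/4 * real n * ln (real n) / (real n - 1)) / real n"
    proof -
      have "path_prob (B 2) \<le> (1 + 1 / (real n - 1)) ^ T1 / real n"
        using path_prob_covered_early[of T1] by (simp add: B_def)
      also have "(1 + 1 / (real n - 1)) ^ T1 \<le> exp (1 / (real n - 1)) ^ T1"
        by (intro power_mono exp_ge_add_one_self) (use n2 in auto)
      also have "\<dots> = exp (real T1 / (real n - 1))" by (simp add: exp_of_nat_mult[symmetric])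
      also have "\<dots> \<le> exp (3/4 * real n * ln (real n) / (real n - 1))"
        unfolding exp_le_cancel_iff T1_def by (rule divide_right_mono) (use early_bounds(1)[OF n2] n2 in auto)
      finally show ?thesis by (simp add: divide_right_mono)
    qed
    show "path_prob (B 3) \<le> K * avoid_rate 1 ^ T1"
      using path_prob_start_small[OF n5, of T1] by (simp add: B_def K_def)
    show "path_prob (B 4) \<le> K * ((real T2 + 1) / real n) * avoid_rate 1 ^ T1"
      using path_prob_turn[OF n5, of T2 T1] by (simp add: B_def K_def)
    show "path_prob (B 5) \<le> err_close n"
    proof -
      have "path_prob (B 5) \<le> real n * (K * avoid_rate 2 ^ T1 * (2 * (real T2 + 1) / real n + 33) ^ 4)"
        using path_prob_close_small[OF n5, of T1 T2] by (simp add: B_def K_def)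
      also have "\<dots> \<le> real n * (K * exp (- (7/4) * (3/4 * real n * ln (real n) - 1) / (real n - 1)) *
          (2 * (2 * real n * ln (real n) + 2) / real n + 33) ^ 4)"
      proof -
        have 1: "avoid_rate 2 ^ T1 \<le> exp (- (7/4) * (3/4 * real n * ln (real n) - 1) / (real n - 1))"
          using avoid_rate_early[OF n5, of 2] by (simp add: T1_def)
        have "2 * (real T2 + 1) \<le> 2 * (2 * real n * ln (real n) + 2)"
          using late_bounds(2)[OF n2] by (simp add: T2_def)
        then have "2 * (real T2 + 1) / real n \<le> 2 * (2 * real n * ln (real n) + 2) / real n"
          by (rule divide_right_mono) simp
        then have "(2 * (real T2 + 1) / real n + 33) ^ 4 \<le> (2 * (2 * real n * ln (real n) + 2) / real n + 33) ^ 4"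
          by (intro power_mono add_right_mono) auto
        then have "K * avoid_rate 2 ^ T1 * (2 * (real T2 + 1) / real n + 33) ^ 4 \<le>
            K * exp (- (7/4) * (3/4 * real n * ln (real n) - 1) / (real n - 1)) *
              (2 * (2 * real n * ln (real n) + 2) / real n + 33) ^ 4"
          by (intro mult_mono mult_left_mono 1) (auto simp: K_def)
        then show ?thesis by (rule mult_left_mono) simp
      qed
      finally show ?thesis by (simp only: err_close_def K_def)
    qed
    show "path_prob (B 6) \<le> 4 * 14 ^ 8 / real n"
      using path_prob_not_expanding[OF k(2), of T1] by (simp add: B_def)
    show "path_prob (B 7) \<le> err_boost n"
    proof -
      define \<kappa> where "\<kappa> = real k / (real n - 1)"
      define c where "c = (1 / (4 * 14 ^ 8) :: real)"
      \<comment> \<open>Rounding down loses at most a factor 2, because the quotient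
        \<open>k\<close> is at least 1.\<close>
      have "n \<le> 4 * 14 ^ 8 * k"
      proof -
        define N where "N = (2 * 14 ^ 8 :: nat)"
        have "n = N * k + n mod N" by (simp add: k_def N_def)
        moreover have "n mod N < N" by (simp add: N_def)
        moreover have "N * 1 \<le> N * k" using k(1) by (rule mult_le_mono2)
        ultimately have "n \<le> 2 * (N * k)" by linarith
        then show ?thesis by (simp add: N_def)
      qed
      then have "real n \<le> real (4 * 14 ^ 8 * k)" by (rule of_nat_mono)
      then have c: "c \<le> \<kappa>" "0 < c"
        using n2 by (simp_all add: c_def \<kappa>_def field_simps)
      have \<kappa>: "\<kappa> \<le> 1" using k by (simp add: \<kappa>_def)
      define Gn where "Gn = T1 div 2 - 1 - 2 * (10 * n)"
      have "3/4 * real n * ln (real n) - 1 \<le> real T1" unfolding T1_def by (rule early_bounds) (rule n2)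
      moreover have "real T1 \<le> 2 * real (T1 div 2) + 1"
        using of_nat_mono[of T1 "2 * (T1 div 2) + 1", where 'a = real] by simp
      moreover have "real (T1 div 2) - 1 - 20 * real n \<le> real Gn" by (simp add: Gn_def)
      ultimately have G: "3/8 * real n * ln (real n) - 3 - 20 * real n \<le> real Gn" by linarith
      have "(1 - \<kappa>\<^sup>2) ^ Gn \<le> exp (- (\<kappa>\<^sup>2 * real Gn))"
        by (rule one_minus_power_le_exp) (use \<kappa> c in \<open>simp add: power_le_one_iff\<close>)
      also have "\<dots> \<le> exp (- (c\<^sup>2 * (3/8 * real n * ln (real n) - 3 - 20 * real n)))"
      proof -
        have "c\<^sup>2 * (3/8 * real n * ln (real n) - 3 - 20 * real n) \<le> c\<^sup>2 * real Gn"
          using G by (intro mult_left_mono) auto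
        also have "\<dots> \<le> \<kappa>\<^sup>2 * real Gn" using c by (intro mult_right_mono power_mono) auto
        finally show ?thesis by simp
      qed
      finally have 1: "(1 - \<kappa>\<^sup>2) ^ Gn \<le> exp (- (c\<^sup>2 * (3/8 * real n * ln (real n) - 3 - 20 * real n)))" .
      have 2: "ln (real n) ^ (10 * n) = exp (10 * real n * ln (ln (real n)))"
        using ln1 by (simp add: exp_of_nat_mult[of "10 * n", simplified] ln_realpow exp_ln)
      have 3: "exp ((real T2 + 1) / ln (real n)) \<le> exp ((2 * real n * ln (real n) + 2) / ln (real n))"
        using late_bounds(2)[OF n2] ln1 by (simp add: T2_def divide_right_mono)
      have 4: "(4::real) ^ (10 * n) = exp (10 * real n * ln 4)"
        using exp_of_nat_mult[of "10 * n" "ln (4::real)"] by simp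
      have "path_prob (B 7) \<le> ln (real n) ^ (10 * n) * exp ((real T2 + 1) / ln (real n)) * (4 ^ (10 * n) * (1 - \<kappa>\<^sup>2) ^ Gn)"
        using path_prob_no_booster[OF k(3) ln1, of T2 "10 * n" T1] by (simp add: B_def \<kappa>_def Gn_def)
      also have "\<dots> \<le> exp (10 * real n * ln (ln (real n))) * exp ((2 * real n * ln (real n) + 2) / ln (real n)) *
          (exp (10 * real n * ln 4) * exp (- (c\<^sup>2 * (3/8 * real n * ln (real n) - 3 - 20 * real n))))"
        unfolding 2 4 using 1 3 \<kappa> c by (intro mult_mono) (auto simp: power_le_one_iff)
      also have "\<dots> = err_boost n"
        unfolding err_boost_def c_def by (simp only: mult_exp_exp) (simp add: algebra_simps)
      finally show ?thesis .
    qed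
  qed
  also have "\<dots> \<le> err n"
  proof -
    define e where "e = exp (- (7/8) * (3/4 * real n * ln (real n) - 1) / (real n - 1))"
    have "avoid_rate 1 ^ T1 \<le> e" using avoid_rate_early[OF n5, of 1] by (simp add: T1_def e_def)
    moreover have "(real T2 + 1) / real n \<le> (2 * real n * ln (real n) + 2) / real n"
      using late_bounds(2)[OF n2] by (intro divide_right_mono) (auto simp: T2_def)
    ultimately have "K * (1 + (real T2 + 1) / real n) * avoid_rate 1 ^ T1 \<le> K * (1 + (2 * real n * ln (real n) + 2) / real n) * e"
      using avoid_rate_bounds[OF n5, of 1] ln1 by (intro mult_mono) (auto simp: K_def)
    then show ?thesis by (simp add: err_def K_def e_def algebra_simps)
  qed
  finally show ?thesis .
qed

end

theorem theorem2:
  fixes M :: "nat \<Rightarrow> 'a measure" and X :: "nat \<Rightarrow> nat \<Rightarrow> 'a \<Rightarrow> nat"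
  assumes "\<And>n. n \<ge> 2 \<Longrightarrow> complete_graph_walk (M n) n (X n)"
  shows "(\<lambda>n. \<P>(\<omega> in M n. hamilton_time n (\<lambda>t. X n t \<omega>) = cover_time n (\<lambda>t. X n t \<omega>) + 1))
    \<longlonglongrightarrow> 1"
proof (rule tendsto_sandwich)
  have ge2: "4 * 14 ^ 8 \<le> n \<Longrightarrow> 2 \<le> n" for n :: nat by simp
  show "\<forall>\<^sub>F n in sequentially. 1 - err n \<le>
      \<P>(\<omega> in M n. hamilton_time n (\<lambda>t. X n t \<omega>) = cover_time n (\<lambda>t. X n t \<omega>) + 1)"
  proof (rule eventually_sequentiallyI)
    fix n :: nat assume n: "4 * 14 ^ 8 \<le> n"
    interpret complete_graph_walk "M n" n "X n" by (rule assms) (rule ge2[OF n])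
    let ?H = "{\<omega> \<in> space (M n). hamilton_time n (\<lambda>t. X n t \<omega>) = cover_time n (\<lambda>t. X n t \<omega>) + 1}"
    have "prob (space (M n) - ?H) = 1 - prob ?H" by (rule prob_compl[OF hamilton_event_sets])
    moreover have "space (M n) - ?H = {\<omega> \<in> space (M n). hamilton_time n (\<lambda>t. X n t \<omega>) \<noteq> cover_time n (\<lambda>t. X n t \<omega>) + 1}"
      by auto
    ultimately show "1 - err n \<le> prob ?H" using path_prob_not_hamilton[OF n] by (simp add: path_prob_def)
  qed
  show "\<forall>\<^sub>F n in sequentially.
      \<P>(\<omega> in M n. hamilton_time n (\<lambda>t. X n t \<omega>) = cover_time n (\<lambda>t. X n t \<omega>) + 1) \<le> 1"
  proof (rule eventually_sequentiallyI)
    fix n :: nat assume n: "2 \<le> n"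
    interpret complete_graph_walk "M n" n "X n" by (rule assms) (rule n)
    show "prob {\<omega> \<in> space (M n). hamilton_time n (\<lambda>t. X n t \<omega>) = cover_time n (\<lambda>t. X n t \<omega>) + 1} \<le> 1"
      by (rule prob_le_1)
  qed
  show "(\<lambda>n. 1 - err n) \<longlonglongrightarrow> 1" using tendsto_diff[OF tendsto_const err_tendsto, of 1] by simp
qed simp

end
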